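(* Fix an integer $n\geq 1$, $0<\rho\leq\infty$, and $I=(0,\rho)$. Let $g,h\in C^{2n-2}(I)$ be real-valued, and suppose that for all $x\in I$, $\mathcal{H}_n(h;x)\succ 0$ and $h^{(r)}(x)>0$ for all integers $0\leq r\leq n-1$. Define $$\gamma_n(h,g;x):=\lambda_{\max}\!\left(\mathcal{H}_n(h;x)^{-1/2}\,\mathcal{H}_n(g;x)\,\mathcal{H}_n(h;x)^{-1/2}\right)$$ and $$\mathcal{K}_n(h,g;I):=\sup_{x\in I}\max\biggl\{0,\ \max_{0\leq r\leq n-1}\frac{g^{(r)}(x)}{h^{(r)}(x)},\ \gamma_n(h,g;x)\biggr\}\in[0,\infty].$$ Then, for every real $K\geq 0$, the following assertions are equivalent: (i) $g[A]\preceq K\,h[A]$ for every $A\in\mathbb{P}_n(I)$; (ii) $K\geq\mathcal{K}_n(h,g;I)$. Therefore, a finite constant $K\ge 0$ satisfying (i) exists if and only if $\mathcal{K}_n(h,g;I)<\infty$.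
   Context: $\mathbb{P}_n(I)$ denotes the set of real symmetric positive semidefinite $n\times n$ matrices all of whose entries lie in $I$; $f[A]:=[f(a_{ij})]$ is the entrywise application of $f$. $B\succ 0$ (resp. $B\succeq 0$) means $B$ is positive definite (resp. semidefinite), and $B\preceq C$ means $C-B\succeq 0$. $\mathcal{E}:=x\frac{d}{dx}$ is the Euler derivative, $\mathcal{E}^k$ its $k$-fold iterate, and $\mathcal{H}_n(f;x):=[\mathcal{E}^{i+j}f(x)]_{i,j=0}^{n-1}$. $\lambda_{\max}(B)$ is the largest eigenvalue of a real symmetric matrix $B$. *)

theory Defs
  imports
    "HOL-Analysis.Interval_Integral"
    "Jordan_Normal_Form.Spectral_Radius"
    "Jordan_Normal_Form.Gauss_Jordan_Elimination"
begin

(* Matrices and vectors are those of Jordan_Normal_Form, so that the dimension n is a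
   natural number and Hankel indices i + j make sense. *)
no_notation Finite_Cartesian_Product.vec_nth (infixl "$" 90)
no_notation Inner_Product.real_inner_class.inner (infix "\<bullet>" 70)

subsection \<open>Real symmetric matrices\<close>

definition psd_mat :: "real mat \<Rightarrow> bool" where
  "psd_mat A \<longleftrightarrow> square_mat A \<and> A\<^sup>T = A \<and>
     (\<forall>v \<in> carrier_vec (dim_row A). 0 \<le> v \<bullet> (A *\<^sub>v v))"

definition pd_mat :: "real mat \<Rightarrow> bool" where
  "pd_mat A \<longleftrightarrow> square_mat A \<and> A\<^sup>T = A \<and>
     (\<forall>v \<in> carrier_vec (dim_row A). v \<noteq> 0\<^sub>v (dim_row A) \<longrightarrow> 0 < v \<bullet> (A *\<^sub>v v))"

definition loewner_le :: "real mat \<Rightarrow> real mat \<Rightarrow> bool" (infix "\<preceq>\<^sub>L" 50) where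
  "B \<preceq>\<^sub>L C \<longleftrightarrow> dim_row B = dim_row C \<and> dim_col B = dim_col C \<and> psd_mat (C - B)"

definition psd_mats_in :: "nat \<Rightarrow> real set \<Rightarrow> real mat set" where
  "psd_mats_in n I = {A \<in> carrier_mat n n. psd_mat A \<and> (\<forall>i<n. \<forall>j<n. A $$ (i, j) \<in> I)}"

(* Meaningful for psd A only, which has exactly one psd square root. *)
definition mat_sqrt :: "real mat \<Rightarrow> real mat" where
  "mat_sqrt A = (THE S. psd_mat S \<and> S * S = A)"

(* mat_inverse returns None for a singular argument; here A is to be positive definite. *)
definition mat_inv_sqrt :: "real mat \<Rightarrow> real mat" where
  "mat_inv_sqrt A = mat_sqrt (the (mat_inverse A))"

(* Only for symmetric B: then all eigenvalues are real, so the real spectrum is everything. *)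
definition lambda_max :: "real mat \<Rightarrow> real" where
  "lambda_max B = Max (spectrum B)"

subsection \<open>Derivatives\<close>

(* For open S: deriv is the two-sided derivative, and all its iterates on S depend only
   on the values of f on S. *)
definition Ck_on :: "nat \<Rightarrow> (real \<Rightarrow> real) \<Rightarrow> real set \<Rightarrow> bool" where
  "Ck_on k f S \<longleftrightarrow>
     (\<forall>r<k. \<forall>x\<in>S. (deriv ^^ r) f field_differentiable (at x)) \<and>
     continuous_on S ((deriv ^^ k) f)"

definition euler :: "(real \<Rightarrow> real) \<Rightarrow> real \<Rightarrow> real" where
  "euler f = (\<lambda>x. x * deriv f x)"

definition hankel_euler :: "nat \<Rightarrow> (real \<Rightarrow> real) \<Rightarrow> real \<Rightarrow> real mat" where
  "hankel_euler n f x = mat n n (\<lambda>(i, j). (euler ^^ (i + j)) f x)"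

subsection \<open>The sharp constant\<close>

definition gamma_const :: "nat \<Rightarrow> (real \<Rightarrow> real) \<Rightarrow> (real \<Rightarrow> real) \<Rightarrow> real \<Rightarrow> real" where
  "gamma_const n h g x = lambda_max
     (mat_inv_sqrt (hankel_euler n h x) * hankel_euler n g x * mat_inv_sqrt (hankel_euler n h x))"

(* The supremum is taken in the extended reals and may be infinite. *)
definition K_const :: "nat \<Rightarrow> (real \<Rightarrow> real) \<Rightarrow> (real \<Rightarrow> real) \<Rightarrow> real set \<Rightarrow> ereal" where
  "K_const n h g I = (SUP x\<in>I. ereal (Max {0,
     Max ((\<lambda>r. (deriv ^^ r) g x / (deriv ^^ r) h x) ` {0..n-1}),
     gamma_const n h g x}))"

end

(* Put f = K h - g, so that (i) says that f preserves positivity on P_n(I), and (ii) that the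
   derivatives of f up to order n - 1 and the matrices H_n(f; x) are nonnegative.

   Necessity: test f on the matrices (a + t k l) and (x e^(d (k + l))), k, l < n, with finite difference
   weights, and let t, d tend to 0.

   Sufficiency: write psi(s) = f(e^s); the Hankel matrices of derivatives of psi are those of (ii).
   (1) Polya's theorem on Chebyshev systems, applied in both variables of psi(s + t), shows that
   definite Hankel matrices make every matrix (psi(s_i + s_j)) with distinct nodes nonsingular. Perturbing
   by a definite kernel, semidefinite Hankel matrices give f[A] >= 0 for A of rank one.
   (2) If psi is moreover bounded near minus infinity, then psi' has the same property in one dimension
   less: on n - 1 equally spaced nodes the quadratic forms are log-convex under shifts of the nodes, and
   a bounded log-convex function on a left half-line increases.
   (3) The FitzGerald-Horn induction on n then passes from rank one to arbitrary A. *)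

theory Submission
  imports Defs "HOL-Analysis.Function_Topology" "HOL-Combinatorics.Stirling"
begin

subsection \<open>Finite differences and families of derivatives\<close>

text \<open>Step (2) cannot be done pointwise: the matrix of psi^(i+j+1) is no principal submatrix
  of that of psi^(i+j). For f(x) = 1/x one has psi(s) = e^(-s), all of whose Hankel matrices are
  semidefinite of rank one, yet psi' < 0. What excludes this is global: \<open>I\<close> reaches
  down to 0, so psi is defined arbitrarily far to the left, and f >= 0, f' >= 0 keep it bounded
  there.

  Step (1) has only C^(2n-2) to work with, hence no integral representation of f. Polya's theorem
  gives nonsingularity but no sign. The sign comes from an extremal argument: were some quadratic
  form of the kernel negative, then adding the right multiple of a definite exponential kernel would
  produce a singular kernel with definite Hankel matrices.

  Step (3) needs only f' in dimension n - 1 because the difference between \<open>A\<close> and its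
  rank one part has a vanishing last row and column.

  Derivatives are carried as families \<open>F\<close>, so that passing from f to f' is an index
  shift and the substitution x = e^s yields a family again.\<close>

definition deriv_family :: "nat \<Rightarrow> (nat \<Rightarrow> real \<Rightarrow> real) \<Rightarrow> real set \<Rightarrow> bool" where
  "deriv_family m F S \<longleftrightarrow>
     (\<forall>k<m. \<forall>x\<in>S. (F k has_real_derivative F (Suc k) x) (at x)) \<and> continuous_on S (F m)"

lemma deriv_familyD:
  "deriv_family m F S \<Longrightarrow> k < m \<Longrightarrow> x \<in> S \<Longrightarrow> (F k has_real_derivative F (Suc k) x) (at x)"
  by (simp add: deriv_family_def)

lemma deriv_family_continuous:
  assumes "deriv_family m F S" "k \<le> m" shows "continuous_on S (F k)"
proof (cases "k = m")
  case True then show ?thesis using assms by (simp add: deriv_family_def)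
next
  case False
  then have "\<forall>x\<in>S. (F k has_real_derivative F (Suc k) x) (at x)"
    using assms by (simp add: deriv_family_def)
  then show ?thesis
    by (meson DERIV_isCont continuous_at_imp_continuous_on)
qed

lemma deriv_family_mono:
  assumes "deriv_family m F S" "k \<le> m" "T \<subseteq> S" shows "deriv_family k F T"
  using assms deriv_family_continuous[OF assms(1,2)]
  by (auto simp: deriv_family_def subset_iff intro: continuous_on_subset)

lemma deriv_family_shift:
  assumes "deriv_family (m + p) F S" shows "deriv_family m (\<lambda>k. F (k + p)) S"
  using assms by (auto simp: deriv_family_def)

definition fdiff :: "real \<Rightarrow> (real \<Rightarrow> real) \<Rightarrow> real \<Rightarrow> real" where
  "fdiff d f = (\<lambda>x. f (x + d) - f x)"

text \<open>Signed binomial coefficients (-1)^(m-k) (m choose k), given by the Pascal recursion that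
  mirrors one more application of \<open>fdiff\<close>.\<close>

fun fdiff_weight :: "nat \<Rightarrow> nat \<Rightarrow> real" where
  "fdiff_weight 0 k = (if k = 0 then 1 else 0)"
| "fdiff_weight (Suc m) k = (if k = 0 then 0 else fdiff_weight m (k - 1)) - fdiff_weight m k"

lemma fdiff_weight_eq_0: "m < k \<Longrightarrow> fdiff_weight m k = 0"
  by (induction m arbitrary: k) auto

text \<open>Any number \<open>n > m\<close> of terms is allowed, so that differences of different
  orders are vectors of one common length, to be paired with the same kernel.\<close>

lemma fdiff_funpow_eq_sum:
  assumes "m < n"
  shows "(fdiff d ^^ m) f x = (\<Sum>k<n. fdiff_weight m k * f (x + real k * d))"
  using assms
proof (induction m arbitrary: f)
  case 0
  have "(\<Sum>k<n. fdiff_weight 0 k * f (x + real k * d)) = (\<Sum>k<n. if k = 0 then f x else 0)"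
    by (rule sum.cong) auto
  then show ?case using 0 by simp
next
  case (Suc m)
  obtain n' where n': "n = Suc n'" using Suc.prems by (cases n) auto
  have z: "fdiff_weight m n' = 0" using Suc.prems n' by (simp add: fdiff_weight_eq_0)
  have "(\<Sum>k<n. fdiff_weight m k * f (x + real k * d + d))
      = (\<Sum>k<n'. fdiff_weight m k * f (x + real (Suc k) * d))"
    unfolding n' by (simp add: z algebra_simps)
  also have "\<dots> = (\<Sum>k<n. (if k = 0 then 0 else fdiff_weight m (k - 1)) * f (x + real k * d))"
    unfolding n' by (subst sum.lessThan_Suc_shift) simp
  finally have s: "(\<Sum>k<n. fdiff_weight m k * f (x + real k * d + d)) = \<dots>" .
  have "(fdiff d ^^ Suc m) f x = (fdiff d ^^ m) (fdiff d f) x"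
    by (simp add: funpow_swap1)
  also have "\<dots> = (\<Sum>k<n. fdiff_weight m k * f (x + real k * d + d)) -
                  (\<Sum>k<n. fdiff_weight m k * f (x + real k * d))"
    using Suc.IH[of "fdiff d f"] Suc.prems
    by (simp add: fdiff_def[of d f] right_diff_distrib sum_subtractf)
  also have "\<dots> = (\<Sum>k<n. fdiff_weight (Suc m) k * f (x + real k * d))"
    unfolding s by (simp add: left_diff_distrib sum_subtractf)
  finally show ?case .
qed

text \<open>Differencing commutes with differentiation, so the induction applies to the family of
  first differences and leaves a single mean value step.\<close>

lemma fdiff_funpow_mean_value:
  assumes "\<And>k y. k < m \<Longrightarrow> x \<le> y \<Longrightarrow> y \<le> x + real m * d
      \<Longrightarrow> (F k has_real_derivative F (Suc k) y) (at y)"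
    and "d > 0"
  shows "\<exists>y. x \<le> y \<and> y \<le> x + real m * d \<and> (fdiff d ^^ m) (F 0) x = d ^ m * F m y"
  using assms(1)
proof (induction m arbitrary: F)
  case 0
  then show ?case by auto
next
  case (Suc m)
  let ?G = "\<lambda>k. fdiff d (F k)"
  have "(?G k has_real_derivative ?G (Suc k) y) (at y)"
    if "k < m" "x \<le> y" "y \<le> x + real m * d" for k y
  proof -
    have 1: "(F k has_real_derivative F (Suc k) y) (at y)"
      by (rule Suc.prems) (use that \<open>d > 0\<close> in \<open>auto simp: algebra_simps\<close>)
    have "(F k has_real_derivative F (Suc k) (y + d)) (at (y + d))"
      by (rule Suc.prems) (use that \<open>d > 0\<close> in \<open>auto simp: algebra_simps\<close>)
    then have 2: "((\<lambda>y. F k (y + d)) has_real_derivative F (Suc k) (y + d)) (at y)"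
      by (simp add: DERIV_shift)
    show ?thesis unfolding fdiff_def by (intro DERIV_diff 1 2)
  qed
  then have "\<exists>y. x \<le> y \<and> y \<le> x + real m * d \<and> (fdiff d ^^ m) (?G 0) x = d ^ m * ?G m y"
    by (rule Suc.IH)
  then obtain y where y: "x \<le> y" "y \<le> x + real m * d"
    "(fdiff d ^^ m) (fdiff d (F 0)) x = d ^ m * fdiff d (F m) y" by auto
  have "\<exists>z>y. z < y + d \<and> F m (y + d) - F m y = (y + d - y) * F (Suc m) z"
    by (rule MVT2) (use y \<open>d > 0\<close> in \<open>auto intro!: Suc.prems simp: algebra_simps\<close>)
  then obtain z where z: "z > y" "z < y + d" "F m (y + d) - F m y = d * F (Suc m) z" by auto
  have "(fdiff d ^^ Suc m) (F 0) x = d ^ Suc m * F (Suc m) z"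
    using y(3) z(3) by (simp add: funpow_swap1 fdiff_def)
  moreover have "x \<le> z" "z \<le> x + real (Suc m) * d" using y z by (auto simp: algebra_simps)
  ultimately show ?case by blast
qed

lemma fdiff_quotient_tendsto:
  assumes F: "deriv_family m F S" and "open S" "x \<in> S"
  shows "((\<lambda>d. (fdiff d ^^ m) (F 0) x / d ^ m) \<longlongrightarrow> F m x) (at_right 0)"
proof -
  obtain e where e: "e > 0" "ball x e \<subseteq> S" using assms by (meson openE)
  define P where "P d y \<longleftrightarrow> x \<le> y \<and> y \<le> x + real m * d \<and> (fdiff d ^^ m) (F 0) x = d ^ m * F m y"
    for d y
  \<comment> \<open>A choice of intermediate point for each \<open>d\<close>, so that continuity of
    \<open>F m\<close> can be composed with \<open>Y d\<close> tending to \<open>x\<close>.\<close>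
  define Y where "Y d = (SOME y. P d y)" for d
  have ev: "\<forall>\<^sub>F d in at_right 0. P d (Y d) \<and> d > 0"
  proof -
    have "\<forall>\<^sub>F d in at_right (0::real). d < e / (real m + 1) \<and> d > 0"
      using e by (auto simp: eventually_at_right intro!: exI[of _ "e / (real m + 1)"])
    then show ?thesis
    proof (rule eventually_mono)
      fix d assume d: "d < e / (real m + 1) \<and> d > 0"
      then have "d * (real m + 1) < e" by (simp add: pos_less_divide_eq)
      then have md: "real m * d < e" using d by (simp add: algebra_simps)
      have "\<exists>y. P d y" unfolding P_def
      proof (rule fdiff_funpow_mean_value)
        fix k y assume "k < m" "x \<le> y" "y \<le> x + real m * d"
        then show "(F k has_real_derivative F (Suc k) y) (at y)"
          using md e(2) by (intro deriv_familyD[OF F]) (auto simp: dist_real_def subset_iff)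
      qed (use d in auto)
      then show "P d (Y d) \<and> d > 0" using d unfolding Y_def by (auto intro: someI_ex)
    qed
  qed
  have Ylim: "(Y \<longlongrightarrow> x) (at_right 0)"
  proof (rule tendsto_sandwich)
    show "\<forall>\<^sub>F d in at_right 0. x \<le> Y d" "\<forall>\<^sub>F d in at_right 0. Y d \<le> x + real m * d"
      using ev by (auto simp: P_def elim: eventually_mono)
    show "((\<lambda>d. x + real m * d) \<longlongrightarrow> x) (at_right 0)"
      by (auto intro!: tendsto_eq_intros)
  qed auto
  have "isCont (F m) x"
    using deriv_family_continuous[OF F order_refl] assms continuous_on_eq_continuous_at by blast
  then have "((\<lambda>d. F m (Y d)) \<longlongrightarrow> F m x) (at_right 0)"
    by (rule isCont_tendsto_compose[OF _ Ylim])
  moreover have "\<forall>\<^sub>F d in at_right 0. F m (Y d) = (fdiff d ^^ m) (F 0) x / d ^ m"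
    using ev by (rule eventually_mono) (auto simp: P_def)
  ultimately show ?thesis by (rule Lim_transform_eventually)
qed

lemma fdiff_funpow_power: "(fdiff 1 ^^ r) (\<lambda>x. x ^ r) 0 = fact r"
proof -
  let ?G = "\<lambda>k x::real. fact r / fact (r - k) * x ^ (r - k)"
  have "\<exists>y. 0 \<le> y \<and> y \<le> 0 + real r * 1 \<and> (fdiff 1 ^^ r) (?G 0) 0 = 1 ^ r * ?G r y"
  proof (rule fdiff_funpow_mean_value)
    have d: "((\<lambda>x. fact r / fact (Suc j) * x ^ Suc j) has_real_derivative fact r / fact j * y ^ j) (at y)"
      for j and y :: real
      by (rule DERIV_cong, (rule derivative_intros)+) (simp add: divide_simps)
    fix k and y :: real assume "k < r"
    then show "(?G k has_real_derivative ?G (Suc k) y) (at y)"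
      using d[of "r - Suc k" y] by (simp only: Suc_diff_Suc)
  qed simp
  then show ?thesis by auto
qed

text \<open>Nodes in arithmetic progression make the kernel depend on \<open>i + j\<close> only; a
  difference in each index then amounts to one difference of the total order. This is how Hankel
  matrices of derivatives arise.\<close>

lemma fdiff_double_sum:
  assumes "m < n" "k < n"
  shows "(\<Sum>i<n. \<Sum>j<n. fdiff_weight m i * fdiff_weight k j * f (x + real (i + j) * d))
    = (fdiff d ^^ (m + k)) f x"
proof -
  have "(fdiff d ^^ (m + k)) f x = (fdiff d ^^ m) ((fdiff d ^^ k) f) x"
    by (simp add: funpow_add)
  also have "\<dots> = (\<Sum>i<n. fdiff_weight m i * (\<Sum>j<n. fdiff_weight k j * f (x + real i * d + real j * d)))"
    using assms by (simp add: fdiff_funpow_eq_sum)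
  also have "\<dots> = (\<Sum>i<n. \<Sum>j<n. fdiff_weight m i * fdiff_weight k j * f (x + real (i + j) * d))"
    by (simp add: sum_distrib_left algebra_simps)
  finally show ?thesis by simp
qed

text \<open>The congruence by \<open>w\<close> in coordinates: the form of \<open>G\<close> at a
  combination of the rows of \<open>w\<close> is the form, in the coefficients \<open>a\<close>, of
  the transformed matrix.\<close>

lemma double_sum_substitution:
  fixes a :: "nat \<Rightarrow> real"
  shows "(\<Sum>k<m. \<Sum>l<m. (\<Sum>i<n. a i * w i k) * (\<Sum>j<n. a j * w j l) * G k l)
    = (\<Sum>i<n. \<Sum>j<n. a i * a j * (\<Sum>k<m. \<Sum>l<m. w i k * w j l * G k l))"
proof -
  have "(\<Sum>i<n. a i * w i k) * (\<Sum>j<n. a j * w j l) * G k l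
    = (\<Sum>i<n. \<Sum>j<n. a i * a j * (w i k * w j l * G k l))" for k l
  proof -
    have "(\<Sum>i<n. a i * w i k) * (\<Sum>j<n. a j * w j l) * G k l
      = (\<Sum>i<n. \<Sum>j<n. (a i * w i k) * (a j * w j l)) * G k l" by (simp only: sum_product)
    also have "\<dots> = (\<Sum>i<n. \<Sum>j<n. (a i * w i k) * (a j * w j l) * G k l)"
      by (simp only: sum_distrib_right)
    finally show ?thesis by (simp only: mult_ac)
  qed
  then have "(\<Sum>k<m. \<Sum>l<m. (\<Sum>i<n. a i * w i k) * (\<Sum>j<n. a j * w j l) * G k l)
    = (\<Sum>k<m. \<Sum>l<m. \<Sum>i<n. \<Sum>j<n. a i * a j * (w i k * w j l * G k l))" by simp
  also have "\<dots> = (\<Sum>k<m. \<Sum>i<n. \<Sum>l<m. \<Sum>j<n. a i * a j * (w i k * w j l * G k l))"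
    by (rule sum.cong[OF refl], rule sum.swap)
  also have "\<dots> = (\<Sum>i<n. \<Sum>k<m. \<Sum>l<m. \<Sum>j<n. a i * a j * (w i k * w j l * G k l))"
    by (rule sum.swap)
  also have "\<dots> = (\<Sum>i<n. \<Sum>k<m. \<Sum>j<n. \<Sum>l<m. a i * a j * (w i k * w j l * G k l))"
    by (rule sum.cong[OF refl], rule sum.cong[OF refl], rule sum.swap)
  also have "\<dots> = (\<Sum>i<n. \<Sum>j<n. \<Sum>k<m. \<Sum>l<m. a i * a j * (w i k * w j l * G k l))"
    by (rule sum.cong[OF refl], rule sum.swap)
  finally show ?thesis by (simp only: sum_distrib_left)
qed

text \<open>A test vector assembled from scaled difference weights turns the kernel into the Hankel
  form of difference quotients, whose limit is the claim. The shift \<open>p\<close> is 0 for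
  necessity and 1 in \<open>hankel_deriv_nonneg\<close>, where the kernel is that of a first
  difference.\<close>

lemma hankel_nonneg_of_kernel:
  assumes F: "deriv_family (2 * n - 2 + p) F S" and S: "open S" "x \<in> S"
    and ker: "\<forall>\<^sub>F d in at_right 0. \<forall>q. 0 \<le> (\<Sum>i<n. \<Sum>j<n. q i * q j * (fdiff d ^^ p) (F 0) (x + real (i + j) * d))"
  shows "0 \<le> (\<Sum>i<n. \<Sum>j<n. c i * c j * F (i + j + p) x)"
proof -
  let ?T = "\<lambda>d. \<Sum>i<n. \<Sum>j<n. c i * c j * ((fdiff d ^^ (i + j + p)) (F 0) x / d ^ (i + j + p))"
  have "(?T \<longlongrightarrow> (\<Sum>i<n. \<Sum>j<n. c i * c j * F (i + j + p) x)) (at_right 0)"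
    by (intro tendsto_sum tendsto_mult tendsto_const fdiff_quotient_tendsto[where S = S]
        deriv_family_mono[OF F] S) auto
  moreover have "\<forall>\<^sub>F d in at_right 0. 0 \<le> ?T d"
    using eventually_conj[OF ker eventually_at_right_less[of 0]]
  proof (rule eventually_mono)
    fix d :: real
    assume d: "(\<forall>q. 0 \<le> (\<Sum>i<n. \<Sum>j<n. q i * q j * (fdiff d ^^ p) (F 0) (x + real (i + j) * d))) \<and> 0 < d"
    let ?g = "(fdiff d ^^ p) (F 0)"
    \<comment> \<open>Entry \<open>k\<close> collects the weights at node \<open>k\<close> of all
      the differences of order \<open>i\<close>, each divided by \<open>d ^ i\<close>. The factor
      \<open>d ^ p\<close> still missing from the quotients is positive and is split off at the
      end.\<close>
    define q where "q k = (\<Sum>i<n. c i / d ^ i * fdiff_weight i k)" for k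
    from d have "0 \<le> (\<Sum>k<n. \<Sum>l<n. q k * q l * ?g (x + real (k + l) * d))" by simp
    also have "\<dots> = (\<Sum>i<n. \<Sum>j<n. c i / d ^ i * (c j / d ^ j) *
          (\<Sum>k<n. \<Sum>l<n. fdiff_weight i k * fdiff_weight j l * ?g (x + real (k + l) * d)))"
      unfolding q_def by (rule double_sum_substitution)
    also have "\<dots> = (\<Sum>i<n. \<Sum>j<n. c i / d ^ i * (c j / d ^ j) * ((fdiff d ^^ (i + j)) ?g x))"
      by (rule sum.cong[OF refl], rule sum.cong[OF refl], subst fdiff_double_sum) auto
    also have "\<dots> = d ^ p * ?T d"
      using d unfolding sum_distrib_left by (intro sum.cong refl) (simp add: funpow_add power_add)
    finally have "0 \<le> d ^ p * ?T d" .
    moreover have "0 < d ^ p" using d by simp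
    ultimately show "0 \<le> ?T d" by (meson mult_pos_neg not_le)
  qed
  ultimately show ?thesis by (rule tendsto_lowerbound) simp
qed

text \<open>Contract both indices with the weights of an \<open>r\<close>th difference. Over
  \<open>l\<close> this is a difference with step \<open>t k\<close>, asymptotically
  \<open>(t k)^r F r a\<close>; over \<open>k\<close> it is the \<open>r\<close>th difference of
  \<open>k^r\<close>, which is \<open>fact r\<close>. Division by \<open>t^r\<close> leaves
  \<open>fact r * F r a\<close> in the limit.\<close>

lemma deriv_nonneg_of_product_kernel:
  assumes F: "deriv_family r F S" and S: "open S" "a \<in> S" and r: "r < n"
    and ker: "\<forall>\<^sub>F t in at_right 0. \<forall>v. 0 \<le> (\<Sum>k<n. \<Sum>l<n. v k * v l * F 0 (a + t * real k * real l))"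
  shows "0 \<le> F r a"
proof -
  let ?w = "fdiff_weight r"
  let ?T = "\<lambda>t. \<Sum>k<n. ?w k * ((fdiff (t * real k) ^^ r) (F 0) a / t ^ r)"
  have lim: "((\<lambda>t. (fdiff (t * real k) ^^ r) (F 0) a / t ^ r) \<longlongrightarrow> real k ^ r * F r a) (at_right 0)" for k
  \<comment> \<open>For \<open>k = 0\<close> the step is constantly 0 and does not approach 0 from
    the right. There both sides vanish, or equal \<open>F 0 a\<close> when
    \<open>r = 0\<close>.\<close>
  proof (cases "k = 0")
    case True
    have "(fdiff 0 ^^ r) f a = (if r = 0 then f a else 0)" for f
      by (cases r) (auto simp: fdiff_def)
    then show ?thesis using True by (auto simp: power_0_left)
  next
    case False
    have "filterlim (\<lambda>t. t * real k) (at_right 0) (at_right 0)"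
    proof (rule tendsto_imp_filterlim_at_right)
      show "((\<lambda>t. t * real k) \<longlongrightarrow> 0) (at_right 0)" by (auto intro!: tendsto_eq_intros)
      show "\<forall>\<^sub>F t in at_right 0. 0 < t * real k"
        using eventually_at_right_less[of 0] by (rule eventually_mono) (use False in auto)
    qed
    from filterlim_compose[OF fdiff_quotient_tendsto[OF F S] this]
    have "((\<lambda>t. real k ^ r * ((fdiff (t * real k) ^^ r) (F 0) a / (t * real k) ^ r))
        \<longlongrightarrow> real k ^ r * F r a) (at_right 0)"
      by (intro tendsto_mult tendsto_const)
    then show ?thesis using False by (simp add: power_mult_distrib)
  qed
  have "(?T \<longlongrightarrow> (\<Sum>k<n. ?w k * (real k ^ r * F r a))) (at_right 0)"
    by (intro tendsto_sum tendsto_mult tendsto_const lim)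
  also have "(\<Sum>k<n. ?w k * (real k ^ r * F r a)) = fact r * F r a"
    using fdiff_funpow_eq_sum[OF r, of 1 "\<lambda>x. x ^ r" 0]
    by (simp add: fdiff_funpow_power sum_distrib_right mult.assoc)
  finally have T: "(?T \<longlongrightarrow> fact r * F r a) (at_right 0)" .
  have "\<forall>\<^sub>F t in at_right 0. 0 \<le> ?T t"
    using eventually_conj[OF ker eventually_at_right_less[of 0]]
  proof (rule eventually_mono)
    fix t :: real
    assume t: "(\<forall>v. 0 \<le> (\<Sum>k<n. \<Sum>l<n. v k * v l * F 0 (a + t * real k * real l))) \<and> 0 < t"
    have "?T t = (\<Sum>k<n. \<Sum>l<n. ?w k * ?w l * F 0 (a + t * real k * real l)) / t ^ r"
      by (simp add: fdiff_funpow_eq_sum[OF r] sum_distrib_left sum_divide_distrib mult_ac)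
    then show "0 \<le> ?T t" using t by simp
  qed
  with T have "0 \<le> fact r * F r a" by (rule tendsto_lowerbound) simp
  then show ?thesis using fact_gt_zero[of r, where 'a = real] by (auto simp: zero_le_mult_iff)
qed

subsection \<open>Quadratic forms and the spectral theorem\<close>

text \<open>Vectors are functions on all of \<open>nat\<close>. Pinning the coordinates from
  \<open>N\<close> on to 0 makes the cube a product of compact sets, and Tychonoff's theorem
  applies.\<close>

lemma compact_unit_cube:
  "compact {v :: nat \<Rightarrow> real. (\<forall>i<N. \<bar>v i\<bar> \<le> 1) \<and> (\<forall>i\<ge>N. v i = 0)}"
proof -
  let ?S = "\<lambda>i. if i < N then {-1..1::real} else {0}"
  have "compactin (product_topology (\<lambda>i::nat. euclidean) UNIV) (PiE UNIV ?S)"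
    by (subst compactin_PiE) (auto simp: compact_Icc)
  moreover have "PiE UNIV ?S = {v. (\<forall>i<N. \<bar>v i\<bar> \<le> 1) \<and> (\<forall>i\<ge>N. v i = 0)}"
    by (auto simp: PiE_UNIV_domain Pi_iff abs_le_iff split: if_splits)
  ultimately show ?thesis by (simp add: euclidean_product_topology)
qed

text \<open>Matrices are plain functions read on the first \<open>N\<close> indices, so that passing
  to a leading block or to one dimension more changes only \<open>N\<close>.\<close>

definition quad :: "nat \<Rightarrow> (nat \<Rightarrow> nat \<Rightarrow> real) \<Rightarrow> (nat \<Rightarrow> real) \<Rightarrow> real" where
  "quad N M v = (\<Sum>i<N. \<Sum>j<N. v i * v j * M i j)"

definition dotp :: "nat \<Rightarrow> (nat \<Rightarrow> real) \<Rightarrow> (nat \<Rightarrow> real) \<Rightarrow> real" where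
  "dotp N u v = (\<Sum>i<N. u i * v i)"

definition mulv :: "nat \<Rightarrow> (nat \<Rightarrow> nat \<Rightarrow> real) \<Rightarrow> (nat \<Rightarrow> real) \<Rightarrow> nat \<Rightarrow> real" where
  "mulv N M v i = (\<Sum>j<N. M i j * v j)"

definition sym_on :: "nat \<Rightarrow> (nat \<Rightarrow> nat \<Rightarrow> real) \<Rightarrow> bool" where
  "sym_on N M \<longleftrightarrow> (\<forall>i<N. \<forall>j<N. M i j = M j i)"

definition pos_def :: "nat \<Rightarrow> (nat \<Rightarrow> nat \<Rightarrow> real) \<Rightarrow> bool" where
  "pos_def N M \<longleftrightarrow> (\<forall>v. (\<exists>i<N. v i \<noteq> 0) \<longrightarrow> 0 < quad N M v)"

lemma dotp_commute: "dotp N u v = dotp N v u"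
  by (simp add: dotp_def mult.commute)

lemma quad_eq_dotp: "quad N M v = dotp N v (mulv N M v)"
  by (simp add: quad_def dotp_def mulv_def sum_distrib_left mult_ac)

lemma dotp_add_right: "dotp N u (\<lambda>i. v i + w i) = dotp N u v + dotp N u w"
  and dotp_diff_right: "dotp N u (\<lambda>i. v i - w i) = dotp N u v - dotp N u w"
  and dotp_scale_right: "dotp N u (\<lambda>i. a * v i) = a * dotp N u v"
  by (simp_all add: dotp_def algebra_simps sum.distrib sum_subtractf sum_distrib_left)

lemma mulv_scale: "mulv N M (\<lambda>i. a * v i) = (\<lambda>i. a * mulv N M v i)"
  by (simp add: mulv_def fun_eq_iff algebra_simps sum_distrib_left)

lemma dotp_mulv_sym:
  assumes "sym_on N M" shows "dotp N u (mulv N M v) = dotp N v (mulv N M u)"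
proof -
  have "dotp N u (mulv N M v) = (\<Sum>i<N. \<Sum>j<N. u i * M i j * v j)"
    by (simp add: dotp_def mulv_def sum_distrib_left mult_ac)
  also have "\<dots> = (\<Sum>j<N. \<Sum>i<N. u i * M i j * v j)" by (rule sum.swap)
  also have "\<dots> = (\<Sum>j<N. \<Sum>i<N. u i * M j i * v j)"
    using assms by (intro sum.cong refl) (auto simp: sym_on_def)
  also have "\<dots> = dotp N v (mulv N M u)"
    by (simp add: dotp_def mulv_def sum_distrib_left mult_ac)
  finally show ?thesis .
qed

lemma quad_add_scale:
  assumes "sym_on N M"
  shows "quad N M (\<lambda>i. w i + t * z i)
    = quad N M w + 2 * t * dotp N z (mulv N M w) + t\<^sup>2 * quad N M z"
proof -
  have "quad N M (\<lambda>i. w i + t * z i) = quad N M w + t * dotp N z (mulv N M w)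
      + t * dotp N w (mulv N M z) + t\<^sup>2 * quad N M z"
    unfolding quad_def dotp_def mulv_def
    by (simp add: algebra_simps sum.distrib sum_distrib_left power2_eq_square)
  then show ?thesis using dotp_mulv_sym[OF assms, of w z] by simp
qed

lemma linear_term_zero:
  fixes b c :: real
  assumes "\<And>t. 0 \<le> 2 * t * b + t\<^sup>2 * c"
  shows "b = 0"
proof (rule ccontr)
  assume "b \<noteq> 0"
  have c: "c \<ge> 0" using assms[of 1] assms[of "-1"] by simp
  \<comment> \<open>The minimiser would be \<open>t = - b / c\<close>; the denominator
    \<open>c + 1\<close> stays positive when \<open>c = 0\<close>, and the value is still
    negative.\<close>
  have "0 \<le> 2 * (- b / (c + 1)) * b + (- b / (c + 1))\<^sup>2 * c" by (rule assms)
  also have "\<dots> = - (b\<^sup>2 * (c + 2)) / (c + 1)\<^sup>2"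
    using c by (simp add: divide_simps power2_eq_square) (simp add: algebra_simps)
  also have "\<dots> < 0" using c \<open>b \<noteq> 0\<close> by (simp add: divide_simps)
  finally show False by simp
qed

lemma dotp_pos: "\<exists>i<N. v i \<noteq> 0 \<Longrightarrow> 0 < dotp N v v"
proof -
  assume "\<exists>i<N. v i \<noteq> 0"
  then obtain i where "i < N" "v i \<noteq> 0" by blast
  then show ?thesis unfolding dotp_def
    by (intro sum_pos2[where i = i]) (auto simp: zero_less_mult_iff linorder_neq_iff)
qed

text \<open>The quotient of the two forms attains its minimum on the Euclidean unit sphere of the
  orthogonal complement of \<open>F\<close>. With \<open>E = ident\<close> and earlier eigenvectors
  in \<open>F\<close> this drives the spectral theorem; with \<open>F\<close> empty and general
  \<open>E\<close> it solves a generalized eigenvalue problem.\<close>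

lemma rayleigh_minimizer:
  fixes F :: "(nat \<Rightarrow> real) set"
  assumes M: "sym_on N M" and E: "sym_on N E" and pd: "pos_def N E"
    and v0: "\<exists>i<N. v0 i \<noteq> 0" "\<forall>u\<in>F. dotp N u v0 = 0"
  obtains w \<mu> where "\<exists>i<N. w i \<noteq> 0" "\<forall>u\<in>F. dotp N u w = 0"
    "\<And>z. \<forall>u\<in>F. dotp N u z = 0 \<Longrightarrow> \<mu> * quad N E z \<le> quad N M z"
    "\<And>z. \<forall>u\<in>F. dotp N u z = 0 \<Longrightarrow> dotp N z (mulv N M w) = \<mu> * dotp N z (mulv N E w)"
proof -
  define K where "K = {v :: nat \<Rightarrow> real. (\<forall>i<N. \<bar>v i\<bar> \<le> 1) \<and> (\<forall>i\<ge>N. v i = 0)} \<inter>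
     ({v. dotp N v v = 1} \<inter> (\<Inter>u\<in>F. {v. dotp N u v = 0}))"
  have "closed ({v. dotp N v v = 1} \<inter> (\<Inter>u\<in>F. {v. dotp N u v = 0}))"
    unfolding dotp_def
    by (intro closed_Int closed_INT ballI closed_Collect_eq continuous_intros
        continuous_on_product_coordinates)
  then have comp: "compact K" unfolding K_def by (intro compact_Int_closed compact_unit_cube)
  have KE: "quad N E v > 0" if "v \<in> K" for v
  proof -
    have "\<exists>i<N. v i \<noteq> 0"
    proof (rule ccontr)
      assume "\<not> ?thesis"
      then have "dotp N v v = 0" by (simp add: dotp_def)
      with that show False by (simp add: K_def)
    qed
    then show ?thesis using pd by (auto simp: pos_def_def)
  qed
  have norm: "\<exists>r>0. (\<lambda>i. if i < N then v i / r else 0) \<in> K"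
    if v: "\<exists>i<N. v i \<noteq> 0" "\<forall>u\<in>F. dotp N u v = 0" for v
  proof -
    define r where "r = sqrt (dotp N v v)"
    have pos: "dotp N v v > 0"
      by (rule dotp_pos[OF v(1)])
    then have r: "r > 0" "r\<^sup>2 = dotp N v v" by (auto simp: r_def)
    have le: "\<bar>v i / r\<bar> \<le> 1" if "i < N" for i
    proof -
      have "(v i)\<^sup>2 \<le> dotp N v v"
        unfolding dotp_def power2_eq_square using that
        by (intro member_le_sum[where f = "\<lambda>i. v i * v i"]) auto
      then have "\<bar>v i\<bar> \<le> r" using r by (metis abs_le_square_iff abs_of_pos)
      then show ?thesis using r by simp
    qed
    have "dotp N u (\<lambda>i. if i < N then v i / r else 0) = dotp N u v / r" for u
      by (simp add: dotp_def sum_divide_distrib)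
    moreover have "dotp N (\<lambda>i. if i < N then v i / r else 0) (\<lambda>i. if i < N then v i / r else 0) = dotp N v v / r\<^sup>2"
      by (simp add: dotp_def sum_divide_distrib power2_eq_square)
    ultimately show ?thesis
      using le v r pos by (intro exI[of _ r]) (auto simp: K_def)
  qed
  have ne: "K \<noteq> {}" using norm[OF v0] by blast
  have "continuous_on K (quad N A)" for A
    unfolding quad_def
    by (intro continuous_intros continuous_on_subset[OF continuous_on_product_coordinates]) auto
  then have cont: "continuous_on K (\<lambda>v. quad N M v / quad N E v)"
    using KE by (intro continuous_on_divide) force+
  from continuous_attains_inf[OF comp ne cont] obtain w where w: "w \<in> K"
    "\<And>v. v \<in> K \<Longrightarrow> quad N M w / quad N E w \<le> quad N M v / quad N E v" by blast
  define \<mu> where "\<mu> = quad N M w / quad N E w"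
  have w1: "\<exists>i<N. w i \<noteq> 0"
  proof (rule ccontr)
    assume "\<not> ?thesis"
    then have "dotp N w w = 0" by (simp add: dotp_def)
    with w(1) show False by (simp add: K_def)
  qed
  have w2: "\<forall>u\<in>F. dotp N u w = 0" using w(1) by (auto simp: K_def)
  have min: "\<mu> * quad N E z \<le> quad N M z" if z: "\<forall>u\<in>F. dotp N u z = 0" for z
  proof (cases "\<exists>i<N. z i \<noteq> 0")
    case True
    then obtain r where r: "r > 0" "(\<lambda>i. if i < N then z i / r else 0) \<in> K"
      using norm z by blast
    have q: "quad N A (\<lambda>i. if i < N then z i / r else 0) = quad N A z / r\<^sup>2" for A
      by (simp add: quad_def sum_divide_distrib power2_eq_square)
    have "\<mu> \<le> quad N M z / quad N E z"
      using w(2)[OF r(2)] r(1) by (simp add: q \<mu>_def)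
    moreover have "quad N E z > 0" using pd True by (auto simp: pos_def_def)
    ultimately show ?thesis by (simp add: pos_le_divide_eq)
  next
    case False
    then show ?thesis by (simp add: quad_def)
  qed
  have eq: "quad N M w = \<mu> * quad N E w" using KE[OF w(1)] by (simp add: \<mu>_def)
  \<comment> \<open>First variation: along \<open>w + t z\<close> the form of
    \<open>M - \<mu> E\<close> is nonnegative and vanishes at \<open>t = 0\<close>, so its linear
    term in \<open>t\<close> is zero.\<close>
  have "dotp N z (mulv N M w) - \<mu> * dotp N z (mulv N E w) = 0"
    if z: "\<forall>u\<in>F. dotp N u z = 0" for z
  proof (rule linear_term_zero)
    fix t
    have "\<mu> * quad N E (\<lambda>i. w i + t * z i) \<le> quad N M (\<lambda>i. w i + t * z i)"
      using w2 z by (intro min) (simp add: dotp_add_right dotp_scale_right)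
    then show "0 \<le> 2 * t * (dotp N z (mulv N M w) - \<mu> * dotp N z (mulv N E w))
        + t\<^sup>2 * (quad N M z - \<mu> * quad N E z)"
      unfolding quad_add_scale[OF M] quad_add_scale[OF E] eq by (simp add: algebra_simps)
  qed
  then show thesis using that[OF w1 w2 min] by simp
qed

section \<open>Eigenvectors and the spectral theorem\<close>

definition ident :: "nat \<Rightarrow> nat \<Rightarrow> real" where
  "ident i j = (if i = j then 1 else 0)"

lemma mulv_ident: "i < N \<Longrightarrow> mulv N ident v i = v i"
proof -
  assume "i < N"
  have "mulv N ident v i = (\<Sum>j<N. if i = j then v j else 0)"
    unfolding mulv_def ident_def by (intro sum.cong) auto
  then show ?thesis using \<open>i < N\<close> by simp
qed

lemma dotp_mulv_ident: "dotp N u (mulv N ident v) = dotp N u v"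
  unfolding dotp_def by (intro sum.cong) (auto simp: mulv_ident)

lemma quad_ident: "quad N ident v = dotp N v v"
  by (simp add: quad_eq_dotp dotp_mulv_ident)

lemma sym_ident: "sym_on N ident" and pos_def_ident: "pos_def N ident"
  by (auto simp: sym_on_def ident_def pos_def_def quad_ident dotp_pos)

lemma dotp_eqI:
  assumes "\<And>z. dotp N z u = dotp N z v" "i < N" shows "u i = v i"
proof -
  have "dotp N (\<lambda>j. u j - v j) (\<lambda>j. u j - v j) = 0"
    unfolding dotp_diff_right using assms(1) by simp
  then show ?thesis using dotp_pos[of N "\<lambda>j. u j - v j"] assms(2) by force
qed

text \<open>Here \<open>\<mu>\<close> is the least eigenvalue of the pencil of \<open>M\<close> and
  \<open>E\<close>. It measures how much of \<open>E\<close> must be added to \<open>M\<close> to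
  reach the boundary of the semidefinite cone, which is what \<open>kernel_nonneg_distinct\<close>
  exploits.\<close>

lemma rayleigh_eigenvector:
  assumes M: "sym_on N M" and E: "sym_on N E" "pos_def N E" and "N > 0"
  obtains w \<mu> where "\<exists>i<N. w i \<noteq> 0" "\<And>z. \<mu> * quad N E z \<le> quad N M z"
    "\<And>i. i < N \<Longrightarrow> mulv N M w i = \<mu> * mulv N E w i"
proof -
  have "\<exists>i<N. (\<lambda>_. 1 :: real) i \<noteq> 0" using \<open>N > 0\<close> by auto
  from rayleigh_minimizer[OF M E this, of "{}"] obtain w \<mu> where w: "\<exists>i<N. w i \<noteq> 0"
    "\<And>z. \<mu> * quad N E z \<le> quad N M z"
    "\<And>z. dotp N z (mulv N M w) = \<mu> * dotp N z (mulv N E w)" by auto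
  have "mulv N M w i = (\<lambda>i. \<mu> * mulv N E w i) i" if "i < N" for i
    by (rule dotp_eqI[OF _ that]) (simp add: dotp_scale_right w(3))
  then show thesis using that w by blast
qed

text \<open>For a square matrix the left and right kernels vanish together, since the determinant is
  invariant under transposition. In the Chebyshev arguments this exchanges the roles of functions
  and nodes.\<close>

lemma transpose_injective:
  fixes a :: "nat \<Rightarrow> nat \<Rightarrow> real"
  assumes inj: "\<And>c. (\<And>j. j < N \<Longrightarrow> (\<Sum>i<N. c i * a i j) = 0) \<Longrightarrow> \<forall>i<N. c i = 0"
    and d: "\<And>i. i < N \<Longrightarrow> (\<Sum>j<N. a i j * d j) = 0"
  shows "\<forall>j<N. d j = 0"
proof -
  define A where "A = mat N N (\<lambda>(i, j). a i j)"
  have A: "A \<in> carrier_mat N N" by (simp add: A_def)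
  have "det A\<^sup>T \<noteq> 0"
  proof
    assume "det A\<^sup>T = 0"
    then obtain v where v: "v \<in> carrier_vec N" "v \<noteq> 0\<^sub>v N" "A\<^sup>T *\<^sub>v v = 0\<^sub>v N"
      using det_0_iff_vec_prod_zero[of "A\<^sup>T" N] A by auto
    have "(\<Sum>i<N. v $ i * a i j) = 0" if "j < N" for j
    proof -
      have "(A\<^sup>T *\<^sub>v v) $ j = (\<Sum>i<N. v $ i * a i j)"
        using that v(1) by (auto simp: A_def scalar_prod_def atLeast0LessThan mult.commute intro!: sum.cong)
      then show ?thesis using v(3) that by simp
    qed
    from inj[of "\<lambda>i. v $ i", OF this] have "v = 0\<^sub>v N" using v(1) by auto
    with v(2) show False by simp
  qed
  then have "det A \<noteq> 0" using det_transpose[OF A] by simp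
  then have nz: "A *\<^sub>v v = 0\<^sub>v N \<Longrightarrow> v \<in> carrier_vec N \<Longrightarrow> v = 0\<^sub>v N" for v
    using det_0_iff_vec_prod_zero[OF A] by blast
  have "A *\<^sub>v vec N d = 0\<^sub>v N"
    using d by (auto simp: A_def scalar_prod_def atLeast0LessThan intro!: eq_vecI)
  from nz[OF this] have "vec N d = 0\<^sub>v N" by simp
  then show ?thesis by (metis index_vec index_zero_vec(1))
qed

lemma exists_orthogonal:
  assumes "k < N"
  shows "\<exists>v. (\<exists>i<N. v i \<noteq> 0) \<and> (\<forall>l<k. dotp N (e l) v = 0)"
proof -
  define A where "A = mat N N (\<lambda>(l, i). if l < k then e l i else 0)"
  have A: "A \<in> carrier_mat N N" by (simp add: A_def)
  have "\<exists>d. (\<forall>j<N. (\<Sum>i<N. (if j < k then e j i else 0) * d i) = 0) \<and> (\<exists>i<N. d i \<noteq> 0)"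
  proof (rule ccontr)
    assume no: "\<not> ?thesis"
    \<comment> \<open>The \<open>k\<close> conditions are padded by zero rows to a square system.
      The indicator of the padded rows lies in its left kernel, so an injective system would force
      that indicator to vanish, although its entry at \<open>k\<close> is 1.\<close>
    have "\<forall>i<N. (if i < k then 0 else 1 :: real) = 0"
    proof (rule transpose_injective)
      fix c assume "\<And>j. j < N \<Longrightarrow> (\<Sum>i<N. c i * (if j < k then e j i else 0)) = 0"
      then have "\<forall>j<N. (\<Sum>i<N. (if j < k then e j i else 0) * c i) = 0" by (simp add: mult.commute)
      then show "\<forall>i<N. c i = 0" using no by blast
    next
      fix i assume "i < N"
      show "(\<Sum>j<N. (if j < k then e j i else 0) * (if j < k then 0 else 1)) = 0"
        by (rule sum.neutral) auto
    qed
    then show False using assms by auto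
  qed
  then obtain d where d: "\<forall>j<N. (\<Sum>i<N. (if j < k then e j i else 0) * d i) = 0" "\<exists>i<N. d i \<noteq> 0"
    by blast
  have "dotp N (e l) d = 0" if "l < k" for l
    using d(1)[rule_format, of l] that assms by (simp add: dotp_def)
  then show ?thesis using d(2) by blast
qed

lemma exists_orthonormal_eigenvectors:
  assumes M: "sym_on N M" and "k \<le> N"
  shows "\<exists>e lam. (\<forall>l<k. \<forall>m<k. dotp N (e l) (e m) = ident l m) \<and>
      (\<forall>l<k. \<forall>i<N. mulv N M (e l) i = lam l * e l i)"
  using \<open>k \<le> N\<close>
proof (induction k)
  case 0
  then show ?case by simp
next
  case (Suc k)
  then obtain e lam where e: "\<And>l m. l < k \<Longrightarrow> m < k \<Longrightarrow> dotp N (e l) (e m) = ident l m"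
    and ev: "\<And>l i. l < k \<Longrightarrow> i < N \<Longrightarrow> mulv N M (e l) i = lam l * e l i"
    by (metis Suc_leD)
  obtain v where v: "\<exists>i<N. v i \<noteq> 0" "\<forall>l<k. dotp N (e l) v = 0"
    using exists_orthogonal[of k N e] Suc.prems by auto
  have "\<forall>u \<in> e ` {..<k}. dotp N u v = 0" using v by auto
  from rayleigh_minimizer[OF M sym_ident pos_def_ident v(1) this] obtain w \<mu> where
    w1: "\<exists>i<N. w i \<noteq> 0" and w2: "\<forall>u \<in> e ` {..<k}. dotp N u w = 0"
    and w3: "\<And>z. \<forall>u \<in> e ` {..<k}. dotp N u z = 0 \<Longrightarrow> dotp N z (mulv N M w) = \<mu> * dotp N z (mulv N ident w)"
    by metis
  have w: "\<exists>i<N. w i \<noteq> 0" "\<And>l. l < k \<Longrightarrow> dotp N (e l) w = 0" using w1 w2 by auto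
  have cr: "dotp N z (mulv N M w) = \<mu> * dotp N z w" if "\<And>l. l < k \<Longrightarrow> dotp N (e l) z = 0" for z
    using w3[of z] that by (simp add: dotp_mulv_ident)
  have orth: "dotp N (e l) (mulv N M w) = 0" if "l < k" for l
  proof -
    have "dotp N (e l) (mulv N M w) = dotp N w (mulv N M (e l))" by (rule dotp_mulv_sym[OF M])
    also have "\<dots> = dotp N w (\<lambda>i. lam l * e l i)"
      unfolding dotp_def using ev that by (intro sum.cong) auto
    finally show ?thesis using w(2)[OF that] by (simp add: dotp_scale_right dotp_commute)
  qed
  \<comment> \<open>Stationarity is known only against vectors orthogonal to the earlier
    \<open>e l\<close>. By \<open>orth\<close> the residual \<open>?z\<close> is such a vector, so
    it may be tested against itself.\<close>
  have eig: "mulv N M w i = \<mu> * w i" if "i < N" for i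
  proof -
    let ?z = "\<lambda>i. mulv N M w i - \<mu> * w i"
    have "dotp N ?z (mulv N M w) = \<mu> * dotp N ?z w"
      by (rule cr) (simp add: dotp_diff_right dotp_scale_right orth w(2))
    then have "dotp N ?z ?z = 0" by (simp add: dotp_diff_right dotp_scale_right)
    then show ?thesis using dotp_pos[of N ?z] that by force
  qed
  define r where "r = sqrt (dotp N w w)"
  have r: "r > 0" "dotp N w w = r * r" using dotp_pos[OF w(1)] by (auto simp: r_def)
  define e' where "e' l = (if l = k then (\<lambda>i. 1 / r * w i) else e l)" for l
  define lam' where "lam' l = (if l = k then \<mu> else lam l)" for l
  have ww: "dotp N (\<lambda>i. 1 / r * w i) (\<lambda>i. 1 / r * w i) = 1"
    using r unfolding dotp_scale_right dotp_commute[of N "\<lambda>i. 1 / r * w i"]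
    by (simp add: dotp_scale_right divide_simps)
  have we: "dotp N (e l) (\<lambda>i. 1 / r * w i) = 0" "dotp N (\<lambda>i. 1 / r * w i) (e l) = 0" if "l < k" for l
    using w(2)[OF that] by (simp_all only: dotp_scale_right dotp_commute[of N "\<lambda>i. 1 / r * w i"] mult_zero_right)
  have "dotp N (e' l) (e' m) = ident l m" if "l < Suc k" "m < Suc k" for l m
    using that e ww we by (auto simp: e'_def ident_def less_Suc_eq simp del: times_divide_eq_left)
  moreover have "mulv N M (e' l) i = lam' l * e' l i" if "l < Suc k" "i < N" for l i
    using that ev eig by (auto simp: e'_def lam'_def less_Suc_eq mulv_scale simp del: times_divide_eq_left)
  ultimately show ?case by blast
qed

lemma orthonormal_complete:
  assumes e: "\<And>l m. l < N \<Longrightarrow> m < N \<Longrightarrow> dotp N (e l) (e m) = ident l m"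
    and "i < N" "j < N"
  shows "(\<Sum>k<N. e k i * e k j) = ident i j"
proof -
  define U where "U = mat N N (\<lambda>(k, i). e k i)"
  have U: "U \<in> carrier_mat N N" by (simp add: U_def)
  have "U * U\<^sup>T = 1\<^sub>m N"
    using e by (intro eq_matI) (auto simp: U_def scalar_prod_def atLeast0LessThan dotp_def ident_def)
  then have "U\<^sup>T * U = 1\<^sub>m N" using U mat_mult_left_right_inverse[of U N "U\<^sup>T"] by simp
  then have "(U\<^sup>T * U) $$ (i, j) = ident i j" using assms by (simp add: ident_def)
  then show ?thesis using assms by (simp add: U_def scalar_prod_def atLeast0LessThan)
qed

lemma spectral_decomposition:
  assumes M: "sym_on N M"
  obtains e lam where "\<And>l m. l < N \<Longrightarrow> m < N \<Longrightarrow> dotp N (e l) (e m) = ident l m"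
    and "\<And>l i. l < N \<Longrightarrow> i < N \<Longrightarrow> mulv N M (e l) i = lam l * e l i"
    and "\<And>i j. i < N \<Longrightarrow> j < N \<Longrightarrow> M i j = (\<Sum>k<N. lam k * e k i * e k j)"
proof -
  obtain e lam where e: "\<And>l m. l < N \<Longrightarrow> m < N \<Longrightarrow> dotp N (e l) (e m) = ident l m"
    and ev: "\<And>l i. l < N \<Longrightarrow> i < N \<Longrightarrow> mulv N M (e l) i = lam l * e l i"
    using exists_orthonormal_eigenvectors[OF M order_refl] by blast
  have "M i j = (\<Sum>k<N. lam k * e k i * e k j)" if ij: "i < N" "j < N" for i j
  proof -
    have "(\<Sum>k<N. lam k * e k i * e k j) = (\<Sum>k<N. mulv N M (e k) i * e k j)"
      using ev ij by simp
    also have "\<dots> = (\<Sum>k<N. \<Sum>l<N. M i l * (e k l * e k j))"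
      by (simp add: mulv_def sum_distrib_left mult_ac)
    also have "\<dots> = (\<Sum>l<N. M i l * (\<Sum>k<N. e k l * e k j))"
      by (subst sum.swap) (simp add: sum_distrib_left)
    also have "\<dots> = (\<Sum>l<N. if l = j then M i l else 0)"
      using ij by (intro sum.cong) (auto simp: orthonormal_complete[OF e] ident_def)
    finally show ?thesis using ij by simp
  qed
  then show thesis using that e ev by blast
qed

text \<open>Expanding \<open>A\<close> over its eigenvectors, with nonnegative eigenvalues, writes
  the form of the entrywise product as a nonnegative combination of forms of \<open>B\<close> at the
  vectors \<open>v i * e k i\<close>.\<close>

lemma schur_product:
  assumes "sym_on N A" "\<And>v. 0 \<le> quad N A v" "\<And>v. 0 \<le> quad N B v"
  shows "0 \<le> quad N (\<lambda>i j. A i j * B i j) v"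
proof -
  obtain e lam where e: "\<And>l m. l < N \<Longrightarrow> m < N \<Longrightarrow> dotp N (e l) (e m) = ident l m"
    and ev: "\<And>l i. l < N \<Longrightarrow> i < N \<Longrightarrow> mulv N A (e l) i = lam l * e l i"
    and A: "\<And>i j. i < N \<Longrightarrow> j < N \<Longrightarrow> A i j = (\<Sum>k<N. lam k * e k i * e k j)"
    using spectral_decomposition[OF assms(1)] by blast
  have "lam k \<ge> 0" if "k < N" for k
  proof -
    have "quad N A (e k) = dotp N (e k) (\<lambda>i. lam k * e k i)"
      unfolding quad_eq_dotp unfolding dotp_def using ev that by (intro sum.cong) auto
    then show ?thesis using assms(2)[of "e k"] e[OF that that] by (simp add: dotp_scale_right ident_def)
  qed
  moreover have "quad N (\<lambda>i j. A i j * B i j) v = (\<Sum>k<N. lam k * quad N B (\<lambda>i. v i * e k i))"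
  proof -
    have "quad N (\<lambda>i j. A i j * B i j) v
      = (\<Sum>i<N. \<Sum>j<N. \<Sum>k<N. lam k * ((v i * e k i) * (v j * e k j) * B i j))"
      unfolding quad_def by (intro sum.cong refl) (simp add: A sum_distrib_left sum_distrib_right mult_ac)
    also have "\<dots> = (\<Sum>k<N. \<Sum>i<N. \<Sum>j<N. lam k * ((v i * e k i) * (v j * e k j) * B i j))"
      by (subst (2) sum.swap, subst sum.swap) (rule refl)
    finally show ?thesis by (simp add: quad_def sum_distrib_left)
  qed
  ultimately show ?thesis using assms(3) by (auto intro!: sum_nonneg)
qed

subsection \<open>Chebyshev systems\<close>

text \<open>The class C^m with its derivatives quantified away: \<open>chebyshev_system\<close>
  works with iterated quotients and derivatives, for which no closed form is wanted, only closure
  properties.\<close>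

fun times_diff :: "nat \<Rightarrow> (real \<Rightarrow> real) \<Rightarrow> real set \<Rightarrow> bool" where
  "times_diff 0 f S \<longleftrightarrow> continuous_on S f"
| "times_diff (Suc m) f S \<longleftrightarrow>
     (\<exists>f'. (\<forall>x\<in>S. (f has_real_derivative f' x) (at x)) \<and> times_diff m f' S)"

lemma times_diff_continuous: "times_diff m f S \<Longrightarrow> continuous_on S f"
  by (cases m) (auto intro!: continuous_at_imp_continuous_on dest: DERIV_isCont)

lemma times_diff_SucD: "times_diff (Suc m) f S \<Longrightarrow> times_diff m f S"
  by (induction m arbitrary: f) (auto intro!: continuous_at_imp_continuous_on dest: DERIV_isCont)

lemma times_diff_add: "times_diff m f S \<Longrightarrow> times_diff m g S \<Longrightarrow> times_diff m (\<lambda>x. f x + g x) S"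
proof (induction m arbitrary: f g)
  case 0 then show ?case by (auto intro: continuous_intros)
next
  case (Suc m)
  then obtain f' g' where "\<forall>x\<in>S. (f has_real_derivative f' x) (at x)" "times_diff m f' S"
    "\<forall>x\<in>S. (g has_real_derivative g' x) (at x)" "times_diff m g' S" by auto
  then show ?case using Suc.IH[of f' g']
    by (auto intro!: exI[of _ "\<lambda>x. f' x + g' x"] DERIV_add)
qed

lemma times_diff_mult: "times_diff m f S \<Longrightarrow> times_diff m g S \<Longrightarrow> times_diff m (\<lambda>x. f x * g x) S"
proof (induction m arbitrary: f g)
  case 0 then show ?case by (auto intro: continuous_intros)
next
  case (Suc m)
  then obtain f' g' where d: "\<forall>x\<in>S. (f has_real_derivative f' x) (at x)" "times_diff m f' S"
    "\<forall>x\<in>S. (g has_real_derivative g' x) (at x)" "times_diff m g' S" by auto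
  have "times_diff m (\<lambda>x. f' x * g x + f x * g' x) S"
    by (intro times_diff_add Suc.IH d(2) d(4) times_diff_SucD[OF Suc.prems(1)]
        times_diff_SucD[OF Suc.prems(2)])
  moreover have "((\<lambda>x. f x * g x) has_real_derivative f' x * g x + f x * g' x) (at x)" if "x \<in> S" for x
    using DERIV_mult'[of f "f' x" x UNIV g "g' x"] d that by (simp add: add.commute)
  ultimately show ?case unfolding times_diff.simps
    by (intro exI[of _ "\<lambda>x. f' x * g x + f x * g' x"] conjI ballI)
qed

lemma times_diff_const: "times_diff m (\<lambda>_. c) S"
proof (induction m arbitrary: c)
  case (Suc m)
  have "\<forall>x\<in>S. ((\<lambda>_. c) has_real_derivative 0) (at x)" by simp
  with Suc[of 0] show ?case unfolding times_diff.simps by (intro exI[of _ "\<lambda>_. 0"] conjI)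
qed simp

lemma times_diff_inverse:
  "times_diff m f S \<Longrightarrow> \<forall>x\<in>S. f x \<noteq> 0 \<Longrightarrow> times_diff m (\<lambda>x. inverse (f x)) S"
proof (induction m arbitrary: f)
  case 0 then show ?case by (auto intro: continuous_intros)
next
  case (Suc m)
  then obtain f' where d: "\<forall>x\<in>S. (f has_real_derivative f' x) (at x)" "times_diff m f' S" by auto
  have "times_diff m (\<lambda>x. inverse (f x)) S"
    using Suc.IH[OF times_diff_SucD[OF Suc.prems(1)] Suc.prems(2)] .
  then have "times_diff m (\<lambda>x. - 1 * (inverse (f x) * f' x * inverse (f x))) S"
    using d by (intro times_diff_mult times_diff_const)
  moreover have "((\<lambda>x. inverse (f x)) has_real_derivative - 1 * (inverse (f x) * f' x * inverse (f x))) (at x)"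
    if "x \<in> S" for x
    using DERIV_inverse'[of f "f' x" x UNIV] d(1) Suc.prems(2) that by simp
  ultimately show ?case unfolding times_diff.simps
    by (intro exI[of _ "\<lambda>x. - 1 * (inverse (f x) * f' x * inverse (f x))"] conjI ballI)
qed

lemma times_diff_divide:
  "times_diff m f S \<Longrightarrow> times_diff m g S \<Longrightarrow> \<forall>x\<in>S. g x \<noteq> 0 \<Longrightarrow> times_diff m (\<lambda>x. f x / g x) S"
  unfolding divide_inverse by (intro times_diff_mult times_diff_inverse)

lemma times_diff_deriv_family: "deriv_family m F S \<Longrightarrow> times_diff m (F 0) S"
proof (induction m arbitrary: F)
  case 0 then show ?case by (simp add: deriv_family_def)
next
  case (Suc m)
  have "times_diff m (F 1) S"
    using Suc.IH[OF deriv_family_shift[of m 1 F]] Suc.prems by simp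
  then show ?case using deriv_familyD[OF Suc.prems] by (auto intro!: exI[of _ "F 1"])
qed

section \<open>Order of vanishing at a point\<close>

definition vanishes_at :: "nat \<Rightarrow> (real \<Rightarrow> real) \<Rightarrow> real \<Rightarrow> bool" where
  "vanishes_at k f t \<longleftrightarrow> ((\<lambda>x. f x / (x - t) ^ k) \<longlongrightarrow> 0) (at t)"

lemma vanishes_at_mono:
  assumes "vanishes_at k f t" "j \<le> k" shows "vanishes_at j f t"
proof -
  have "((\<lambda>x. f x / (x - t) ^ k * (x - t) ^ (k - j)) \<longlongrightarrow> 0 * (t - t) ^ (k - j)) (at t)"
    using assms(1) unfolding vanishes_at_def by (intro tendsto_intros)
  moreover have "\<forall>\<^sub>F x in at t. f x / (x - t) ^ k * (x - t) ^ (k - j) = f x / (x - t) ^ j"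
    using assms(2) by (auto simp: eventually_at_filter power_diff)
  ultimately have "((\<lambda>x. f x / (x - t) ^ j) \<longlongrightarrow> 0 * (t - t) ^ (k - j)) (at t)"
    by (rule Lim_transform_eventually)
  then show ?thesis by (simp add: vanishes_at_def)
qed

lemma vanishes_at_mult_cont:
  assumes "vanishes_at k f t" "isCont g t" shows "vanishes_at k (\<lambda>x. g x * f x) t"
proof -
  have "((\<lambda>x. g x * (f x / (x - t) ^ k)) \<longlongrightarrow> g t * 0) (at t)"
    using assms unfolding vanishes_at_def isCont_def by (intro tendsto_mult)
  then show ?thesis by (simp add: vanishes_at_def)
qed

lemma vanishes_at_cong:
  assumes "open S" "t \<in> S" "\<And>x. x \<in> S \<Longrightarrow> f x = g x"
  shows "vanishes_at k f t \<longleftrightarrow> vanishes_at k g t"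
  unfolding vanishes_at_def
  by (rule tendsto_cong) (use assms in \<open>auto simp: eventually_at_topological\<close>)

text \<open>By the mean value theorem \<open>F x = (x - t) * f y\<close> with \<open>y\<close>
  between \<open>t\<close> and \<open>x\<close>; the factor \<open>x - t\<close> raises the order by
  one.\<close>

lemma vanishes_at_integrate:
  assumes "open S" "t \<in> S" and d: "\<And>x. x \<in> S \<Longrightarrow> (F has_real_derivative f x) (at x)"
    and "F t = 0" and van: "vanishes_at k f t"
  shows "vanishes_at (Suc k) F t"
  unfolding vanishes_at_def
proof (rule LIM_I)
  fix e :: real assume "0 < e"
  then obtain d1 where d1: "d1 > 0" "\<And>x. x \<noteq> t \<Longrightarrow> \<bar>x - t\<bar> < d1 \<Longrightarrow> \<bar>f x / (x - t) ^ k\<bar> < e"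
    using LIM_D[OF van[unfolded vanishes_at_def]] by (metis diff_zero real_norm_def)
  obtain d2 where d2: "d2 > 0" "ball t d2 \<subseteq> S" using assms by (meson openE)
  show "\<exists>s>0. \<forall>x. x \<noteq> t \<and> norm (x - t) < s \<longrightarrow> norm (F x / (x - t) ^ Suc k - 0) < e"
  proof (intro exI conjI allI impI)
    show "min d1 d2 > 0" using d1 d2 by simp
    fix x assume x: "x \<noteq> t \<and> norm (x - t) < min d1 d2"
    have inS: "y \<in> S" if "\<bar>y - t\<bar> \<le> \<bar>x - t\<bar>" for y
      using that x d2(2) by (auto simp: dist_real_def subset_iff)
    \<comment> \<open>\<open>y \<noteq> t\<close> matters: the limit in \<open>vanishes_at\<close>
      says nothing about the value at \<open>t\<close> itself.\<close>
    have "\<exists>y. \<bar>y - t\<bar> \<le> \<bar>x - t\<bar> \<and> y \<noteq> t \<and> F x = (x - t) * f y"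
    proof (cases "x < t")
      case True
      have "\<exists>y>x. y < t \<and> F t - F x = (t - x) * f y"
        by (rule MVT2) (use True in \<open>auto intro!: d inS\<close>)
      then obtain y where "y > x" "y < t" "F t - F x = (t - x) * f y" by blast
      then show ?thesis using \<open>F t = 0\<close> by (intro exI[of _ y]) (auto simp: algebra_simps)
    next
      case False
      have "\<exists>y>t. y < x \<and> F x - F t = (x - t) * f y"
        by (rule MVT2) (use False x in \<open>auto intro!: d inS\<close>)
      then obtain y where "y > t" "y < x" "F x - F t = (x - t) * f y" by blast
      then show ?thesis using \<open>F t = 0\<close> by (intro exI[of _ y]) auto
    qed
    then obtain y where y: "\<bar>y - t\<bar> \<le> \<bar>x - t\<bar>" "y \<noteq> t" "F x = (x - t) * f y" by blast
    have "\<bar>f y\<bar> < e * \<bar>y - t\<bar> ^ k"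
      using d1(2)[of y] y x by (simp add: abs_divide power_abs divide_simps split: if_splits)
    also have "\<dots> \<le> e * \<bar>x - t\<bar> ^ k"
      using y \<open>e > 0\<close> by (intro mult_left_mono power_mono) auto
    finally have "\<bar>f y\<bar> / \<bar>x - t\<bar> ^ k < e" using x by (simp add: pos_divide_less_eq)
    then show "norm (F x / (x - t) ^ Suc k - 0) < e"
      using x y(3) by (simp add: abs_divide abs_mult power_abs)
  qed
qed

text \<open>The \<open>k\<close>th difference quotient at \<open>t\<close> is evaluated in two ways:
  it tends to \<open>F k t\<close>, and it tends to 0 term by term because \<open>F 0\<close> is
  o(d^k) at every node \<open>t + i d\<close>.\<close>

lemma deriv_family_vanishes_at:
  assumes F: "deriv_family m F S" and S: "open S" "t \<in> S" and "vanishes_at m (F 0) t" "k \<le> m"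
  shows "F k t = 0"
proof -
  have van: "vanishes_at k (F 0) t" by (rule vanishes_at_mono) fact+
  have lim: "((\<lambda>d. (fdiff d ^^ k) (F 0) t / d ^ k) \<longlongrightarrow> F k t) (at_right 0)"
    by (rule fdiff_quotient_tendsto[OF deriv_family_mono[OF F \<open>k \<le> m\<close> order_refl] S])
  have "((\<lambda>d. F 0 (t + real i * d) / d ^ k) \<longlongrightarrow> 0) (at_right 0)" if "i \<noteq> 0" for i
  proof -
    have "filterlim (\<lambda>d. t + real i * d) (at t) (at_right 0)"
      unfolding filterlim_at
    proof
      show "((\<lambda>d. t + real i * d) \<longlongrightarrow> t) (at_right 0)" by (auto intro!: tendsto_eq_intros)
      show "\<forall>\<^sub>F d in at_right 0. t + real i * d \<in> UNIV \<and> t + real i * d \<noteq> t"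
        using eventually_at_right_less[of 0] by (rule eventually_mono) (use that in auto)
    qed
    from filterlim_compose[OF van[unfolded vanishes_at_def] this]
    have "((\<lambda>d. real i ^ k * (F 0 (t + real i * d) / (real i * d) ^ k)) \<longlongrightarrow> real i ^ k * 0) (at_right 0)"
      by (intro tendsto_mult tendsto_const) simp
    then show ?thesis using that by (simp add: power_mult_distrib)
  qed
  \<comment> \<open>The node \<open>i = 0\<close> is \<open>t\<close> itself, outside the punctured
    limit; continuity supplies its value.\<close>
  moreover have "F 0 t = 0"
  proof -
    have "(F 0 \<longlongrightarrow> 0) (at t)" using vanishes_at_mono[OF van, of 0] by (simp add: vanishes_at_def)
    moreover have "isCont (F 0) t"
      using deriv_family_continuous[OF F, of 0] S continuous_on_eq_continuous_at by blast
    ultimately show ?thesis using LIM_unique by (auto simp: isCont_def)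
  qed
  ultimately have l: "((\<lambda>d. F 0 (t + real i * d) / d ^ k) \<longlongrightarrow> 0) (at_right 0)" for i
    by (cases "i = 0") auto
  have "((\<lambda>d. \<Sum>i<Suc k. fdiff_weight k i * (F 0 (t + real i * d) / d ^ k)) \<longlongrightarrow> (\<Sum>i<Suc k. fdiff_weight k i * 0))
      (at_right 0)"
    by (intro tendsto_sum tendsto_mult tendsto_const l)
  then have "((\<lambda>d. (fdiff d ^^ k) (F 0) t / d ^ k) \<longlongrightarrow> 0) (at_right 0)"
    by (simp add: fdiff_funpow_eq_sum[of k "Suc k"] sum_divide_distrib add_divide_distrib)
  with lim show ?thesis using tendsto_unique trivial_limit_at_right_real by blast
qed

text \<open>Rolle's theorem between neighbouring zeros. The bound by \<open>Max Z\<close> is carried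
  through the induction to keep the new zeros distinct: the earlier ones lie below
  \<open>Max W\<close>, the last one above it.\<close>

lemma rolle_zeros:
  fixes f :: "real \<Rightarrow> real"
  assumes "finite Z" "card Z = Suc m" "Z \<subseteq> S" "is_interval S"
    and "\<And>x. x \<in> S \<Longrightarrow> (f has_real_derivative f' x) (at x)" "\<And>z. z \<in> Z \<Longrightarrow> f z = 0"
  shows "\<exists>Z'. finite Z' \<and> card Z' = m \<and> Z' \<subseteq> S \<and> (\<forall>z\<in>Z'. f' z = 0 \<and> z < Max Z)"
  using assms(1-3,6)
proof (induction m arbitrary: Z)
  case 0
  then show ?case by (intro exI[of _ "{}"]) auto
next
  case (Suc m)
  define W where "W = Z - {Max Z}"
  have Z: "Z \<noteq> {}" "Max Z \<in> Z" using Suc.prems by (auto intro!: Max_in)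
  have W: "finite W" "card W = Suc m" "W \<subseteq> Z" "W \<noteq> {}"
  proof -
    show "finite W" "W \<subseteq> Z" using Suc.prems by (auto simp: W_def)
    show c: "card W = Suc m" using Suc.prems Z by (simp add: W_def)
    show "W \<noteq> {}" using c by auto
  qed
  have MW: "Max W \<in> W" using W by (intro Max_in)
  have lt: "Max W < Max Z"
  proof -
    have "Max W \<in> Z" "Max W \<noteq> Max Z" using MW by (auto simp: W_def)
    then show ?thesis using Max_ge[OF Suc.prems(1), of "Max W"] by simp
  qed
  have "Max W \<in> S" "Max Z \<in> S" using MW W(3) Z(2) Suc.prems(3) by blast+
  then have inS: "x \<in> S" if "Max W \<le> x" "x \<le> Max Z" for x
    using that \<open>is_interval S\<close> by (meson mem_is_interval_1_I)
  have "W \<subseteq> S" "\<And>z. z \<in> W \<Longrightarrow> f z = 0" using W Suc.prems by auto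
  from Suc.IH[OF W(1,2) this] obtain Z' where Z':
    "finite Z'" "card Z' = m" "Z' \<subseteq> S" "\<forall>z\<in>Z'. f' z = 0 \<and> z < Max W" by blast
  have "\<exists>z>Max W. z < Max Z \<and> f (Max Z) - f (Max W) = (Max Z - Max W) * f' z"
    by (rule MVT2) (use lt assms(5) inS in auto)
  moreover have "f (Max Z) = 0" "f (Max W) = 0" using Suc.prems(4) MW W(3) Z(2) by blast+
  ultimately obtain z where z: "z > Max W" "z < Max Z" "f' z = 0"
    using lt by (auto simp del: Max_less_iff Max_gr_iff)
  have "z \<notin> Z'" using Z' z by force
  then show ?case using Z' z lt inS[of z]
    by (intro exI[of _ "insert z Z'"]) auto
qed

text \<open>Polya's criterion for a Chebyshev system, by induction: divide by the first function,
  differentiate, and apply Rolle's theorem. Phrasing vanishing to order \<open>k\<close> as \<open>o((x - t)^k)\<close>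
  makes the hypothesis stable under both operations, so no Wronskians are needed.\<close>

lemma chebyshev_system:
  fixes u :: "nat \<Rightarrow> real \<Rightarrow> real"
  assumes "open S" "is_interval S"
    and "\<And>i. i \<le> m \<Longrightarrow> times_diff m (u i) S"
    and "\<And>k t c. k \<le> m \<Longrightarrow> t \<in> S \<Longrightarrow> vanishes_at k (\<lambda>x. \<Sum>i\<le>k. c i * u i x) t \<Longrightarrow> \<forall>i\<le>k. c i = 0"
    and "finite Z" "card Z = Suc m" "Z \<subseteq> S" "\<And>z. z \<in> Z \<Longrightarrow> (\<Sum>i\<le>m. c i * u i z) = 0"
  shows "\<forall>i\<le>m. c i = 0"
  using assms(3-)
proof (induction m arbitrary: u c Z)
  case 0
  obtain z where z: "z \<in> Z" using 0 by fastforce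
  then have "z \<in> S" using 0 by auto
  have "isCont (u 0) z"
    using times_diff_continuous[OF "0.prems"(1)[of 0]] \<open>open S\<close> \<open>z \<in> S\<close> continuous_on_eq_continuous_at by blast
  then have "((\<lambda>x. c 0 * u 0 x) \<longlongrightarrow> c 0 * u 0 z) (at z)"
    by (intro tendsto_mult tendsto_const) (simp add: isCont_def)
  moreover have "c 0 * u 0 z = 0" using "0.prems"(6)[OF z] by simp
  ultimately have "((\<lambda>x. c 0 * u 0 x) \<longlongrightarrow> 0) (at z)" by metis
  then have "vanishes_at 0 (\<lambda>x. \<Sum>i\<le>0. c i * u i x) z"
    by (simp add: vanishes_at_def)
  then show ?case using "0.prems"(2) \<open>z \<in> S\<close> by blast
next
  case (Suc m)
  \<comment> \<open>This is the hypothesis at order 0: at a zero of \<open>u 0\<close> the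
    nontrivial combination \<open>1 * u 0\<close> would vanish to order 0.\<close>
  have u0: "u 0 t \<noteq> 0" if "t \<in> S" for t
  proof
    assume "u 0 t = 0"
    moreover have "isCont (u 0) t"
      using times_diff_continuous[OF Suc.prems(1)[of 0]] \<open>open S\<close> that continuous_on_eq_continuous_at by blast
    ultimately have "vanishes_at 0 (\<lambda>x. \<Sum>i\<le>0. 1 * u i x) t"
      by (simp add: vanishes_at_def isCont_def)
    then show False using Suc.prems(2)[of 0 t "\<lambda>_. 1"] that by (meson one_neq_zero le0)
  qed
  have contu0: "isCont (u 0) t" if "t \<in> S" for t
    using times_diff_continuous[OF Suc.prems(1)[of 0]] \<open>open S\<close> that continuous_on_eq_continuous_at by blast
  have "\<exists>v. (\<forall>x\<in>S. ((\<lambda>x. u (Suc i) x / u 0 x) has_real_derivative v x) (at x)) \<and> times_diff m v S"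
    if "i \<le> m" for i
    using times_diff_divide[OF Suc.prems(1)[of "Suc i"] Suc.prems(1)[of 0]] that u0 by simp
  then obtain v where v: "\<And>i x. i \<le> m \<Longrightarrow> x \<in> S \<Longrightarrow> ((\<lambda>x. u (Suc i) x / u 0 x) has_real_derivative v i x) (at x)"
    "\<And>i. i \<le> m \<Longrightarrow> times_diff m (v i) S" by metis
  have "\<forall>i\<le>m. c (Suc i) = 0"
  proof -
    let ?F = "\<lambda>x. c 0 + (\<Sum>i\<le>m. c (Suc i) * (u (Suc i) x / u 0 x))"
    have F: "?F x = (\<Sum>i\<le>Suc m. c i * u i x) / u 0 x" if "x \<in> S" for x
      using u0[OF that] unfolding sum.atMost_Suc_shift[of _ m]
      by (simp add: add_divide_distrib sum_divide_distrib)
    have dF: "(?F has_real_derivative (\<Sum>i\<le>m. c (Suc i) * v i x)) (at x)" if "x \<in> S" for x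
    proof -
      have "(?F has_real_derivative 0 + (\<Sum>i\<le>m. c (Suc i) * v i x)) (at x)"
        by (intro DERIV_add DERIV_const DERIV_sum DERIV_cmult v(1) that) simp
      then show ?thesis by simp
    qed
    have "?F z = 0" if "z \<in> Z" for z
      using that F[of z] Suc.prems(5,6) by auto
    then have "\<exists>Z'. finite Z' \<and> card Z' = Suc m \<and> Z' \<subseteq> S \<and>
        (\<forall>z\<in>Z'. (\<Sum>i\<le>m. c (Suc i) * v i z) = 0 \<and> z < Max Z)"
      by (intro rolle_zeros[OF Suc.prems(3,4,5) \<open>is_interval S\<close> dF])
    then obtain Z' where Z': "finite Z'" "card Z' = Suc m" "Z' \<subseteq> S"
      "\<forall>z\<in>Z'. (\<Sum>i\<le>m. c (Suc i) * v i z) = 0 \<and> z < Max Z" by blast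
    show ?thesis
    proof (rule Suc.IH[OF v(2) _ Z'(1,2,3)])
      fix k t b assume k: "k \<le> m" and t: "t \<in> S" and van: "vanishes_at k (\<lambda>x. \<Sum>i\<le>k. b i * v i x) t"
      let ?G = "\<lambda>x. \<Sum>i\<le>k. b i * (u (Suc i) x / u 0 x)"
      \<comment> \<open>The constant of integration. After multiplication by \<open>u 0\<close> it
        becomes the coefficient \<open>- Gt\<close> of \<open>u 0\<close>, so that the hypothesis on
        \<open>u\<close> applies at order \<open>Suc k\<close>.\<close>
      define Gt where "Gt = ?G t"
      have "vanishes_at (Suc k) (\<lambda>x. ?G x - Gt) t"
      proof (rule vanishes_at_integrate[OF \<open>open S\<close> t _ _ van])
        fix x assume "x \<in> S"
        then have "((\<lambda>x. ?G x - Gt) has_real_derivative (\<Sum>i\<le>k. b i * v i x) - 0) (at x)"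
          using k by (intro DERIV_diff DERIV_const DERIV_sum DERIV_cmult v(1)) auto
        then show "((\<lambda>x. ?G x - Gt) has_real_derivative (\<Sum>i\<le>k. b i * v i x)) (at x)" by simp
      qed (simp add: Gt_def)
      from vanishes_at_mult_cont[OF this contu0[OF t]]
      have "vanishes_at (Suc k) (\<lambda>x. u 0 x * (?G x - Gt)) t" .
      also have "vanishes_at (Suc k) (\<lambda>x. u 0 x * (?G x - Gt)) t \<longleftrightarrow>
         vanishes_at (Suc k) (\<lambda>x. \<Sum>i\<le>Suc k. (case i of 0 \<Rightarrow> - Gt | Suc i \<Rightarrow> b i) * u i x) t"
      proof (rule vanishes_at_cong[OF \<open>open S\<close> t])
        fix x assume "x \<in> S"
        then show "u 0 x * (?G x - Gt) = (\<Sum>i\<le>Suc k. (case i of 0 \<Rightarrow> - Gt | Suc i \<Rightarrow> b i) * u i x)"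
          using u0[of x] unfolding sum.atMost_Suc_shift[of _ k]
          by (simp add: right_diff_distrib sum_distrib_left)
      qed
      finally have "\<forall>i\<le>Suc k. (case i of 0 \<Rightarrow> - Gt | Suc i \<Rightarrow> b i) = 0"
        using Suc.prems(2) k t by blast
      then have "b i = 0" if "i \<le> k" for i
        using that by (auto dest: spec[of _ "Suc i"])
      then show "\<forall>i\<le>k. b i = 0" by blast
    qed (use Z' in auto)
  qed
  moreover have "c 0 = 0"
  proof -
    obtain z where z: "z \<in> Z" using Suc.prems(4) by fastforce
    then have "(\<Sum>i\<le>Suc m. c i * u i z) = 0" by (rule Suc.prems(6))
    then have "c 0 * u 0 z = 0"
      unfolding sum.atMost_Suc_shift[of _ m] using calculation by simp
    then show ?thesis using u0 z Suc.prems(5) by auto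
  qed
  ultimately have "c i = 0" if "i \<le> Suc m" for i using that by (cases i) auto
  then show ?case by blast
qed

subsection \<open>From Hankel matrices to kernels\<close>

lemma quad_eq_0: "(\<And>i. i < N \<Longrightarrow> v i = 0) \<Longrightarrow> quad N M v = 0"
  by (simp add: quad_def)

lemma quad_extend:
  assumes "k \<le> N"
  shows "quad N M (\<lambda>i. if i < k then v i else 0) = quad k M v"
proof -
  have "quad N M (\<lambda>i. if i < k then v i else 0)
    = (\<Sum>i<N. if i < k then (\<Sum>j<N. if j < k then v i * v j * M i j else 0) else 0)"
    unfolding quad_def by (intro sum.cong refl) (auto intro!: sum.cong)
  also have "\<dots> = quad k M v"
  proof -
    have "{..<N} \<inter> {i. i < k} = {..<k}" using assms by auto
    then show ?thesis by (simp add: quad_def sum.If_cases)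
  qed
  finally show ?thesis .
qed

lemma pos_def_principal:
  assumes "pos_def N M" "k \<le> N" shows "pos_def k M"
  unfolding pos_def_def
proof (intro allI impI)
  fix v assume "\<exists>i<k. v i \<noteq> (0 :: real)"
  then have "\<exists>i<N. (if i < k then v i else 0) \<noteq> 0" using assms(2) by (meson less_le_trans)
  then have "0 < quad N M (\<lambda>i. if i < k then v i else 0)"
    using assms(1) by (simp add: pos_def_def)
  then show "0 < quad k M v" by (simp add: quad_extend[OF assms(2)])
qed

lemma deriv_family_translate:
  assumes "deriv_family m F J" shows "deriv_family m (\<lambda>k t. F k (t + a)) {t. t + a \<in> J}"
  unfolding deriv_family_def
proof (intro conjI allI ballI impI)
  fix k x assume "k < m" "x \<in> {t. t + a \<in> J}"
  then have "(F k has_real_derivative F (Suc k) (x + a)) (at (x + a))"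
    using deriv_familyD[OF assms] by simp
  then show "((\<lambda>t. F k (t + a)) has_real_derivative F (Suc k) (x + a)) (at x)"
    by (simp add: DERIV_shift)
next
  show "continuous_on {t. t + a \<in> J} (\<lambda>t. F m (t + a))"
    using assms unfolding deriv_family_def
    by (intro continuous_on_compose2[of J "F m" _ "\<lambda>t. t + a"] continuous_intros) auto
qed

lemma deriv_family_sum:
  assumes "\<And>a. a \<in> A \<Longrightarrow> deriv_family m (G a) S"
  shows "deriv_family m (\<lambda>k x. \<Sum>a\<in>A. c a * G a k x) S"
  using assms unfolding deriv_family_def
  by (auto intro!: DERIV_sum DERIV_cmult continuous_intros)

text \<open>Pairing the vanishing combinations with \<open>c\<close> itself gives the value 0 of the
  definite form of the leading block at \<open>c\<close>.\<close>

lemma hankel_quad_eq_0: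
  assumes "pos_def (Suc m) M" "k \<le> m" "\<And>p. p \<le> k \<Longrightarrow> (\<Sum>i\<le>k. c i * M i p) = 0"
  shows "\<forall>i\<le>k. c i = 0"
proof (rule ccontr)
  assume "\<not> ?thesis"
  then have "\<exists>i<Suc k. c i \<noteq> 0" by (auto simp: less_Suc_eq_le)
  then have "0 < quad (Suc k) M c"
    using pos_def_principal[OF assms(1), of "Suc k"] assms(2) by (auto simp: pos_def_def)
  also have "quad (Suc k) M c = (\<Sum>p\<le>k. c p * (\<Sum>i\<le>k. c i * M i p))"
    unfolding quad_def lessThan_Suc_atMost
    by (subst sum.swap) (simp add: sum_distrib_left mult_ac)
  also have "\<dots> = 0" using assms(3) by simp
  finally show False by simp
qed

section \<open>Nonsingular kernels from definite Hankel matrices\<close>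

context
  fixes m :: nat and F :: "nat \<Rightarrow> real \<Rightarrow> real" and J :: "real set"
  assumes F: "deriv_family (2 * m) F J" and J: "open J" "is_interval J"
    and hankel: "\<And>x. x \<in> J \<Longrightarrow> pos_def (Suc m) (\<lambda>i j. F (i + j) x)"
begin

lemma open_interval_translate: "open {t. t + a \<in> J}" "is_interval {t. t + a \<in> J}"
proof -
  have "{t. t + a \<in> J} = (\<lambda>t. t + a) -` J" by auto
  then show "open {t. t + a \<in> J}"
    using J(1) by (simp add: open_vimage continuous_intros)
  show "is_interval {t. t + a \<in> J}"
    unfolding is_interval_1
  proof (intro ballI allI impI)
    fix b c x assume "b \<in> {t. t + a \<in> J}" "c \<in> {t. t + a \<in> J}" "b \<le> x \<and> x \<le> c"
    then show "x \<in> {t. t + a \<in> J}"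
      using mem_is_interval_1_I[OF J(2), of "b + a" "c + a" "x + a"] by simp
  qed
qed

text \<open>A row combination is a combination of the functions \<open>F i (x + .)\<close>, and if
  it vanishes to order \<open>p\<close> at a point, its coefficients are a null vector of a leading
  Hankel block. Hence the rows are independent by \<open>chebyshev_system\<close>, with the
  \<open>y j\<close> as zeros, and the columns by transposition.\<close>

lemma derivatives_nonsingular:
  assumes "k \<le> m" "inj_on y {..k}" "\<And>j. j \<le> k \<Longrightarrow> x + y j \<in> J"
    and "\<And>i. i \<le> k \<Longrightarrow> (\<Sum>j\<le>k. d j * F i (x + y j)) = 0"
  shows "\<forall>j\<le>k. d j = 0"
proof -
  have "\<forall>j<Suc k. d j = 0"
  proof (rule transpose_injective)
    fix c assume c: "\<And>j. j < Suc k \<Longrightarrow> (\<Sum>i<Suc k. c i * F i (x + y j)) = 0"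
    have "\<forall>i\<le>k. c i = 0"
    proof (rule chebyshev_system[where S = "{t. t + x \<in> J}" and Z = "y ` {..k}" and u = "\<lambda>i t. F i (t + x)"])
      fix i assume "i \<le> k"
      then have "deriv_family k (\<lambda>p. F (p + i)) J"
        by (intro deriv_family_shift deriv_family_mono[OF F]) (use assms(1) in auto)
      from times_diff_deriv_family[OF deriv_family_translate[OF this, of x]]
      show "times_diff k (\<lambda>t. F i (t + x)) {t. t + x \<in> J}" by simp
    next
      fix p t b assume p: "p \<le> k" and t: "t \<in> {t. t + x \<in> J}"
        and van: "vanishes_at p (\<lambda>t. \<Sum>i\<le>p. b i * F i (t + x)) t"
      have fam: "deriv_family p (\<lambda>q t. \<Sum>i\<le>p. b i * F (q + i) (t + x)) {t. t + x \<in> J}"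
      proof (rule deriv_family_sum)
        fix i assume "i \<in> {..p}"
        then have "deriv_family p (\<lambda>q. F (q + i)) J"
          by (intro deriv_family_shift deriv_family_mono[OF F]) (use assms(1) p in auto)
        from deriv_family_translate[OF this, of x]
        show "deriv_family p (\<lambda>q t. F (q + i) (t + x)) {t. t + x \<in> J}" .
      qed
      have "(\<Sum>i\<le>p. b i * F (q + i) (t + x)) = 0" if "q \<le> p" for q
        using deriv_family_vanishes_at[OF fam open_interval_translate(1) t _ that] van by simp
      then show "\<forall>i\<le>p. b i = 0"
        using hankel_quad_eq_0[OF hankel[of "t + x"], of p b] t p assms(1) by (simp add: add.commute)
    next
      show "card (y ` {..k}) = Suc k" using assms(2) by (simp add: card_image)
    qed (use assms(3) c in \<open>auto simp: open_interval_translate lessThan_Suc_atMost add.commute\<close>)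
    then show "\<forall>i<Suc k. c i = 0" by auto
  qed (use assms(4) in \<open>auto simp: lessThan_Suc_atMost mult.commute\<close>)
  then show ?thesis by auto
qed

text \<open>Polya's criterion in the variable \<open>t\<close>, for the functions
  \<open>F 0 (t + y j)\<close>. Vanishing to order \<open>k\<close> at \<open>t\<close> kills all
  derivatives up to order \<open>k\<close> there, which is the system that
  \<open>derivatives_nonsingular\<close> excludes.\<close>

lemma kernel_nonsingular:
  assumes y: "inj_on y {..m}" "\<And>i j. i \<le> m \<Longrightarrow> j \<le> m \<Longrightarrow> y i + y j \<in> J"
    and d: "\<And>i. i \<le> m \<Longrightarrow> (\<Sum>j\<le>m. d j * F 0 (y i + y j)) = 0"
  shows "\<forall>j\<le>m. d j = 0"
proof -
  let ?S = "\<Inter>j\<in>{..m}. {t. t + y j \<in> J}"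
  have S: "open ?S" by (intro open_INT ballI open_interval_translate) simp
  have S': "is_interval ?S"
    unfolding is_interval_1
  proof (intro ballI allI impI)
    fix a b x assume "a \<in> ?S" "b \<in> ?S" "a \<le> x \<and> x \<le> b"
    then have "x + y j \<in> J" if "j \<le> m" for j
      using mem_is_interval_1_I[OF J(2), of "a + y j" "b + y j" "x + y j"] that by auto
    then show "x \<in> ?S" by simp
  qed
  have fam: "deriv_family (2 * m) (\<lambda>k t. F k (t + y j)) ?S" if "j \<le> m" for j
    by (rule deriv_family_mono[OF deriv_family_translate[OF F]]) (use that in auto)
  show ?thesis
  proof (rule chebyshev_system[OF S S', where Z = "y ` {..m}" and u = "\<lambda>j t. F 0 (t + y j)"])
    fix j assume "j \<le> m"
    show "times_diff m (\<lambda>t. F 0 (t + y j)) ?S"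
      by (rule times_diff_deriv_family[OF deriv_family_mono[OF fam[OF \<open>j \<le> m\<close>]]]) auto
  next
    fix k t c assume k: "k \<le> m" and t: "t \<in> ?S"
      and van: "vanishes_at k (\<lambda>t. \<Sum>j\<le>k. c j * F 0 (t + y j)) t"
    have "deriv_family k (\<lambda>p t. \<Sum>j\<le>k. c j * F p (t + y j)) ?S"
      by (rule deriv_family_sum, rule deriv_family_mono[OF fam]) (use k in auto)
    from deriv_family_vanishes_at[OF this S t van]
    have "(\<Sum>j\<le>k. c j * F p (t + y j)) = 0" if "p \<le> k" for p using that .
    then show "\<forall>j\<le>k. c j = 0"
      using k t y(1) by (intro derivatives_nonsingular[of k y t]) (auto intro: inj_on_subset)
  next
    show "card (y ` {..m}) = Suc m" using y(1) by (simp add: card_image)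
  qed (use y(2) d in auto)
qed

end

text \<open>Perturbs semidefinite Hankel matrices into definite ones.\<close>

definition exp_sum :: "nat \<Rightarrow> nat \<Rightarrow> real \<Rightarrow> real" where
  "exp_sum m k x = (\<Sum>l\<le>m. real l ^ k * exp (real l * x))"

lemma deriv_family_exp_sum: "deriv_family N (exp_sum m) J"
  unfolding deriv_family_def exp_sum_def
  by (auto intro!: derivative_eq_intros continuous_intros sum.cong)

lemma vandermonde_injective:
  fixes c z :: "nat \<Rightarrow> real"
  assumes "inj_on z {..m}" "\<And>l. l \<le> m \<Longrightarrow> (\<Sum>i\<le>m. c i * z l ^ i) = 0"
  shows "\<forall>i\<le>m. c i = 0"
proof (rule ccontr)
  assume "\<not> ?thesis"
  then obtain k where k: "c k \<noteq> 0" "k \<le> m" by blast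
  have "z ` {..m} \<subseteq> {x. (\<Sum>i\<le>m. c i * x ^ i) = 0}" using assms(2) by auto
  then have "card (z ` {..m}) \<le> m"
    using polyfun_rootbound[of c k m] k by (meson card_mono order_trans)
  then show False using assms(1) by (simp add: card_image)
qed

lemma quad_sum_squares:
  "quad N (\<lambda>i j. \<Sum>l\<le>m. g l * a l i * a l j) c = (\<Sum>l\<le>m. g l * (\<Sum>i<N. c i * a l i)\<^sup>2)"
proof -
  have "g l * (\<Sum>i<N. c i * a l i)\<^sup>2 = (\<Sum>i<N. \<Sum>j<N. c i * c j * (g l * a l i * a l j))" for l
    unfolding power2_eq_square sum_product by (simp add: sum_distrib_left mult_ac)
  then have "(\<Sum>l\<le>m. g l * (\<Sum>i<N. c i * a l i)\<^sup>2)
      = (\<Sum>l\<le>m. \<Sum>i<N. \<Sum>j<N. c i * c j * (g l * a l i * a l j))" by simp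
  also have "\<dots> = (\<Sum>i<N. \<Sum>l\<le>m. \<Sum>j<N. c i * c j * (g l * a l i * a l j))" by (rule sum.swap)
  also have "\<dots> = (\<Sum>i<N. \<Sum>j<N. \<Sum>l\<le>m. c i * c j * (g l * a l i * a l j))"
    by (rule sum.cong[OF refl], rule sum.swap)
  finally show ?thesis by (simp add: quad_def sum_distrib_left)
qed

lemma pos_def_sum_squares:
  fixes g :: "nat \<Rightarrow> real"
  assumes "\<And>l. g l > 0" "\<And>c. (\<And>l. l \<le> m \<Longrightarrow> (\<Sum>i<N. c i * a l i) = 0) \<Longrightarrow> \<forall>i<N. c i = 0"
  shows "pos_def N (\<lambda>i j. \<Sum>l\<le>m. g l * a l i * a l j)"
  unfolding pos_def_def quad_sum_squares
proof (intro allI impI)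
  fix c assume "\<exists>i<N. c i \<noteq> (0 :: real)"
  then obtain l where "l \<le> m" "(\<Sum>i<N. c i * a l i) \<noteq> 0" using assms(2) by blast
  then show "0 < (\<Sum>l\<le>m. g l * (\<Sum>i<N. c i * a l i)\<^sup>2)"
    using assms(1) by (intro sum_pos2[where i = l]) (auto simp: less_imp_le)
qed

text \<open>This is the moment matrix of the measure with mass \<open>exp (l x)\<close> at
  \<open>l = 0, ..., m\<close>. With \<open>m + 1\<close> atoms, no nonzero polynomial of degree at
  most \<open>m\<close> vanishes on all of them.\<close>

lemma pos_def_hankel_exp_sum: "pos_def (Suc m) (\<lambda>i j. exp_sum m (i + j) x)"
proof -
  have "pos_def (Suc m) (\<lambda>i j. \<Sum>l\<le>m. exp (real l * x) * real l ^ i * real l ^ j)"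
  proof (rule pos_def_sum_squares)
    fix c assume c: "\<And>l. l \<le> m \<Longrightarrow> (\<Sum>i<Suc m. c i * real l ^ i) = 0"
    have "\<forall>i\<le>m. c i = 0"
    proof (rule vandermonde_injective[of real])
      show "(\<Sum>i\<le>m. c i * real l ^ i) = 0" if "l \<le> m" for l
        using c[OF that] by (simp only: lessThan_Suc_atMost)
    qed (simp add: inj_on_def)
    then show "\<forall>i<Suc m. c i = 0" by (simp only: less_Suc_eq_le)
  qed simp
  then show ?thesis by (simp add: exp_sum_def power_add mult_ac)
qed

text \<open>The kernel is the Gram matrix of the vectors of powers of \<open>exp (y i)\<close>,
  independent by Vandermonde since the \<open>y i\<close> are distinct.\<close>

lemma pos_def_kernel_exp_sum:
  assumes "inj_on y {..m}"
  shows "pos_def (Suc m) (\<lambda>i j. exp_sum m 0 (y i + y j))"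
proof -
  have "pos_def (Suc m) (\<lambda>i j. \<Sum>l\<le>m. 1 * exp (y i) ^ l * exp (y j) ^ l)"
  proof (rule pos_def_sum_squares)
    fix c assume c: "\<And>l. l \<le> m \<Longrightarrow> (\<Sum>i<Suc m. c i * exp (y i) ^ l) = 0"
    show "\<forall>i<Suc m. c i = 0"
    proof (rule transpose_injective[where a = "\<lambda>l i. exp (y i) ^ l"])
      fix b assume "\<And>j. j < Suc m \<Longrightarrow> (\<Sum>i<Suc m. b i * exp (y j) ^ i) = 0"
      then show "\<forall>i<Suc m. b i = 0"
        using vandermonde_injective[of "\<lambda>j. exp (y j)" m b] assms
        unfolding lessThan_Suc_atMost less_Suc_eq_le by (meson exp_inj_iff inj_on_def)
    qed (use c in \<open>auto simp: mult.commute\<close>)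
  qed simp
  then show ?thesis by (simp add: exp_sum_def exp_add exp_of_nat_mult algebra_simps)
qed

text \<open>If the form were negative somewhere, the least eigenvalue \<open>\<mu>\<close> of the
  kernel relative to that of \<open>exp_sum\<close> would be negative. Then
  \<open>F - \<mu> exp_sum\<close> has definite Hankel matrices, while its kernel annihilates the
  eigenvector \<open>w\<close>, against \<open>kernel_nonsingular\<close>. The critical amount of
  perturbation is hit exactly, so no limit is taken.\<close>

lemma kernel_nonneg_distinct:
  assumes F: "deriv_family (2 * m) F J" and J: "open J" "is_interval J"
    and hankel: "\<And>x c. x \<in> J \<Longrightarrow> 0 \<le> quad (Suc m) (\<lambda>i j. F (i + j) x) c"
    and y: "inj_on y {..m}" "\<And>i j. i \<le> m \<Longrightarrow> j \<le> m \<Longrightarrow> y i + y j \<in> J"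
  shows "0 \<le> quad (Suc m) (\<lambda>i j. F 0 (y i + y j)) c"
proof (rule ccontr)
  assume neg: "\<not> ?thesis"
  let ?M = "\<lambda>i j. F 0 (y i + y j)" and ?E = "\<lambda>i j. exp_sum m 0 (y i + y j)"
  have sym: "sym_on (Suc m) ?M" "sym_on (Suc m) ?E" by (auto simp: sym_on_def add.commute)
  have E: "pos_def (Suc m) ?E" by (rule pos_def_kernel_exp_sum[OF y(1)])
  obtain w \<mu> where w: "\<exists>i<Suc m. w i \<noteq> 0" "\<And>z. \<mu> * quad (Suc m) ?E z \<le> quad (Suc m) ?M z"
    "\<And>i. i < Suc m \<Longrightarrow> mulv (Suc m) ?M w i = \<mu> * mulv (Suc m) ?E w i"
    using rayleigh_eigenvector[OF sym E] by blast
  have "\<exists>i<Suc m. c i \<noteq> 0" using neg quad_eq_0[of "Suc m" c ?M] by fastforce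
  then have "quad (Suc m) ?E c > 0" using E by (simp add: pos_def_def)
  moreover have "\<mu> * quad (Suc m) ?E c < 0" using w(2)[of c] neg by linarith
  ultimately have \<mu>: "\<mu> < 0" by (simp add: mult_less_0_iff)
  let ?G = "\<lambda>k x. F k x - \<mu> * exp_sum m k x"
  have "\<forall>j\<le>m. w j = 0"
  proof (rule kernel_nonsingular[where F = ?G, OF _ J _ y])
    show "deriv_family (2 * m) ?G J"
      using F deriv_family_exp_sum[of "2 * m" m J] unfolding deriv_family_def
      by (auto intro!: DERIV_diff DERIV_cmult continuous_intros)
    show "pos_def (Suc m) (\<lambda>i j. ?G (i + j) x)" if "x \<in> J" for x
    proof -
      have "quad (Suc m) (\<lambda>i j. ?G (i + j) x) v
          = quad (Suc m) (\<lambda>i j. F (i + j) x) v - \<mu> * quad (Suc m) (\<lambda>i j. exp_sum m (i + j) x) v" for v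
        by (simp only: quad_def sum_distrib_left sum_subtractf[symmetric])
          (simp only: right_diff_distrib mult_ac)
      moreover have "\<mu> * quad (Suc m) (\<lambda>i j. exp_sum m (i + j) x) v < 0" if "\<exists>i<Suc m. v i \<noteq> 0" for v
        using pos_def_hankel_exp_sum[of m x] that \<mu> by (simp add: pos_def_def mult_neg_pos)
      ultimately show ?thesis using hankel[OF that] by (simp add: pos_def_def) (smt (verit))
    qed
    show "(\<Sum>j\<le>m. w j * ?G 0 (y i + y j)) = 0" if "i \<le> m" for i
      using w(3)[of i] that
      by (simp add: mulv_def lessThan_Suc_atMost algebra_simps sum_subtractf sum_distrib_left)
  qed
  then show False using w(1) by auto
qed

text \<open>Repeated nodes are merged by adding up their coefficients. The fewer distinct nodes then
  need only a leading block of the Hankel matrix, which inherits semidefiniteness by padding with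
  zeros.\<close>

lemma kernel_nonneg_of_hankel:
  assumes F: "deriv_family (2 * n - 2) F J" and J: "open J" "is_interval J"
    and hankel: "\<And>x c. x \<in> J \<Longrightarrow> 0 \<le> quad n (\<lambda>i j. F (i + j) x) c"
    and s: "\<And>i j. i < n \<Longrightarrow> j < n \<Longrightarrow> s i + s j \<in> J"
  shows "0 \<le> quad n (\<lambda>i j. F 0 (s i + s j)) c"
proof (cases "n = 0")
  case True then show ?thesis by (simp add: quad_def)
next
  case False
  let ?T = "s ` {..<n}"
  define m where "m = card ?T - 1"
  have "card ?T > 0" using False by (auto simp: card_gt_0_iff)
  then have m: "card ?T = Suc m" by (simp add: m_def)
  then have mn: "Suc m \<le> n" using card_image_le[of "{..<n}" s] by simp
  obtain y where y: "bij_betw y {..<Suc m} ?T"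
    using ex_bij_betw_nat_finite[of ?T] m by (auto simp: atLeast0LessThan)
  define C where "C k = (\<Sum>i | i < n \<and> s i = y k. c i)" for k
  have group: "(\<Sum>i<n. c i * g (s i)) = (\<Sum>k<Suc m. C k * g (y k))" for g
  proof -
    have "(\<Sum>i<n. c i * g (s i)) = (\<Sum>a\<in>?T. \<Sum>i | i \<in> {..<n} \<and> s i = a. c i * g (s i))"
      by (rule sum.image_gen) simp
    also have "\<dots> = (\<Sum>a\<in>?T. (\<Sum>i | i < n \<and> s i = a. c i) * g a)"
      by (simp add: sum_distrib_right)
    also have "\<dots> = (\<Sum>k<Suc m. C k * g (y k))"
      unfolding C_def by (rule sum.reindex_bij_betw[OF y, symmetric])
    finally show ?thesis .
  qed
  have "quad n (\<lambda>i j. F 0 (s i + s j)) c = (\<Sum>i<n. c i * (\<Sum>j<n. c j * F 0 (s i + s j)))"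
    by (simp add: quad_def sum_distrib_left mult_ac)
  also have "\<dots> = (\<Sum>i<n. c i * (\<Sum>l<Suc m. C l * F 0 (s i + y l)))"
    by (simp only: group[of "\<lambda>t. F 0 (s _ + t)"])
  also have "\<dots> = (\<Sum>k<Suc m. C k * (\<Sum>l<Suc m. C l * F 0 (y k + y l)))"
    by (rule group)
  also have "\<dots> = quad (Suc m) (\<lambda>k l. F 0 (y k + y l)) C"
    unfolding quad_def sum_distrib_left by (simp only: mult_ac)
  also have "\<dots> \<ge> 0"
  proof (rule kernel_nonneg_distinct[OF _ J])
    show "deriv_family (2 * m) F J" by (rule deriv_family_mono[OF F]) (use mn in auto)
    show "0 \<le> quad (Suc m) (\<lambda>i j. F (i + j) x) b" if "x \<in> J" for x b
      using hankel[OF that] quad_extend[OF mn] by metis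
    show "inj_on y {..m}" using y by (simp add: bij_betw_def lessThan_Suc_atMost)
    show "y i + y j \<in> J" if "i \<le> m" "j \<le> m" for i j
    proof -
      have "y i \<in> ?T" "y j \<in> ?T" using y that by (auto simp: bij_betw_def)
      then show ?thesis using s by auto
    qed
  qed
  finally show ?thesis .
qed

subsection \<open>Kernels of derivatives\<close>

text \<open>Log-convexity makes successive ratios nondecreasing, so a first ratio
  \<open>r > 1\<close> forces growth at least like \<open>a 0 * r ^ k\<close>. In the application
  the index runs to the left, and the conclusion means increase in the base point.\<close>

lemma bounded_log_convex_decreasing:
  fixes a :: "nat \<Rightarrow> real"
  assumes nonneg: "\<And>k. 0 \<le> a k" and bound: "\<And>k. a k \<le> C"
    and convex: "\<And>k. (a (Suc k))\<^sup>2 \<le> a k * a (Suc (Suc k))"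
  shows "a 1 \<le> a 0"
proof (rule ccontr)
  assume "\<not> ?thesis"
  then have gt: "a 0 < a 1" by simp
  have "a 0 \<noteq> 0" using convex[of 0] gt by auto
  then have pos: "a 0 > 0" using nonneg[of 0] by simp
  define r where "r = a 1 / a 0"
  have r: "r > 1" using gt pos by (simp add: r_def)
  have step: "a k > 0 \<and> r * a k \<le> a (Suc k)" for k
  proof (induction k)
    case 0 then show ?case using pos by (simp add: r_def)
  next
    case (Suc k)
    have p: "a (Suc k) > 0" using Suc r by (smt (verit) mult_pos_pos)
    have "a k * (r * a (Suc k)) \<le> a (Suc k) * a (Suc k)"
      using Suc p by (simp add: mult_ac)
    also have "\<dots> \<le> a k * a (Suc (Suc k))" using convex[of k] by (simp add: power2_eq_square)
    finally show ?case using Suc p by simp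
  qed
  have grow: "a 0 * r ^ k \<le> a k" for k
  proof (induction k)
    case (Suc k)
    have "a 0 * r ^ Suc k = r * (a 0 * r ^ k)" by simp
    also have "\<dots> \<le> r * a k" using Suc r by (intro mult_left_mono) auto
    finally show ?case using step[of k] by simp
  qed simp
  obtain k where "C / a 0 < r ^ k" using real_arch_pow[OF r] by blast
  then have "C < a 0 * r ^ k" using pos by (simp add: pos_divide_less_eq mult.commute)
  then show False using grow[of k] bound[of k] by simp
qed

lemma discriminant_le:
  fixes a b c :: real
  assumes "\<And>t. 0 \<le> a + 2 * t * b + t\<^sup>2 * c" "0 \<le> c"
  shows "b\<^sup>2 \<le> a * c"
proof (cases "c = 0")
  case True
  have "b = 0"
  proof (rule ccontr)
    assume "b \<noteq> 0"
    \<comment> \<open>This \<open>t\<close> makes \<open>a + 2 * t * b\<close> equal to -1.\<close>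
    then show False using assms(1)[of "- (a + 1) / (2 * b)"] True by (simp add: field_simps)
  qed
  then show ?thesis using True by simp
next
  case False
  then have "c > 0" using assms by simp
  have "0 \<le> a + 2 * (- b / c) * b + (- b / c)\<^sup>2 * c" by (rule assms)
  also have "\<dots> = (a * c - b\<^sup>2) / c" using \<open>c > 0\<close> by (simp add: field_simps power2_eq_square)
  finally show ?thesis using \<open>c > 0\<close> by (simp add: zero_le_divide_iff)
qed

lemma psd_cauchy_schwarz:
  assumes "sym_on N M" "\<And>v. 0 \<le> quad N M v"
  shows "(dotp N z (mulv N M w))\<^sup>2 \<le> quad N M w * quad N M z"
  by (rule discriminant_le) (use assms in \<open>auto simp: quad_add_scale[OF assms(1), symmetric]\<close>)

text \<open>On an arithmetic progression the quadratic forms of a kernel of order \<open>n + 1\<close> in \<open>n\<close>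
  coefficients are log-convex in the base point. Being bounded to the left they increase, which is
  positivity of the kernel of the derivative.\<close>

lemma hankel_deriv_nonneg:
  assumes F: "deriv_family (2 * n - 2 + 1) F J" and "open J"
    and down: "\<And>x y. x \<in> J \<Longrightarrow> y \<le> x \<Longrightarrow> y \<in> J"
    and ker: "\<And>s c. (\<And>i j. i < Suc n \<Longrightarrow> j < Suc n \<Longrightarrow> s i + s j \<in> J)
        \<Longrightarrow> 0 \<le> quad (Suc n) (\<lambda>i j. F 0 (s i + s j)) c"
    and nonneg: "\<And>x. x \<in> J \<Longrightarrow> 0 \<le> F 0 x"
    and mono: "\<And>x y. y \<in> J \<Longrightarrow> x \<le> y \<Longrightarrow> F 0 x \<le> F 0 y"
    and "x \<in> J"
  shows "0 \<le> quad n (\<lambda>i j. F (i + j + 1) x) c"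
  unfolding quad_def
proof (rule hankel_nonneg_of_kernel[OF F \<open>open J\<close> \<open>x \<in> J\<close>])
  obtain e where e: "e > 0" "ball x e \<subseteq> J" using \<open>open J\<close> \<open>x \<in> J\<close> by (meson openE)
  have "\<forall>\<^sub>F d in at_right 0. 0 < d \<and> d < e / (2 * real n + 1)"
    using e by (auto simp: eventually_at_right intro!: exI[of _ "e / (2 * real n + 1)"])
  then show "\<forall>\<^sub>F d in at_right 0. \<forall>q. 0 \<le> (\<Sum>i<n. \<Sum>j<n. q i * q j * (fdiff d ^^ 1) (F 0) (x + real (i + j) * d))"
  proof (rule eventually_mono, intro allI)
    fix d q assume d: "0 < d \<and> d < e / (2 * real n + 1)"
    \<comment> \<open>A common upper bound for all nodes: base points are at most
      \<open>x + d\<close>, and offsets at most \<open>2 * n * d\<close>.\<close>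
    define X where "X = x + (2 * real n + 1) * d"
    have "(2 * real n + 1) * d < e"
      using d pos_less_divide_eq[of "2 * real n + 1" d e] by (simp add: mult.commute)
    then have X: "X \<in> J" using e(2) d by (auto simp: X_def dist_real_def subset_iff)
    define b where "b t = quad n (\<lambda>i j. F 0 (t + real (i + j) * d)) q" for t
    have pt: "t + real (i + j) * d \<le> X" if "t \<le> x + d" "i \<le> n" "j \<le> n" for t i j
    proof -
      have "real (i + j) * d \<le> (2 * real n) * d" using that d by (intro mult_right_mono) auto
      then show ?thesis using that(1) by (simp add: X_def algebra_simps)
    qed
    let ?M = "\<lambda>t i j. F 0 (t + real (i + j) * d)"
    have psd: "0 \<le> quad (Suc n) (?M t) v" if "t \<le> x + d" for t v
    proof -
      have "0 \<le> quad (Suc n) (\<lambda>i j. F 0 ((t / 2 + real i * d) + (t / 2 + real j * d))) v"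
      proof (rule ker)
        fix i j assume "i < Suc n" "j < Suc n"
        then show "(t / 2 + real i * d) + (t / 2 + real j * d) \<in> J"
          using down[OF X] pt[OF that, of i j] by (simp add: algebra_simps)
      qed
      then show ?thesis by (simp add: algebra_simps)
    qed
    have sym: "sym_on (Suc n) (?M t)" for t by (simp add: sym_on_def add.commute)
    \<comment> \<open>The vector \<open>q\<close> in the first and in the last \<open>n\<close> of
      \<open>n + 1\<close> places. Their forms have base points \<open>t\<close> and
      \<open>t + 2 d\<close>, their mixed term has \<open>t + d\<close>, so Cauchy-Schwarz is
      log-convexity in steps of \<open>d\<close>.\<close>
    let ?q0 = "\<lambda>i. if i < n then q i else 0" and ?q1 = "\<lambda>i. if i = 0 then 0 else q (i - 1)"
    have b0: "quad (Suc n) (?M t) ?q0 = b t" for t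
      unfolding b_def by (rule quad_extend) simp
    have b2: "quad (Suc n) (?M t) ?q1 = b (t + 2 * d)" for t
      unfolding quad_def b_def sum.lessThan_Suc_shift by (simp add: algebra_simps)
    have b1: "dotp (Suc n) ?q1 (mulv (Suc n) (?M t) ?q0) = b (t + d)" for t
    proof -
      have "mulv (Suc n) (?M t) ?q0 i = (\<Sum>j<n. ?M t i j * q j)" for i
        by (simp add: mulv_def)
      then show ?thesis
        unfolding dotp_def quad_def b_def sum.lessThan_Suc_shift
        by (simp add: algebra_simps sum_distrib_left)
    qed
    \<comment> \<open>The progression starts at \<open>x + d\<close> and moves left, so that
      \<open>a 0 - a 1\<close> is the form of the first difference of \<open>F 0\<close> at base
      point \<open>x\<close>.\<close>
    define a where "a k = b (x + d - real k * d)" for k :: nat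
    have "a 1 \<le> a 0"
    proof (rule bounded_log_convex_decreasing)
      fix k :: nat
      have le: "x + d - real k * d \<le> x + d" for k using d by simp
      show "0 \<le> a k" unfolding a_def b0[symmetric] by (rule psd[OF le])
      show "(a (Suc k))\<^sup>2 \<le> a k * a (Suc (Suc k))"
      proof -
        let ?t = "x + d - real (Suc (Suc k)) * d"
        have "(b (?t + d))\<^sup>2 \<le> b ?t * b (?t + 2 * d)"
          using psd_cauchy_schwarz[where z = ?q1 and w = ?q0 and N = "Suc n" and M = "?M ?t",
              OF sym psd[OF le]]
          unfolding b0 b1 b2 .
        then show ?thesis by (simp add: a_def algebra_simps)
      qed
      \<comment> \<open>\<open>F 0\<close> is nonnegative and increasing, so every entry lies
        between 0 and \<open>F 0 X\<close>, however far to the left the base point is.\<close>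
      show "a k \<le> (\<Sum>i<n. \<Sum>j<n. \<bar>q i * q j\<bar> * F 0 X)"
        unfolding a_def b_def quad_def
      proof (intro sum_mono)
        fix i j assume "i \<in> {..<n}" "j \<in> {..<n}"
        then have p: "x + d - real k * d + real (i + j) * d \<le> X" by (intro pt le) auto
        have "q i * q j * F 0 (x + d - real k * d + real (i + j) * d)
            \<le> \<bar>q i * q j\<bar> * F 0 (x + d - real k * d + real (i + j) * d)"
          using nonneg[OF down[OF X p]] by (intro mult_right_mono) auto
        also have "\<dots> \<le> \<bar>q i * q j\<bar> * F 0 X" by (intro mult_left_mono mono[OF X p]) auto
        finally show "q i * q j * F 0 (x + d - real k * d + real (i + j) * d) \<le> \<bar>q i * q j\<bar> * F 0 X" .
      qed
    qed
    then have "0 \<le> b (x + d) - b x" by (simp add: a_def)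
    also have "\<dots> = (\<Sum>i<n. \<Sum>j<n. q i * q j * (fdiff d ^^ 1) (F 0) (x + real (i + j) * d))"
      by (simp add: b_def quad_def fdiff_def sum_subtractf[symmetric] algebra_simps)
    finally show "0 \<le> (\<Sum>i<n. \<Sum>j<n. q i * q j * (fdiff d ^^ 1) (F 0) (x + real (i + j) * d))" .
  qed
qed

text \<open>The classical expansion of the Euler operator: its \<open>k\<close>th iterate on f is
  the sum of \<open>S(k, j) x^j f^(j)\<close> with Stirling numbers of the second kind. At x = e^s
  it is the \<open>k\<close>th derivative of f(e^s), see \<open>deriv_family_exp\<close>.\<close>

definition euler_family :: "(nat \<Rightarrow> real \<Rightarrow> real) \<Rightarrow> nat \<Rightarrow> real \<Rightarrow> real" where
  "euler_family F k x = (\<Sum>j\<le>k. real (Stirling k j) * x ^ j * F j x)"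

lemma euler_family_0 [simp]: "euler_family F 0 x = F 0 x"
  and euler_family_1: "euler_family F (Suc 0) x = x * F 1 x"
  by (simp_all add: euler_family_def)

lemma euler_family_Suc:
  "euler_family F (Suc k) x =
    x * (\<Sum>j\<le>k. real (Stirling k j) * (real j * x ^ (j - 1) * F j x + x ^ j * F (Suc j) x))"
proof -
  \<comment> \<open>The extra term has coefficient \<open>Stirling k (Suc k) = 0\<close>, and the
    term \<open>j = 0\<close> is killed by \<open>real j\<close>; together they permit the index
    shift.\<close>
  have "(\<Sum>j\<le>k. real j * real (Stirling k j) * x ^ j * F j x)
      = (\<Sum>j\<le>Suc k. real j * real (Stirling k j) * x ^ j * F j x)"
    by simp
  also have "\<dots> = (\<Sum>j\<le>k. real (Suc j) * real (Stirling k (Suc j)) * x ^ Suc j * F (Suc j) x)"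
    unfolding sum.atMost_Suc_shift by simp
  finally have 1: "(\<Sum>j\<le>k. real j * real (Stirling k j) * x ^ j * F j x) = \<dots>" .
  have "euler_family F (Suc k) x = (\<Sum>j\<le>k. real (Stirling (Suc k) (Suc j)) * x ^ Suc j * F (Suc j) x)"
    unfolding euler_family_def sum.atMost_Suc_shift by simp
  also have "\<dots> = (\<Sum>j\<le>k. real (Suc j) * real (Stirling k (Suc j)) * x ^ Suc j * F (Suc j) x)
      + (\<Sum>j\<le>k. real (Stirling k j) * x ^ Suc j * F (Suc j) x)"
    by (subst sum.distrib[symmetric], rule sum.cong) (simp_all add: algebra_simps)
  also have "\<dots> = (\<Sum>j\<le>k. real j * real (Stirling k j) * x ^ j * F j x + real (Stirling k j) * x ^ Suc j * F (Suc j) x)"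
    unfolding 1[symmetric] by (rule sum.distrib[symmetric])
  also have "\<dots> = (\<Sum>j\<le>k. x * (real (Stirling k j) * (real j * x ^ (j - 1) * F j x + x ^ j * F (Suc j) x)))"
  proof (rule sum.cong[OF refl])
    fix j
    show "real j * real (Stirling k j) * x ^ j * F j x + real (Stirling k j) * x ^ Suc j * F (Suc j) x
      = x * (real (Stirling k j) * (real j * x ^ (j - 1) * F j x + x ^ j * F (Suc j) x))"
      by (cases j) (simp_all add: algebra_simps)
  qed
  finally show ?thesis by (simp only: sum_distrib_left)
qed

lemma euler_family_has_derivative:
  assumes F: "deriv_family m F S" and "k < m" "x \<in> S"
  shows "(euler_family F k has_real_derivative
      (\<Sum>j\<le>k. real (Stirling k j) * (real j * x ^ (j - 1) * F j x + x ^ j * F (Suc j) x))) (at x)"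
proof -
  have 1: "((\<lambda>x. x ^ j * F j x) has_real_derivative real j * x ^ (j - 1) * F j x + x ^ j * F (Suc j) x) (at x)"
    if "j \<le> k" for j
  proof -
    have "(F j has_real_derivative F (Suc j) x) (at x)"
      using deriv_familyD[OF F _ \<open>x \<in> S\<close>] that \<open>k < m\<close> by simp
    from DERIV_mult'[OF DERIV_pow[of j x UNIV] this] show ?thesis
      by (simp add: algebra_simps)
  qed
  have "((\<lambda>x. \<Sum>j\<le>k. real (Stirling k j) * (x ^ j * F j x)) has_real_derivative
      (\<Sum>j\<le>k. real (Stirling k j) * (real j * x ^ (j - 1) * F j x + x ^ j * F (Suc j) x))) (at x)"
    by (intro DERIV_sum DERIV_cmult 1) simp
  then show ?thesis by (simp add: euler_family_def[abs_def] mult.assoc)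
qed

lemma deriv_family_exp:
  assumes F: "deriv_family m F S"
  shows "deriv_family m (\<lambda>k s. euler_family F k (exp s)) {s. exp s \<in> S}"
  unfolding deriv_family_def
proof (intro conjI allI ballI impI)
  fix k s assume "k < m" "s \<in> {s. exp s \<in> S}"
  then have "(euler_family F k has_real_derivative
      (\<Sum>j\<le>k. real (Stirling k j) * (real j * exp s ^ (j - 1) * F j (exp s) + exp s ^ j * F (Suc j) (exp s)))) (at (exp s))"
    using euler_family_has_derivative[OF F] by simp
  from DERIV_chain2[OF this DERIV_exp]
  show "((\<lambda>s. euler_family F k (exp s)) has_real_derivative euler_family F (Suc k) (exp s)) (at s)"
    unfolding euler_family_Suc by (simp only: mult.commute)
next
  have "continuous_on S (F j)" if "j \<le> m" for j using deriv_family_continuous[OF F that] .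
  then have "continuous_on S (euler_family F m)"
    unfolding euler_family_def by (intro continuous_intros) auto
  then show "continuous_on {s. exp s \<in> S} (\<lambda>s. euler_family F m (exp s))"
    by (rule continuous_on_compose2) (auto intro: continuous_intros)
qed

lemma psd_minor:
  assumes "sym_on N A" "\<And>v. 0 \<le> quad N A v" "i < N" "j < N"
  shows "(A i j)\<^sup>2 \<le> A i i * A j j"
proof -
  let ?e = "\<lambda>i k. if k = i then 1 else (0 :: real)"
  have m: "mulv N A (?e k) l = A l k" if "k < N" for k l
  proof -
    have "mulv N A (?e k) l = (\<Sum>j<N. if j = k then A l j else 0)"
      unfolding mulv_def by (intro sum.cong) auto
    then show ?thesis using that by simp
  qed
  have d: "dotp N (?e k) v = v k" if "k < N" for k v
  proof -
    have "dotp N (?e k) v = (\<Sum>j<N. if j = k then v j else 0)"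
      unfolding dotp_def by (intro sum.cong) auto
    then show ?thesis using that by simp
  qed
  show ?thesis
    using psd_cauchy_schwarz[OF assms(1,2), of "?e i" "?e j"] assms(3,4)
    by (simp add: quad_eq_dotp m d mult.commute)
qed

lemma quad_rank_one: "quad N (\<lambda>i j. z i * z j) c = (dotp N c z)\<^sup>2"
  unfolding quad_def dotp_def power2_eq_square sum_product by (simp add: mult_ac)

lemma quad_linear:
  "quad N (\<lambda>i j. a * A i j + b * B i j) c = a * quad N A c + b * quad N B c"
  unfolding quad_def sum_distrib_left sum.distrib[symmetric]
  by (intro sum.cong refl) (simp add: algebra_simps)

subsection \<open>From rank one to arbitrary matrices\<close>

text \<open>FitzGerald--Horn reduction: subtracting the rank one matrix \<open>\<zeta> \<zeta>\<^sup>T\<close> built from the last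
  column leaves a positive semidefinite matrix whose last row and column vanish. Along the segment
  from \<open>\<zeta> \<zeta>\<^sup>T\<close> to \<open>A\<close> the quadratic form is monotone by the Schur product theorem and the statement
  for \<open>f'\<close> in one dimension less.\<close>

lemma psd_schur_complement:
  assumes sym: "sym_on (Suc n) A" and psd: "\<And>c. 0 \<le> quad (Suc n) A c" and pos: "A n n > 0"
  defines "z \<equiv> \<lambda>i. A i n / sqrt (A n n)"
  shows "\<And>i. i \<le> n \<Longrightarrow> z i * z n = A i n" "z n = sqrt (A n n)"
    "\<And>c. 0 \<le> quad n (\<lambda>i j. A i j - z i * z j) c"
proof -
  show zn: "z n = sqrt (A n n)" using pos by (simp add: z_def real_div_sqrt)
  show zz: "z i * z n = A i n" if "i \<le> n" for i
    unfolding zn using pos by (simp add: z_def)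
  fix c
  define c' where "c' i = (if i < n then c i else - (\<Sum>i<n. c i * z i) / z n)" for i
  have zn0: "z n \<noteq> 0" using zn pos by simp
  have "dotp (Suc n) c' z = 0"
    using zn0 by (simp add: dotp_def c'_def)
  then have "0 \<le> quad (Suc n) (\<lambda>i j. 1 * A i j + (-1) * (z i * z j)) c'"
    using psd[of c'] by (simp only: quad_linear quad_rank_one) simp
  also have "\<dots> = quad n (\<lambda>i j. A i j - z i * z j) c"
  proof -
    have "A n i - z n * z i = 0" "A i n - z i * z n = 0" if "i \<le> n" for i
      using zz[OF that] sym that by (auto simp: sym_on_def mult.commute)
    then show ?thesis by (simp add: quad_def c'_def)
  qed
  finally show "0 \<le> quad n (\<lambda>i j. A i j - z i * z j) c" .
qed

text \<open>The passage from f to f' for rank one matrices, made in the variable s = ln x, where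
  products of entries become sums of nodes: kernel of order \<open>n + 1\<close>, then Hankel
  matrices of psi', then the kernel of psi' of order \<open>n\<close>.\<close>

lemma deriv_kernel_nonneg:
  assumes "open I" and pos: "\<And>x. x \<in> I \<Longrightarrow> 0 < x"
    and down: "\<And>x y. x \<in> I \<Longrightarrow> 0 < y \<Longrightarrow> y \<le> x \<Longrightarrow> y \<in> I"
    and F: "deriv_family (2 * n) F I" and "n > 0"
    and nonneg: "\<And>x. x \<in> I \<Longrightarrow> 0 \<le> F 0 x" "\<And>x. x \<in> I \<Longrightarrow> 0 \<le> F 1 x"
    and ker: "\<And>z c. (\<And>i. i \<le> n \<Longrightarrow> 0 < z i) \<Longrightarrow> (\<And>i j. i \<le> n \<Longrightarrow> j \<le> n \<Longrightarrow> z i * z j \<in> I)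
      \<Longrightarrow> 0 \<le> quad (Suc n) (\<lambda>i j. F 0 (z i * z j)) c"
    and z: "\<And>i. i < n \<Longrightarrow> 0 < z i" "\<And>i j. i < n \<Longrightarrow> j < n \<Longrightarrow> z i * z j \<in> I"
  shows "0 \<le> quad n (\<lambda>i j. F 1 (z i * z j)) c"
proof -
  let ?J = "{s. exp s \<in> I}"
  let ?P = "\<lambda>k s. euler_family F k (exp s)"
  have "?J = exp -` I" by auto
  then have oJ: "open ?J" using \<open>open I\<close> by (simp add: open_vimage continuous_on_exp)
  have dJ: "y \<in> ?J" if "x \<in> ?J" "y \<le> x" for x y
    using down[of "exp x" "exp y"] that by simp
  have iJ: "is_interval ?J" using dJ unfolding is_interval_1 by blast
  have fam: "deriv_family (2 * n - 2 + 1) ?P ?J"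
    by (rule deriv_family_mono[OF deriv_family_exp[OF F]]) (use \<open>n > 0\<close> in auto)
  have mono: "F 0 x \<le> F 0 y" if "y \<in> I" "0 < x" "x \<le> y" for x y
  proof (rule DERIV_nonneg_imp_nondecreasing[OF that(3)])
    fix t assume "x \<le> t" "t \<le> y"
    then have "t \<in> I" using down[OF that(1), of t] that by simp
    then show "\<exists>d. (F 0 has_real_derivative d) (at t) \<and> 0 \<le> d"
      using deriv_familyD[OF F, of 0 t] nonneg(2)[of t] \<open>n > 0\<close> by auto
  qed
  have hankel: "0 \<le> quad n (\<lambda>i j. ?P (i + j + 1) x) c" if "x \<in> ?J" for x c
  proof (rule hankel_deriv_nonneg[OF fam oJ dJ _ _ _ that])
    fix s :: "nat \<Rightarrow> real" and c
    assume "\<And>i j. i < Suc n \<Longrightarrow> j < Suc n \<Longrightarrow> s i + s j \<in> ?J"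
    then have "0 \<le> quad (Suc n) (\<lambda>i j. F 0 (exp (s i) * exp (s j))) c"
      by (intro ker) (auto simp: exp_add)
    then show "0 \<le> quad (Suc n) (\<lambda>i j. ?P 0 (s i + s j)) c" by (simp add: exp_add)
  qed (use nonneg mono in auto)
  have fam': "deriv_family (2 * n - 2) (\<lambda>k. ?P (k + 1)) ?J"
    by (rule deriv_family_shift[OF fam])
  \<comment> \<open>psi'(s) is x f'(x) with x = \<open>z i * z j\<close>; dividing the coefficients
    by \<open>z i\<close> removes the factor x.\<close>
  have "0 \<le> quad n (\<lambda>i j. ?P (0 + 1) (ln (z i) + ln (z j))) (\<lambda>i. c i / z i)"
    by (rule kernel_nonneg_of_hankel[OF fam' oJ iJ hankel]) (use z in \<open>auto simp: exp_add\<close>)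
  also have "\<dots> = quad n (\<lambda>i j. F 1 (z i * z j)) c"
    unfolding quad_def
  proof (intro sum.cong refl)
    fix i j assume "i \<in> {..<n}" "j \<in> {..<n}"
    then have "0 < z i" "0 < z j" using z(1) by auto
    then show "c i / z i * (c j / z j) * ?P (0 + 1) (ln (z i) + ln (z j)) = c i * c j * F 1 (z i * z j)"
      by (simp add: exp_add euler_family_1)
  qed
  finally show ?thesis .
qed

text \<open>The rank one case is a hypothesis and thus part of the induction over \<open>F\<close>;
  for the shifted family it is renewed by \<open>deriv_kernel_nonneg\<close>.\<close>

lemma preserves_psd:
  assumes "open I" and pos: "\<And>x. x \<in> I \<Longrightarrow> 0 < x"
    and down: "\<And>x y. x \<in> I \<Longrightarrow> 0 < y \<Longrightarrow> y \<le> x \<Longrightarrow> y \<in> I"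
    and "deriv_family (2 * n - 2) F I"
    and "\<And>r x. r < n \<Longrightarrow> x \<in> I \<Longrightarrow> 0 \<le> F r x"
    and "\<And>z c. (\<And>i. i < n \<Longrightarrow> 0 < z i) \<Longrightarrow> (\<And>i j. i < n \<Longrightarrow> j < n \<Longrightarrow> z i * z j \<in> I)
      \<Longrightarrow> 0 \<le> quad n (\<lambda>i j. F 0 (z i * z j)) c"
    and "sym_on n A" "\<And>c. 0 \<le> quad n A c" "\<And>i j. i < n \<Longrightarrow> j < n \<Longrightarrow> A i j \<in> I"
  shows "0 \<le> quad n (\<lambda>i j. F 0 (A i j)) c"
  using assms(4-)
proof (induction n arbitrary: F A c)
  case 0
  then show ?case by (simp add: quad_def)
next
  case (Suc n)
  note F = Suc.prems(1) and nonneg = Suc.prems(2) and ker = Suc.prems(3)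
    and sym = Suc.prems(4) and psd = Suc.prems(5) and AI = Suc.prems(6)
  have Apos: "A n n > 0" using AI[of n n] pos by simp
  define z where "z i = A i n / sqrt (A n n)" for i
  note sc = psd_schur_complement[OF sym psd Apos, folded z_def]
  have zpos: "0 < z i" if "i \<le> n" for i
    using AI[of i n] that Apos pos by (simp add: z_def)
  have zI: "z i * z j \<in> I" if "i \<le> n" "j \<le> n" for i j
  proof -
    \<comment> \<open>The minor of rows \<open>i\<close> and \<open>n\<close> bounds
      \<open>z i ^ 2\<close> by the diagonal entry. Hence the rank one part has entries below some
      diagonal entry of \<open>A\<close>, and they stay in \<open>I\<close>, which is closed
      downwards.\<close>
    have sq: "(z i)\<^sup>2 \<le> A i i" if "i \<le> n" for i
    proof -
      have "(A i n)\<^sup>2 \<le> A i i * A n n" by (rule psd_minor[OF sym psd]) (use that in auto)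
      then show ?thesis using Apos by (simp add: z_def power_divide pos_divide_le_eq)
    qed
    have "z i * z j \<le> max ((z i)\<^sup>2) ((z j)\<^sup>2)"
    proof (cases "z i \<le> z j")
      case True
      then have "z i * z j \<le> z j * z j" using zpos[OF that(2)] by (intro mult_right_mono) auto
      then show ?thesis by (simp add: power2_eq_square)
    next
      case False
      then have "z i * z j \<le> z i * z i" using zpos[OF that(1)] by (intro mult_left_mono) auto
      then show ?thesis by (simp add: power2_eq_square)
    qed
    also have "\<dots> \<le> max (A i i) (A j j)" using sq that by (intro max.mono) auto
    finally have le: "z i * z j \<le> max (A i i) (A j j)" .
    have "max (A i i) (A j j) \<in> I" using AI that by (simp add: max_def)
    then show ?thesis using down[of "max (A i i) (A j j)" "z i * z j"] le zpos that by simp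
  qed
  have rank1: "0 \<le> quad (Suc n) (\<lambda>i j. F 0 (z i * z j)) c"
    by (rule ker) (use zpos zI in auto)
  show ?case
  proof (cases "n = 0")
    case True
    have "z 0 * z 0 = A 0 0" using sc(1)[of 0] True by simp
    then show ?thesis using rank1 True by (simp add: quad_def)
  next
    case False
    define B where "B t i j = z i * z j + t * (A i j - z i * z j)" for t i j
    let ?Q = "\<lambda>t. quad (Suc n) (\<lambda>i j. F 0 (B t i j)) c"
    have BI: "B t i j \<in> I" if "0 \<le> t" "t \<le> 1" "i \<le> n" "j \<le> n" for t i j
    proof -
      have m: "max (z i * z j) (A i j) \<in> I" using zI AI that by (simp add: max_def)
      have eq: "B t i j = (1 - t) * (z i * z j) + t * A i j" by (simp add: B_def algebra_simps)
      have p: "0 < z i * z j" "0 < A i j" using zI AI that pos by auto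
      have "0 < B t i j"
      \<comment> \<open>For \<open>t < 1\<close> positivity comes from the term with weight
        \<open>1 - t\<close>; at \<open>t = 1\<close> it comes from \<open>A i j\<close>.\<close>
      proof (cases "t = 1")
        case False
        then have "0 < (1 - t) * (z i * z j)" using that p by simp
        moreover have "0 \<le> t * A i j" using that p by simp
        ultimately show ?thesis unfolding eq by linarith
      qed (use eq p in simp)
      moreover have "B t i j \<le> max (z i * z j) (A i j)"
        unfolding eq using that by (intro convex_bound_le) auto
      ultimately show ?thesis by (rule down[OF m])
    qed
    have "?Q 0 \<le> ?Q 1"
    proof (rule DERIV_nonneg_imp_nondecreasing[where f = ?Q])
      fix t :: real assume t: "0 \<le> t" "t \<le> 1"
      let ?D = "\<lambda>i j. A i j - z i * z j"
      have dQ: "(?Q has_real_derivative quad (Suc n) (\<lambda>i j. ?D i j * F 1 (B t i j)) c) (at t)"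
        unfolding quad_def
      proof (intro DERIV_sum DERIV_cmult)
        fix i j assume "i \<in> {..<Suc n}" "j \<in> {..<Suc n}"
        then have "(F 0 has_real_derivative F 1 (B t i j)) (at (B t i j))"
          using deriv_familyD[OF F, of 0] BI[OF t] False by simp
        moreover have "((\<lambda>t. B t i j) has_real_derivative ?D i j) (at t)"
          unfolding B_def by (auto intro!: derivative_eq_intros)
        ultimately have "((\<lambda>t. F 0 (B t i j)) has_real_derivative F 1 (B t i j) * ?D i j) (at t)"
          by (rule DERIV_chain2)
        then show "((\<lambda>t. F 0 (B t i j)) has_real_derivative ?D i j * F 1 (B t i j)) (at t)"
          by (simp add: mult.commute)
      qed
      \<comment> \<open>The last row and column of \<open>?D\<close> vanish, so index
        \<open>n\<close> drops out and the statement for f' is needed only in dimension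
        \<open>n\<close>.\<close>
      have dQ_eq: "quad (Suc n) (\<lambda>i j. ?D i j * F 1 (B t i j)) c
          = quad n (\<lambda>i j. ?D i j * F 1 (B t i j)) c"
      proof -
        have "?D n i = 0" "?D i n = 0" if "i \<le> n" for i
          using sc(1)[OF that] sym that by (auto simp: sym_on_def mult.commute)
        then show ?thesis by (simp add: quad_def)
      qed
      have "0 \<le> quad n (\<lambda>i j. ?D i j * F 1 (B t i j)) c"
      proof (rule schur_product)
        show "sym_on n ?D" using sym by (auto simp: sym_on_def mult.commute)
        show "0 \<le> quad n ?D v" for v by (rule sc(3))
        show "0 \<le> quad n (\<lambda>i j. F 1 (B t i j)) v" for v
        proof -
          have "0 \<le> quad n (\<lambda>i j. F (0 + 1) (B t i j)) v"
          proof (rule Suc.IH[where F = "\<lambda>k. F (k + 1)"])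
            show "deriv_family (2 * n - 2) (\<lambda>k. F (k + 1)) I"
              by (intro deriv_family_shift deriv_family_mono[OF F]) (use False in auto)
            show "0 \<le> F (r + 1) x" if "r < n" "x \<in> I" for r x
              using nonneg[of "r + 1" x] that by simp
            show "0 \<le> quad n (\<lambda>i j. F (0 + 1) (w i * w j)) b"
              if w: "\<And>i. i < n \<Longrightarrow> 0 < w i" "\<And>i j. i < n \<Longrightarrow> j < n \<Longrightarrow> w i * w j \<in> I" for w b
            proof -
              have "0 \<le> quad n (\<lambda>i j. F 1 (w i * w j)) b"
              proof (rule deriv_kernel_nonneg[OF \<open>open I\<close> pos down])
                show "deriv_family (2 * n) F I" using F by simp
                show "0 \<le> quad (Suc n) (\<lambda>i j. F 0 (y i * y j)) b"
                  if "\<And>i. i \<le> n \<Longrightarrow> 0 < y i" "\<And>i j. i \<le> n \<Longrightarrow> j \<le> n \<Longrightarrow> y i * y j \<in> I" for y b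
                  by (rule ker) (use that in auto)
              qed (use w nonneg[of 0] nonneg[of 1] False in auto)
              then show ?thesis by simp
            qed
            show "sym_on n (B t)" using sym by (auto simp: sym_on_def B_def mult.commute)
            show "0 \<le> quad n (B t) b" for b
            proof -
              have "B t = (\<lambda>i j. 1 * (z i * z j) + t * ?D i j)" by (simp add: B_def fun_eq_iff)
              then have "quad n (B t) b = 1 * quad n (\<lambda>i j. z i * z j) b + t * quad n ?D b"
                by (simp only: quad_linear)
              then show ?thesis using sc(3)[of b] t by (simp add: quad_rank_one)
            qed
            show "B t i j \<in> I" if "i < n" "j < n" for i j using BI[OF t] that by simp
          qed
          then show ?thesis by simp
        qed
      qed
      then have "0 \<le> quad (Suc n) (\<lambda>i j. ?D i j * F 1 (B t i j)) c" by (simp only: dQ_eq)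
      with dQ show "\<exists>d. (?Q has_real_derivative d) (at t) \<and> 0 \<le> d" by (intro exI conjI)
    qed simp
    then show ?thesis using rank1 by (simp add: B_def)
  qed
qed

subsection \<open>Square roots and pencils of matrices\<close>

abbreviation mat_fun :: "real mat \<Rightarrow> nat \<Rightarrow> nat \<Rightarrow> real" where
  "mat_fun A \<equiv> \<lambda>i j. A $$ (i, j)"

lemma quad_cong:
  assumes "\<And>i j. i < N \<Longrightarrow> j < N \<Longrightarrow> A i j = B i j" "\<And>i. i < N \<Longrightarrow> u i = v i"
  shows "quad N A u = quad N B v"
  unfolding quad_def by (intro sum.cong refl) (use assms in auto)

lemma mult_mat_vec_eq_mulv:
  assumes "A \<in> carrier_mat n n" "v \<in> carrier_vec n" "i < n"
  shows "(A *\<^sub>v v) $ i = mulv n (mat_fun A) (($) v) i"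
  using assms by (auto simp: mulv_def scalar_prod_def atLeast0LessThan intro!: sum.cong)

lemma scalar_prod_eq_quad:
  assumes "A \<in> carrier_mat n n" "v \<in> carrier_vec n"
  shows "v \<bullet> (A *\<^sub>v v) = quad n (mat_fun A) (($) v)"
proof -
  have "v \<bullet> (A *\<^sub>v v) = (\<Sum>i<n. v $ i * (A *\<^sub>v v) $ i)"
    using assms by (simp add: scalar_prod_def atLeast0LessThan)
  also have "\<dots> = dotp n (($) v) (mulv n (mat_fun A) (($) v))"
    unfolding dotp_def by (intro sum.cong refl) (simp add: mult_mat_vec_eq_mulv[OF assms])
  finally show ?thesis by (simp add: quad_eq_dotp)
qed

lemma quad_vec: "quad n M (($) (vec n c)) = quad n M c"
  by (rule quad_cong) auto

lemma sym_on_mat_fun: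
  assumes "A \<in> carrier_mat n n"
  shows "sym_on n (mat_fun A) \<longleftrightarrow> A\<^sup>T = A"
proof
  assume "A\<^sup>T = A"
  then have "A\<^sup>T $$ (i, j) = A $$ (i, j)" for i j by simp
  then have "A $$ (j, i) = A $$ (i, j)" if "i < n" "j < n" for i j
    using assms that by (metis carrier_matD index_transpose_mat(1))
  then show "sym_on n (mat_fun A)" by (simp add: sym_on_def)
qed (use assms in \<open>auto simp: sym_on_def intro!: eq_matI\<close>)

lemma psd_mat_iff:
  assumes A: "A \<in> carrier_mat n n"
  shows "psd_mat A \<longleftrightarrow> sym_on n (mat_fun A) \<and> (\<forall>c. 0 \<le> quad n (mat_fun A) c)"
proof -
  have "(\<forall>v\<in>carrier_vec n. 0 \<le> v \<bullet> (A *\<^sub>v v)) \<longleftrightarrow> (\<forall>c. 0 \<le> quad n (mat_fun A) c)"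
  proof
    assume l: "\<forall>v\<in>carrier_vec n. 0 \<le> v \<bullet> (A *\<^sub>v v)"
    show "\<forall>c. 0 \<le> quad n (mat_fun A) c"
    proof
      fix c
      have "0 \<le> vec n c \<bullet> (A *\<^sub>v vec n c)" using l by simp
      also have "\<dots> = quad n (mat_fun A) c" by (simp add: scalar_prod_eq_quad[OF A] quad_vec)
      finally show "0 \<le> quad n (mat_fun A) c" .
    qed
  qed (simp add: scalar_prod_eq_quad[OF A])
  then show ?thesis using A by (simp add: psd_mat_def sym_on_mat_fun[OF A])
qed

lemma pd_mat_imp:
  assumes A: "A \<in> carrier_mat n n" and pd: "pd_mat A"
  shows "sym_on n (mat_fun A)" "pos_def n (mat_fun A)"
proof -
  show "sym_on n (mat_fun A)" using assms by (simp add: pd_mat_def sym_on_mat_fun[OF A])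
  show "pos_def n (mat_fun A)"
    unfolding pos_def_def
  proof (intro allI impI)
    fix v assume "\<exists>i<n. v i \<noteq> (0 :: real)"
    then obtain i where "i < n" "v i \<noteq> 0" by blast
    then have "vec n v \<noteq> 0\<^sub>v n" by (metis index_vec index_zero_vec(1))
    then have "0 < vec n v \<bullet> (A *\<^sub>v vec n v)" using pd A by (simp add: pd_mat_def)
    then show "0 < quad n (mat_fun A) v" by (simp add: scalar_prod_eq_quad[OF A] quad_vec)
  qed
qed

lemma mulv_cong:
  assumes "\<And>i j. i < n \<Longrightarrow> j < n \<Longrightarrow> A i j = B i j" "\<And>j. j < n \<Longrightarrow> u j = v j" "i < n"
  shows "mulv n A u i = mulv n B v i"
  unfolding mulv_def using assms by (intro sum.cong) auto

lemma dotp_cong: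
  "(\<And>i. i < n \<Longrightarrow> u i = u' i) \<Longrightarrow> (\<And>i. i < n \<Longrightarrow> v i = v' i) \<Longrightarrow> dotp n u v = dotp n u' v'"
  unfolding dotp_def by (intro sum.cong) auto

lemma mulv_mult_mat:
  assumes "A \<in> carrier_mat n n" "B \<in> carrier_mat n n" "i < n"
  shows "mulv n (mat_fun (A * B)) v i = mulv n (mat_fun A) (mulv n (mat_fun B) v) i"
proof -
  have "mulv n (mat_fun (A * B)) v i = (\<Sum>j<n. \<Sum>l<n. A $$ (i, l) * B $$ (l, j) * v j)"
    unfolding mulv_def
    by (intro sum.cong refl) (use assms in \<open>auto simp: scalar_prod_def atLeast0LessThan sum_distrib_right\<close>)
  also have "\<dots> = (\<Sum>l<n. \<Sum>j<n. A $$ (i, l) * B $$ (l, j) * v j)" by (rule sum.swap)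
  finally show ?thesis by (simp add: mulv_def sum_distrib_left mult_ac)
qed

lemma mulv_one_mat: "i < n \<Longrightarrow> mulv n (mat_fun (1\<^sub>m n)) v i = v i"
  using mulv_cong[of n "mat_fun (1\<^sub>m n)" ident v v i] mulv_ident[of i n v]
  by (simp add: ident_def)

lemma exists_psd_sqrt:
  assumes A: "A \<in> carrier_mat n n" and psd: "psd_mat A"
  shows "\<exists>S. psd_mat S \<and> S * S = A"
proof -
  have sym: "sym_on n (mat_fun A)" and nonneg: "\<And>c. 0 \<le> quad n (mat_fun A) c"
    using psd by (auto simp: psd_mat_iff[OF A])
  obtain e lam where e: "\<And>l m. l < n \<Longrightarrow> m < n \<Longrightarrow> dotp n (e l) (e m) = ident l m"
    and ev: "\<And>l i. l < n \<Longrightarrow> i < n \<Longrightarrow> mulv n (mat_fun A) (e l) i = lam l * e l i"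
    and dec: "\<And>i j. i < n \<Longrightarrow> j < n \<Longrightarrow> A $$ (i, j) = (\<Sum>k<n. lam k * e k i * e k j)"
    using spectral_decomposition[OF sym] by blast
  have lam: "lam k \<ge> 0" if "k < n" for k
  proof -
    have "quad n (mat_fun A) (e k) = dotp n (e k) (\<lambda>i. lam k * e k i)"
      unfolding quad_eq_dotp by (rule dotp_cong) (use ev that in auto)
    then show ?thesis using nonneg[of "e k"] e[OF that that] by (simp add: dotp_scale_right ident_def)
  qed
  define r where "r k = sqrt (lam k)" for k
  define S where "S = mat n n (\<lambda>(i, j). \<Sum>k<n. r k * e k i * e k j)"
  have S: "S \<in> carrier_mat n n" by (simp add: S_def)
  have "S * S = A"
  proof (rule eq_matI)
    fix i j assume "i < dim_row A" "j < dim_col A"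
    then have ij: "i < n" "j < n" using A by auto
    have "(S * S) $$ (i, j) = (\<Sum>l<n. (\<Sum>k<n. r k * e k i * e k l) * (\<Sum>m<n. r m * e m j * e m l))"
      using ij by (simp add: S_def scalar_prod_def atLeast0LessThan mult_ac)
    also have "\<dots> = (\<Sum>l<n. \<Sum>k<n. \<Sum>m<n. r k * e k i * (r m * e m j) * (e k l * e m l))"
      by (simp add: sum_product mult_ac)
    also have "\<dots> = (\<Sum>k<n. \<Sum>m<n. \<Sum>l<n. r k * e k i * (r m * e m j) * (e k l * e m l))"
      by (subst sum.swap, subst (2) sum.swap) (rule refl)
    also have "\<dots> = (\<Sum>k<n. \<Sum>m<n. if m = k then r k * e k i * (r m * e m j) else 0)"
    proof (intro sum.cong refl)
      fix k m assume "k \<in> {..<n}" "m \<in> {..<n}"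
      then have "(\<Sum>l<n. e k l * e m l) = ident k m" using e by (simp add: dotp_def)
      then show "(\<Sum>l<n. r k * e k i * (r m * e m j) * (e k l * e m l))
          = (if m = k then r k * e k i * (r m * e m j) else 0)"
        unfolding sum_distrib_left[symmetric] by (simp add: ident_def)
    qed
    also have "\<dots> = (\<Sum>k<n. lam k * e k i * e k j)"
    proof (rule sum.cong[OF refl])
      fix k assume "k \<in> {..<n}"
      then have k: "k < n" by simp
      have "r k * r k = lam k" using lam[OF k] by (simp add: r_def)
      then show "(\<Sum>m<n. if m = k then r k * e k i * (r m * e m j) else 0) = lam k * e k i * e k j"
        using k by (simp add: mult_ac)
    qed
    finally show "(S * S) $$ (i, j) = A $$ (i, j)" using dec[OF ij] by simp
  qed (use A S in auto)
  moreover have "psd_mat S"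
    unfolding psd_mat_iff[OF S]
  proof (intro conjI allI)
    show "sym_on n (mat_fun S)" by (auto simp: sym_on_def S_def mult_ac)
    fix c
    show "0 \<le> quad n (mat_fun S) c"
    proof (cases n)
      case 0 then show ?thesis by (simp add: quad_def)
    next
      case (Suc m)
      have "quad n (mat_fun S) c = quad n (\<lambda>i j. \<Sum>k\<le>m. r k * e k i * e k j) c"
        by (rule quad_cong) (auto simp: S_def Suc lessThan_Suc_atMost)
      also have "\<dots> \<ge> 0"
        unfolding quad_sum_squares using lam Suc by (intro sum_nonneg) (auto simp: r_def)
      finally show ?thesis .
    qed
  qed
  ultimately show ?thesis by blast
qed

lemma psd_sqrt_carrier:
  assumes "A \<in> carrier_mat n n" "psd_mat S" "S * S = A"
  shows "S \<in> carrier_mat n n"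
proof -
  have "dim_row S = n" using arg_cong[OF assms(3), of dim_row] assms(1) by simp
  then show ?thesis using assms(2) by (auto simp: psd_mat_def)
qed

lemma psd_quad_eq_0:
  assumes "sym_on N M" "\<And>v. 0 \<le> quad N M v" "quad N M x = 0" "i < N"
  shows "mulv N M x i = 0"
proof -
  have "dotp N z (mulv N M x) = 0" for z
    using psd_cauchy_schwarz[OF assms(1,2), of z x] assms(3) by simp
  then have "dotp N z (mulv N M x) = dotp N z (\<lambda>_. 0)" for z by (simp add: dotp_def)
  then show ?thesis using dotp_eqI[of N "mulv N M x" "\<lambda>_. 0" i] assms(4) by simp
qed

text \<open>If \<open>(S - T) x = \<mu> x\<close> then \<open>\<mu> (x \<bullet> S x + x \<bullet> T x) = |S x|\<^sup>2 - |T x|\<^sup>2 = 0\<close>, so \<open>\<mu> = 0\<close>.\<close>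

lemma psd_sqrt_unique:
  assumes A: "A \<in> carrier_mat n n"
    and S: "psd_mat S" "S * S = A" and T: "psd_mat T" "T * T = A"
  shows "S = T"
proof -
  have cS: "S \<in> carrier_mat n n" by (rule psd_sqrt_carrier[OF A S])
  have cT: "T \<in> carrier_mat n n" by (rule psd_sqrt_carrier[OF A T])
  note pS = S(1)[unfolded psd_mat_iff[OF cS]] and pT = T(1)[unfolded psd_mat_iff[OF cT]]
  let ?D = "\<lambda>i j. S $$ (i, j) - T $$ (i, j)"
  have "sym_on n ?D" using pS pT by (simp add: sym_on_def)
  then obtain e lam where e: "\<And>l m. l < n \<Longrightarrow> m < n \<Longrightarrow> dotp n (e l) (e m) = ident l m"
    and ev: "\<And>l i. l < n \<Longrightarrow> i < n \<Longrightarrow> mulv n ?D (e l) i = lam l * e l i"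
    and dec: "\<And>i j. i < n \<Longrightarrow> j < n \<Longrightarrow> ?D i j = (\<Sum>k<n. lam k * e k i * e k j)"
    using spectral_decomposition by blast
  have "lam k = 0" if k: "k < n" for k
  proof (rule ccontr)
    assume nz: "lam k \<noteq> 0"
    let ?x = "e k"
    let ?a = "mulv n (mat_fun S) ?x" and ?b = "mulv n (mat_fun T) ?x"
    have ab: "?a i - ?b i = lam k * ?x i" if "i < n" for i
      using ev[OF k that] by (simp add: mulv_def left_diff_distrib sum_subtractf)
    have aa: "dotp n ?a ?a = dotp n ?x (mulv n (mat_fun A) ?x)"
    proof -
      have "dotp n ?a ?a = dotp n ?x (mulv n (mat_fun S) ?a)"
        using dotp_mulv_sym[of n "mat_fun S" ?a ?x] pS by simp
      also have "\<dots> = dotp n ?x (mulv n (mat_fun A) ?x)"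
        by (rule dotp_cong[OF refl]) (simp add: mulv_mult_mat[OF cS cS, symmetric] S(2))
      finally show ?thesis .
    qed
    have bb: "dotp n ?b ?b = dotp n ?x (mulv n (mat_fun A) ?x)"
    proof -
      have "dotp n ?b ?b = dotp n ?x (mulv n (mat_fun T) ?b)"
        using dotp_mulv_sym[of n "mat_fun T" ?b ?x] pT by simp
      also have "\<dots> = dotp n ?x (mulv n (mat_fun A) ?x)"
        by (rule dotp_cong[OF refl]) (simp add: mulv_mult_mat[OF cT cT, symmetric] T(2))
      finally show ?thesis .
    qed
    have "lam k * (quad n (mat_fun S) ?x + quad n (mat_fun T) ?x)
        = dotp n (\<lambda>i. ?a i + ?b i) (\<lambda>i. lam k * ?x i)"
      by (simp add: dotp_scale_right dotp_commute[of n "\<lambda>i. ?a i + ?b i"] dotp_add_right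
          dotp_commute[of n ?x] quad_eq_dotp)
    also have "\<dots> = dotp n (\<lambda>i. ?a i + ?b i) (\<lambda>i. ?a i - ?b i)"
      by (rule dotp_cong) (simp_all add: ab)
    also have "\<dots> = dotp n ?a ?a - dotp n ?b ?b"
      by (simp add: dotp_def algebra_simps sum.distrib sum_subtractf)
    also have "\<dots> = 0" by (simp add: aa bb)
    finally have "quad n (mat_fun S) ?x + quad n (mat_fun T) ?x = 0" using nz by simp
    then have "quad n (mat_fun S) ?x = 0" "quad n (mat_fun T) ?x = 0"
      using pS pT by (smt (verit))+
    then have "?a i = 0" "?b i = 0" if "i < n" for i
      using psd_quad_eq_0[of n "mat_fun S" ?x i] psd_quad_eq_0[of n "mat_fun T" ?x i] pS pT that by auto
    then have "?x i = 0" if "i < n" for i using ab[OF that] nz that by simp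
    then have "dotp n ?x ?x = 0" by (simp add: dotp_def)
    then show False using e[OF k k] by (simp add: ident_def)
  qed
  then have "?D i j = 0" if "i < n" "j < n" for i j using dec[OF that] by simp
  then show ?thesis using cS cT by (intro eq_matI) auto
qed

lemma mat_sqrt:
  assumes "A \<in> carrier_mat n n" "psd_mat A"
  shows "psd_mat (mat_sqrt A)" "mat_sqrt A * mat_sqrt A = A"
proof -
  have "\<exists>!S. psd_mat S \<and> S * S = A"
    using exists_psd_sqrt[OF assms] psd_sqrt_unique[OF assms(1)] by blast
  from theI'[OF this] show "psd_mat (mat_sqrt A)" "mat_sqrt A * mat_sqrt A = A"
    by (simp_all add: mat_sqrt_def)
qed

lemma mat_inv_sqrt:
  assumes H: "H \<in> carrier_mat n n" and pd: "pd_mat H"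
  defines "S \<equiv> mat_inv_sqrt H"
  shows "S \<in> carrier_mat n n" "sym_on n (mat_fun S)" "S * S * H = 1\<^sub>m n" "S * H * S = 1\<^sub>m n"
proof -
  note H' = pd_mat_imp[OF H pd]
  have ker: "v = 0\<^sub>v n" if "v \<in> carrier_vec n" "H *\<^sub>v v = 0\<^sub>v n" for v
  proof (rule ccontr)
    assume "v \<noteq> 0\<^sub>v n"
    then have "0 < v \<bullet> (H *\<^sub>v v)" using pd H that by (auto simp: pd_mat_def)
    then show False using that by simp
  qed
  then have "det H \<noteq> 0" using det_0_iff_vec_prod_zero[OF H] by blast
  then have "mat_inverse H \<noteq> None"
    using mat_inverse(1)[OF H, of "()"] det_non_zero_imp_unit[OF H, of "()"] by blast
  then obtain G where G: "mat_inverse H = Some G" by blast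
  have G': "H * G = 1\<^sub>m n" "G * H = 1\<^sub>m n" "G \<in> carrier_mat n n"
    using mat_inverse(2)[OF H G] by auto
  have HT: "H\<^sup>T = H" using pd by (simp add: pd_mat_def)
  have "G\<^sup>T * H = 1\<^sub>m n"
    using transpose_mult[OF H G'(3)] G'(1) HT by simp
  \<comment> \<open>As \<open>H\<close> is symmetric, the transposed right inverse is a left
    inverse, and the two coincide; so \<open>G\<close> is symmetric.\<close>
  have "G\<^sup>T = G\<^sup>T * (H * G)" using G' by simp
  also have "\<dots> = (G\<^sup>T * H) * G"
    using assoc_mult_mat[of "G\<^sup>T" n n H n G n] G'(3) H by simp
  finally have GT: "G\<^sup>T = G" using \<open>G\<^sup>T * H = 1\<^sub>m n\<close> G'(3) by simp
  have "psd_mat G"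
    unfolding psd_mat_iff[OF G'(3)]
  proof (intro conjI allI)
    show sG: "sym_on n (mat_fun G)" using GT by (simp add: sym_on_mat_fun[OF G'(3)])
    fix c
    \<comment> \<open>Since \<open>c\<close> equals \<open>H\<close> applied to \<open>?u\<close>,
      the form of the inverse at \<open>c\<close> is the form of \<open>H\<close> at
      \<open>?u\<close>.\<close>
    let ?u = "mulv n (mat_fun G) c"
    have "quad n (mat_fun G) c = dotp n ?u c" by (simp add: quad_eq_dotp dotp_commute)
    also have "\<dots> = dotp n ?u (mulv n (mat_fun H) ?u)"
      by (rule dotp_cong[OF refl])
        (simp add: mulv_mult_mat[OF H G'(3), symmetric] G'(1) mulv_one_mat)
    also have "\<dots> = quad n (mat_fun H) ?u" by (simp add: quad_eq_dotp)
    also have "\<dots> \<ge> 0"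
      using H'(2) quad_eq_0[of n ?u "mat_fun H"] unfolding pos_def_def by (metis less_imp_le order_refl)
    finally show "0 \<le> quad n (mat_fun G) c" .
  qed
  from mat_sqrt[OF G'(3) this] have S: "psd_mat S" "S * S = G"
    by (simp_all add: S_def mat_inv_sqrt_def G)
  show cS: "S \<in> carrier_mat n n" by (rule psd_sqrt_carrier[OF G'(3) S])
  show "sym_on n (mat_fun S)" using S(1) psd_mat_iff[OF cS] by simp
  show SSH: "S * S * H = 1\<^sub>m n" using S(2) G'(2) by simp
  have "S * (S * H) = 1\<^sub>m n" using SSH assoc_mult_mat[OF cS cS H] by simp
  then show "S * H * S = 1\<^sub>m n" using mat_mult_left_right_inverse[of S n "S * H"] cS H by simp
qed

text \<open>Minimising the form of \<open>- B\<close> produces an eigenvalue \<open>- \<mu>\<close>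
  of \<open>B\<close> that bounds its form from above. This also shows that the finite spectrum is
  nonempty, so its \<open>Max\<close> is meaningful.\<close>

lemma lambda_max_le_iff:
  assumes B: "B \<in> carrier_mat n n" and sym: "sym_on n (mat_fun B)" and "n > 0"
  shows "lambda_max B \<le> K \<longleftrightarrow> (\<forall>v. quad n (mat_fun B) v \<le> K * dotp n v v)"
proof -
  have fin: "finite (spectrum B)" using card_finite_spectrum[OF B] by simp
  have eig: "k \<in> spectrum B \<longleftrightarrow> (\<exists>w. (\<exists>i<n. w i \<noteq> 0) \<and> (\<forall>i<n. mulv n (mat_fun B) w i = k * w i))" for k
  proof
    assume "k \<in> spectrum B"
    then obtain v where v: "v \<in> carrier_vec n" "v \<noteq> 0\<^sub>v n" "B *\<^sub>v v = k \<cdot>\<^sub>v v"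
      using B by (auto simp: spectrum_def eigenvalue_def eigenvector_def)
    have "\<exists>i<n. v $ i \<noteq> 0" using v(1,2) by (auto intro: eq_vecI)
    moreover have "\<forall>i<n. mulv n (mat_fun B) (($) v) i = k * v $ i"
      using mult_mat_vec_eq_mulv[OF B v(1), symmetric] v(1,3) by simp
    ultimately show "\<exists>w. (\<exists>i<n. w i \<noteq> 0) \<and> (\<forall>i<n. mulv n (mat_fun B) w i = k * w i)" by blast
  next
    assume "\<exists>w. (\<exists>i<n. w i \<noteq> 0) \<and> (\<forall>i<n. mulv n (mat_fun B) w i = k * w i)"
    then obtain w where w: "\<exists>i<n. w i \<noteq> 0" "\<And>i. i < n \<Longrightarrow> mulv n (mat_fun B) w i = k * w i" by blast
    have "vec n w \<noteq> 0\<^sub>v n" using w(1) by (metis index_vec index_zero_vec(1))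
    moreover have "B *\<^sub>v vec n w = k \<cdot>\<^sub>v vec n w"
    proof (rule eq_vecI)
      fix i assume "i < dim_vec (k \<cdot>\<^sub>v vec n w)"
      then have i: "i < n" by simp
      have "(B *\<^sub>v vec n w) $ i = mulv n (mat_fun B) (($) (vec n w)) i"
        by (rule mult_mat_vec_eq_mulv[OF B _ i]) simp
      also have "\<dots> = mulv n (mat_fun B) w i" by (rule mulv_cong) (use i in auto)
      finally show "(B *\<^sub>v vec n w) $ i = (k \<cdot>\<^sub>v vec n w) $ i" using w(2)[OF i] i by simp
    qed (use B in auto)
    ultimately show "k \<in> spectrum B"
      using B by (auto simp: spectrum_def eigenvalue_def eigenvector_def intro!: exI[of _ "vec n w"])
  qed
  have quad_eig: "quad n (mat_fun B) w = k * dotp n w w"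
    if "\<And>i. i < n \<Longrightarrow> mulv n (mat_fun B) w i = k * w i" for w k
  proof -
    have "quad n (mat_fun B) w = dotp n w (\<lambda>i. k * w i)"
      unfolding quad_eq_dotp by (rule dotp_cong) (use that in auto)
    then show ?thesis by (simp add: dotp_scale_right)
  qed
  have "sym_on n (\<lambda>i j. - B $$ (i, j))" using sym by (simp add: sym_on_def)
  then obtain w \<mu> where w: "\<exists>i<n. w i \<noteq> 0"
    "\<And>z. \<mu> * quad n ident z \<le> quad n (\<lambda>i j. - B $$ (i, j)) z"
    "\<And>i. i < n \<Longrightarrow> mulv n (\<lambda>i j. - B $$ (i, j)) w i = \<mu> * mulv n ident w i"
    using rayleigh_eigenvector[OF _ sym_ident pos_def_ident \<open>n > 0\<close>] by blast
  have up: "quad n (mat_fun B) z \<le> - \<mu> * dotp n z z" for z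
    using w(2)[of z] by (simp add: quad_ident) (simp add: quad_def sum_negf)
  have "mulv n (mat_fun B) w i = - \<mu> * w i" if "i < n" for i
    using w(3)[OF that] that by (simp add: mulv_ident) (simp add: mulv_def sum_negf)
  then have mem: "- \<mu> \<in> spectrum B" using w(1) eig by blast
  have pos: "0 \<le> dotp n v v" for v by (simp add: dotp_def sum_nonneg)
  show ?thesis
  proof
    assume "lambda_max B \<le> K"
    then have "- \<mu> \<le> K" using Max_ge[OF fin mem] by (simp add: lambda_max_def)
    then show "\<forall>v. quad n (mat_fun B) v \<le> K * dotp n v v"
      using up pos by (meson mult_right_mono order_trans)
  next
    assume K: "\<forall>v. quad n (mat_fun B) v \<le> K * dotp n v v"
    have "k \<le> K" if "k \<in> spectrum B" for k
    proof -
      from iffD1[OF eig that] obtain v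
        where v: "\<exists>i<n. v i \<noteq> 0" "\<forall>i<n. mulv n (mat_fun B) v i = k * v i" by blast
      have "k * dotp n v v \<le> K * dotp n v v" using spec[OF K, of v] quad_eig[of v k] v(2) by simp
      then show ?thesis using dotp_pos[OF v(1)] by simp
    qed
    then show "lambda_max B \<le> K"
      unfolding lambda_max_def using fin mem by (intro Max.boundedI) auto
  qed
qed

text \<open>Substitute \<open>u = S v\<close>: because \<open>S * H * S\<close> is the identity, the
  squared length of \<open>v\<close> is the form of \<open>H\<close> at \<open>u\<close>, and
  \<open>S\<close> is onto.\<close>

lemma lambda_max_pencil_le_iff:
  assumes H: "H \<in> carrier_mat n n" and pd: "pd_mat H"
    and G: "G \<in> carrier_mat n n" and sym: "sym_on n (mat_fun G)" and "n > 0"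
  shows "lambda_max (mat_inv_sqrt H * G * mat_inv_sqrt H) \<le> K
    \<longleftrightarrow> (\<forall>u. quad n (mat_fun G) u \<le> K * quad n (mat_fun H) u)"
proof -
  define S where "S = mat_inv_sqrt H"
  note S = mat_inv_sqrt[OF H pd, folded S_def]
  let ?B = "S * G * S"
  have SG: "S * G \<in> carrier_mat n n" and B: "?B \<in> carrier_mat n n" using S(1) G by auto
  have SH: "S * H \<in> carrier_mat n n" and SS: "S * S \<in> carrier_mat n n" using S(1) H by auto
  have mulB: "mulv n (mat_fun (S * M * S)) v i = mulv n (mat_fun S) (mulv n (mat_fun M) (mulv n (mat_fun S) v)) i"
    if "i < n" "M \<in> carrier_mat n n" for M v i
    using mulv_mult_mat[of "S * M" n S i v] mulv_mult_mat[of S n M i] S(1) that by simp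
  have quadB: "quad n (mat_fun (S * M * S)) v = quad n (mat_fun M) (mulv n (mat_fun S) v)"
    if "M \<in> carrier_mat n n" for M v
  proof -
    have "quad n (mat_fun (S * M * S)) v
        = dotp n v (mulv n (mat_fun S) (mulv n (mat_fun M) (mulv n (mat_fun S) v)))"
      unfolding quad_eq_dotp by (rule dotp_cong) (simp_all add: mulB that)
    also have "\<dots> = dotp n (mulv n (mat_fun M) (mulv n (mat_fun S) v)) (mulv n (mat_fun S) v)"
      by (rule dotp_mulv_sym[OF S(2)])
    finally show ?thesis by (simp add: quad_eq_dotp dotp_commute)
  qed
  have norm: "dotp n v v = quad n (mat_fun H) (mulv n (mat_fun S) v)" for v
  proof -
    have "dotp n v v = quad n (mat_fun (S * H * S)) v"
      unfolding quad_eq_dotp S(4) by (rule dotp_cong) (simp_all add: mulv_one_mat)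
    then show ?thesis using quadB[OF H] by simp
  qed
  have surj: "mulv n (mat_fun S) (mulv n (mat_fun (S * H)) u) i = u i" if "i < n" for u i
  proof -
    have "mulv n (mat_fun S) (mulv n (mat_fun (S * H)) u) i = mulv n (mat_fun (S * (S * H))) u i"
      using mulv_mult_mat[OF S(1) SH that] by simp
    also have "S * (S * H) = 1\<^sub>m n" using S(3) assoc_mult_mat[OF S(1) S(1) H] by simp
    finally show ?thesis using that by (simp add: mulv_one_mat)
  qed
  have "sym_on n (mat_fun ?B)"
  proof -
    have "?B\<^sup>T = S\<^sup>T * (S * G)\<^sup>T" by (rule transpose_mult[OF SG S(1)])
    also have "(S * G)\<^sup>T = G\<^sup>T * S\<^sup>T" by (rule transpose_mult[OF S(1) G])
    finally have "?B\<^sup>T = S * (G * S)"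
      using S(1,2) G sym by (simp add: sym_on_mat_fun)
    also have "\<dots> = ?B" using assoc_mult_mat[OF S(1) G S(1)] by simp
    finally show ?thesis by (simp add: sym_on_mat_fun[OF B])
  qed
  from lambda_max_le_iff[OF B this \<open>n > 0\<close>]
  have "lambda_max ?B \<le> K \<longleftrightarrow> (\<forall>v. quad n (mat_fun G) (mulv n (mat_fun S) v)
      \<le> K * quad n (mat_fun H) (mulv n (mat_fun S) v))"
    by (simp add: quadB[OF G] norm)
  also have "\<dots> \<longleftrightarrow> (\<forall>u. quad n (mat_fun G) u \<le> K * quad n (mat_fun H) u)"
  proof (intro iffI allI)
    fix u assume "\<forall>v. quad n (mat_fun G) (mulv n (mat_fun S) v)
      \<le> K * quad n (mat_fun H) (mulv n (mat_fun S) v)"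
    \<comment> \<open>\<open>v = S H u\<close> is the preimage of \<open>u\<close>, as
      \<open>S * (S * H)\<close> is the identity.\<close>
    note le = spec[OF this, of "mulv n (mat_fun (S * H)) u"]
    show "quad n (mat_fun G) u \<le> K * quad n (mat_fun H) u"
    proof -
      have "quad n M (mulv n (mat_fun S) (mulv n (mat_fun (S * H)) u)) = quad n M u" for M
        by (rule quad_cong) (simp_all add: surj)
      with le show ?thesis by simp
    qed
  qed blast
  finally show ?thesis unfolding S_def .
qed

subsection \<open>Entrywise preservers\<close>

lemma deriv_family_Ck_on:
  assumes "Ck_on m f S" shows "deriv_family m (\<lambda>r. (deriv ^^ r) f) S"
  using assms unfolding Ck_on_def deriv_family_def
  by (auto simp: DERIV_deriv_iff_field_differentiable)

text \<open>The iterates of \<open>euler\<close> are built with \<open>deriv\<close>, which depends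
  only on values near the point; agreement on the open set \<open>S\<close> therefore passes from
  order \<open>k\<close> to the next.\<close>

lemma euler_funpow_eq:
  assumes f: "Ck_on m f S" and "open S" "k \<le> m" "x \<in> S"
  shows "(euler ^^ k) f x = euler_family (\<lambda>r. (deriv ^^ r) f) k x"
  using assms(3,4)
proof (induction k arbitrary: x)
  case 0
  then show ?case by simp
next
  case (Suc k)
  let ?F = "\<lambda>r. (deriv ^^ r) f"
  have "((euler ^^ k) f has_real_derivative
      (\<Sum>j\<le>k. real (Stirling k j) * (real j * x ^ (j - 1) * ?F j x + x ^ j * ?F (Suc j) x))) (at x)"
  proof (rule has_field_derivative_transform_within_open[OF _ \<open>open S\<close> \<open>x \<in> S\<close>])
    show "(euler_family ?F k has_real_derivative
      (\<Sum>j\<le>k. real (Stirling k j) * (real j * x ^ (j - 1) * ?F j x + x ^ j * ?F (Suc j) x))) (at x)"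
      by (rule euler_family_has_derivative[OF deriv_family_Ck_on[OF f]]) (use Suc.prems in auto)
    show "euler_family ?F k y = (euler ^^ k) f y" if "y \<in> S" for y
      using Suc that by simp
  qed
  from DERIV_imp_deriv[OF this] show ?case
    unfolding euler_family_Suc by (simp add: euler_def[of "(euler ^^ k) f"])
qed

lemma euler_family_linear:
  "euler_family (\<lambda>r x. a * F r x - G r x) k x = a * euler_family F k x - euler_family G k x"
  by (simp add: euler_family_def algebra_simps sum_subtractf sum_distrib_left)

lemma euler_hankel_nonneg_of_preserves_psd:
  assumes "open I" and F: "deriv_family (2 * n - 2) F I"
    and pres: "\<And>A c. sym_on n A \<Longrightarrow> (\<And>c. 0 \<le> quad n A c) \<Longrightarrow> (\<And>i j. i < n \<Longrightarrow> j < n \<Longrightarrow> A i j \<in> I)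
      \<Longrightarrow> 0 \<le> quad n (\<lambda>i j. F 0 (A i j)) c"
    and "x \<in> I" "0 < x"
  shows "0 \<le> quad n (\<lambda>i j. euler_family F (i + j) x) c"
proof -
  let ?J = "{s. exp s \<in> I}"
  let ?P = "\<lambda>k s. euler_family F k (exp s)"
  have "?J = exp -` I" by auto
  then have oJ: "open ?J" using \<open>open I\<close> by (simp add: open_vimage continuous_on_exp)
  have "0 \<le> (\<Sum>i<n. \<Sum>j<n. c i * c j * ?P (i + j + 0) (ln x))"
  proof (rule hankel_nonneg_of_kernel[where F = ?P and S = ?J and p = 0])
    show "deriv_family (2 * n - 2 + 0) ?P ?J" using deriv_family_exp[OF F] by simp
    show "open ?J" by (rule oJ)
    show xJ: "ln x \<in> ?J" using assms by simp
    obtain e where e: "e > 0" "ball (ln x) e \<subseteq> ?J" using oJ xJ by (meson openE)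
    have "\<forall>\<^sub>F d in at_right 0. 0 < d \<and> d < e / (2 * real n + 1)"
      using e by (auto simp: eventually_at_right intro!: exI[of _ "e / (2 * real n + 1)"])
    then show "\<forall>\<^sub>F d in at_right 0. \<forall>q. 0 \<le> (\<Sum>i<n. \<Sum>j<n. q i * q j * (fdiff d ^^ 0) (?P 0) (ln x + real (i + j) * d))"
    proof (rule eventually_mono, intro allI)
      fix d q assume d: "0 < d \<and> d < e / (2 * real n + 1)"
      then have de: "(2 * real n + 1) * d < e"
        using pos_less_divide_eq[of "2 * real n + 1" d e] by (simp add: mult.commute)
      \<comment> \<open>Halving \<open>ln x\<close> makes the rank one matrix
        \<open>z i * z j\<close> have entries \<open>exp (ln x + (i + j) d)\<close>, a kernel in
        arithmetic progression near \<open>ln x\<close>.\<close>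
      define z where "z i = exp (ln x / 2 + real i * d)" for i
      have zz: "z i * z j = exp (ln x + real (i + j) * d)" for i j
        by (simp add: z_def exp_add[symmetric] algebra_simps)
      have zI: "z i * z j \<in> I" if "i < n" "j < n" for i j
      proof -
        have "real (i + j) * d \<le> (2 * real n + 1) * d" using that d by (intro mult_right_mono) auto
        then have "real (i + j) * d < e" using de by (rule le_less_trans)
        then have "ln x + real (i + j) * d \<in> ball (ln x) e"
          using d by (simp add: dist_real_def)
        then show ?thesis using e(2) by (auto simp: zz)
      qed
      have "0 \<le> quad n (\<lambda>i j. F 0 (z i * z j)) q"
        by (rule pres) (auto simp: sym_on_def mult.commute quad_rank_one zI)
      then show "0 \<le> (\<Sum>i<n. \<Sum>j<n. q i * q j * (fdiff d ^^ 0) (?P 0) (ln x + real (i + j) * d))"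
        by (simp add: quad_def zz)
    qed
  qed
  then show ?thesis using \<open>0 < x\<close> by (simp add: quad_def)
qed

lemma deriv_nonneg_of_preserves_psd:
  assumes "open I" and F: "deriv_family r F I" and "r < n"
    and pres: "\<And>A c. sym_on n A \<Longrightarrow> (\<And>c. 0 \<le> quad n A c) \<Longrightarrow> (\<And>i j. i < n \<Longrightarrow> j < n \<Longrightarrow> A i j \<in> I)
      \<Longrightarrow> 0 \<le> quad n (\<lambda>i j. F 0 (A i j)) c"
    and "a \<in> I" "0 < a"
  shows "0 \<le> F r a"
proof (rule deriv_nonneg_of_product_kernel[OF F \<open>open I\<close> \<open>a \<in> I\<close> \<open>r < n\<close>])
  obtain e where e: "e > 0" "ball a e \<subseteq> I" using \<open>open I\<close> \<open>a \<in> I\<close> by (meson openE)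
  have "\<forall>\<^sub>F t in at_right 0. 0 < t \<and> t < e / (real n * real n + 1)"
    using e by (auto simp: eventually_at_right add_nonneg_pos intro!: exI[of _ "e / (real n * real n + 1)"])
  then show "\<forall>\<^sub>F t in at_right 0. \<forall>v. 0 \<le> (\<Sum>k<n. \<Sum>l<n. v k * v l * F 0 (a + t * real k * real l))"
  proof (rule eventually_mono, intro allI)
    fix t v assume t: "0 < t \<and> t < e / (real n * real n + 1)"
    have "0 < real n * real n + 1" by (simp add: add_nonneg_pos)
    then have te: "t * (real n * real n + 1) < e"
      using t pos_less_divide_eq[of "real n * real n + 1" t e] by simp
    have "0 \<le> quad n (\<lambda>k l. F 0 (a + t * real k * real l)) v"
    proof (rule pres)
      show "sym_on n (\<lambda>k l. a + t * real k * real l)" by (simp add: sym_on_def)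
      show "0 \<le> quad n (\<lambda>k l. a + t * real k * real l) c" for c
      proof -
        \<comment> \<open>The test matrix is a sum of two rank one matrices with the weights
          \<open>a\<close> and \<open>t\<close>, both positive.\<close>
        have "quad n (\<lambda>k l. a * (1 * 1) + t * (real k * real l)) c
            = a * (dotp n c (\<lambda>_. 1))\<^sup>2 + t * (dotp n c real)\<^sup>2"
          unfolding quad_linear quad_rank_one ..
        then show ?thesis using t \<open>0 < a\<close> by (simp add: mult.assoc)
      qed
      show "a + t * real k * real l \<in> I" if "k < n" "l < n" for k l
      proof -
        have "real k * real l \<le> real n * real n + 1"
          using mult_mono[of "real k" "real n" "real l" "real n"] that by simp
        then have "t * (real k * real l) \<le> t * (real n * real n + 1)"
          using t by (intro mult_left_mono) auto
        then have "t * (real k * real l) < e" using te by (rule le_less_trans)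
        then have "a + t * (real k * real l) \<in> ball a e"
          using t by (simp add: dist_real_def)
        then show ?thesis using e(2) by (auto simp: mult.assoc)
      qed
    qed
    then show "0 \<le> (\<Sum>k<n. \<Sum>l<n. v k * v l * F 0 (a + t * real k * real l))"
      by (simp add: quad_def)
  qed
qed

lemma preserves_psd_iff:
  assumes "open I" and pos: "\<And>x. x \<in> I \<Longrightarrow> 0 < x"
    and down: "\<And>x y. x \<in> I \<Longrightarrow> 0 < y \<Longrightarrow> y \<le> x \<Longrightarrow> y \<in> I"
    and F: "deriv_family (2 * n - 2) F I" and "n \<ge> 1"
  shows "(\<forall>A c. sym_on n A \<longrightarrow> (\<forall>c. 0 \<le> quad n A c) \<longrightarrow> (\<forall>i<n. \<forall>j<n. A i j \<in> I)
        \<longrightarrow> 0 \<le> quad n (\<lambda>i j. F 0 (A i j)) c)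
    \<longleftrightarrow> (\<forall>x\<in>I. (\<forall>r<n. 0 \<le> F r x) \<and> (\<forall>c. 0 \<le> quad n (\<lambda>i j. euler_family F (i + j) x) c))"
    (is "?lhs \<longleftrightarrow> ?rhs")
proof
  assume ?lhs
  then have pres: "0 \<le> quad n (\<lambda>i j. F 0 (A i j)) c"
    if "sym_on n A" "\<And>c. 0 \<le> quad n A c" "\<And>i j. i < n \<Longrightarrow> j < n \<Longrightarrow> A i j \<in> I" for A c
    using that by blast
  show ?rhs
  proof (intro ballI conjI allI impI)
    fix x r assume x: "x \<in> I" and "r < n"
    then have "deriv_family r F I" by (intro deriv_family_mono[OF F]) auto
    from deriv_nonneg_of_preserves_psd[OF \<open>open I\<close> this \<open>r < n\<close> pres x pos[OF x]]
    show "0 \<le> F r x" by blast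
  next
    fix x c assume x: "x \<in> I"
    from euler_hankel_nonneg_of_preserves_psd[OF \<open>open I\<close> F pres x pos[OF x]]
    show "0 \<le> quad n (\<lambda>i j. euler_family F (i + j) x) c" by blast
  qed
next
  assume r: ?rhs
  let ?J = "{s. exp s \<in> I}"
  let ?P = "\<lambda>k s. euler_family F k (exp s)"
  have "?J = exp -` I" by auto
  then have oJ: "open ?J" using \<open>open I\<close> by (simp add: open_vimage continuous_on_exp)
  have iJ: "is_interval ?J"
    unfolding is_interval_1
  proof (intro ballI allI impI)
    fix a b x :: real assume "b \<in> ?J" "a \<le> x \<and> x \<le> b"
    then show "x \<in> ?J" using down[of "exp b" "exp x"] by simp
  qed
  have ker: "0 \<le> quad n (\<lambda>i j. F 0 (z i * z j)) c"
    if z: "\<And>i. i < n \<Longrightarrow> 0 < z i" "\<And>i j. i < n \<Longrightarrow> j < n \<Longrightarrow> z i * z j \<in> I" for z c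
  proof -
    have "0 \<le> quad n (\<lambda>i j. ?P 0 (ln (z i) + ln (z j))) c"
    proof (rule kernel_nonneg_of_hankel[OF deriv_family_exp[OF F] oJ iJ])
      show "0 \<le> quad n (\<lambda>i j. ?P (i + j) x) c" if "x \<in> ?J" for x c using r that by auto
      show "ln (z i) + ln (z j) \<in> ?J" if "i < n" "j < n" for i j
        using z that by (simp add: exp_add)
    qed
    also have "\<dots> = quad n (\<lambda>i j. F 0 (z i * z j)) c"
      by (rule quad_cong) (use z in \<open>simp_all add: exp_add\<close>)
    finally show ?thesis .
  qed
  show ?lhs
  proof (intro allI impI)
    fix A c assume A: "sym_on n A" "\<forall>c. 0 \<le> quad n A c" "\<forall>i<n. \<forall>j<n. A i j \<in> I"
    show "0 \<le> quad n (\<lambda>i j. F 0 (A i j)) c"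
      by (rule preserves_psd[OF \<open>open I\<close> pos down F _ ker A(1)]) (use r A in auto)
  qed
qed

text \<open>Symmetry of the difference is inherited from \<open>A\<close>, so the Loewner inequality
  reduces to its quadratic form, and matrices can be traded for functions of two indices.\<close>

lemma loewner_preserver_iff:
  fixes g h :: "real \<Rightarrow> real"
  shows "(\<forall>A \<in> psd_mats_in n I. map_mat g A \<preceq>\<^sub>L K \<cdot>\<^sub>m map_mat h A) \<longleftrightarrow>
    (\<forall>A c. sym_on n A \<longrightarrow> (\<forall>c. 0 \<le> quad n A c) \<longrightarrow> (\<forall>i<n. \<forall>j<n. A i j \<in> I)
        \<longrightarrow> 0 \<le> quad n (\<lambda>i j. K * h (A i j) - g (A i j)) c)"
proof -
  have le: "map_mat g A \<preceq>\<^sub>L K \<cdot>\<^sub>m map_mat h A \<longleftrightarrow>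
      (\<forall>c. 0 \<le> quad n (\<lambda>i j. K * h (A $$ (i, j)) - g (A $$ (i, j))) c)"
    if A: "A \<in> carrier_mat n n" and sym: "sym_on n (mat_fun A)" for A
  proof -
    let ?D = "K \<cdot>\<^sub>m map_mat h A - map_mat g A"
    have D: "?D \<in> carrier_mat n n" by (rule minus_carrier_mat) (use A in simp)
    have Dij: "?D $$ (i, j) = K * h (A $$ (i, j)) - g (A $$ (i, j))" if "i < n" "j < n" for i j
      using A that by simp
    have "sym_on n (mat_fun ?D)" using sym by (simp add: sym_on_def Dij del: index_minus_mat)
    moreover have "quad n (mat_fun ?D) c = quad n (\<lambda>i j. K * h (A $$ (i, j)) - g (A $$ (i, j))) c" for c
      by (rule quad_cong[OF Dij]) auto
    ultimately show ?thesis
      using A unfolding loewner_le_def psd_mat_iff[OF D] by simp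
  qed
  show ?thesis (is "?l \<longleftrightarrow> ?r")
  proof
    assume l: ?l
    show ?r
    proof (intro allI impI)
      fix A c assume A: "sym_on n A" "\<forall>c. 0 \<le> quad n A c" "\<forall>i<n. \<forall>j<n. A i j \<in> I"
      define M where "M = mat n n (\<lambda>(i, j). A i j)"
      have M: "M \<in> carrier_mat n n" and Mij: "\<And>i j. i < n \<Longrightarrow> j < n \<Longrightarrow> M $$ (i, j) = A i j"
        by (simp_all add: M_def)
      have sM: "sym_on n (mat_fun M)" using A(1) by (simp add: sym_on_def Mij)
      have "quad n (mat_fun M) b = quad n A b" for b by (rule quad_cong) (simp_all add: Mij)
      then have "M \<in> psd_mats_in n I"
        using M sM A by (simp add: psd_mats_in_def psd_mat_iff[OF M] Mij)
      then have "0 \<le> quad n (\<lambda>i j. K * h (M $$ (i, j)) - g (M $$ (i, j))) c"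
        using l le[OF M sM] by blast
      also have "\<dots> = quad n (\<lambda>i j. K * h (A i j) - g (A i j)) c"
        by (rule quad_cong) (simp_all add: Mij)
      finally show "0 \<le> quad n (\<lambda>i j. K * h (A i j) - g (A i j)) c" .
    qed
  next
    assume r: ?r
    show ?l
    proof
      fix A assume "A \<in> psd_mats_in n I"
      then have A: "A \<in> carrier_mat n n" "psd_mat A" "\<forall>i<n. \<forall>j<n. A $$ (i, j) \<in> I"
        by (auto simp: psd_mats_in_def)
      then show "map_mat g A \<preceq>\<^sub>L K \<cdot>\<^sub>m map_mat h A"
        using r le[OF A(1)] by (simp add: psd_mat_iff[OF A(1)])
    qed
  qed
qed

text \<open>\<open>K \<ge> 0\<close> absorbs the entry 0 of the maximum, and positivity of the
  derivatives of \<open>h\<close> clears the denominators; the supremum becomes pointwise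
  inequalities.\<close>

lemma K_const_le_iff:
  assumes "n \<ge> 1" "0 \<le> K" and pos: "\<And>x r. x \<in> I \<Longrightarrow> r \<le> n - 1 \<Longrightarrow> (deriv ^^ r) h x > 0"
  shows "K_const n h g I \<le> ereal K \<longleftrightarrow>
    (\<forall>x\<in>I. (\<forall>r<n. (deriv ^^ r) g x \<le> K * (deriv ^^ r) h x) \<and> gamma_const n h g x \<le> K)"
proof -
  have "Max ((\<lambda>r. (deriv ^^ r) g x / (deriv ^^ r) h x) ` {0..n-1}) \<le> K
      \<longleftrightarrow> (\<forall>r<n. (deriv ^^ r) g x \<le> K * (deriv ^^ r) h x)" if x: "x \<in> I" for x
  proof -
    have "Max ((\<lambda>r. (deriv ^^ r) g x / (deriv ^^ r) h x) ` {0..n-1}) \<le> K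
      \<longleftrightarrow> (\<forall>r\<le>n - 1. (deriv ^^ r) g x / (deriv ^^ r) h x \<le> K)" by auto
    also have "\<dots> \<longleftrightarrow> (\<forall>r\<le>n - 1. (deriv ^^ r) g x \<le> K * (deriv ^^ r) h x)"
      using pos[OF x] by (auto simp: pos_divide_le_eq)
    also have "\<dots> \<longleftrightarrow> (\<forall>r<n. (deriv ^^ r) g x \<le> K * (deriv ^^ r) h x)"
    proof -
      have "r \<le> n - 1 \<longleftrightarrow> r < n" for r using \<open>n \<ge> 1\<close> by auto
      then show ?thesis by simp
    qed
    finally show ?thesis .
  qed
  then show ?thesis
    unfolding K_const_def SUP_le_iff using \<open>0 \<le> K\<close> by auto
qed

text \<open>\<open>euler_family\<close> is linear in the family, so the pencil inequality between
  the Hankel forms of \<open>g\<close> and \<open>h\<close> is semidefiniteness of the Hankel matrix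
  of K h - g.\<close>

lemma gamma_const_le_iff:
  assumes "open I" "x \<in> I" "n \<ge> 1"
    and g: "Ck_on (2 * n - 2) g I" and h: "Ck_on (2 * n - 2) h I"
    and pd: "pd_mat (hankel_euler n h x)"
  shows "gamma_const n h g x \<le> K \<longleftrightarrow> (\<forall>c. 0 \<le> quad n (\<lambda>i j.
      euler_family (\<lambda>r x. K * (deriv ^^ r) h x - (deriv ^^ r) g x) (i + j) x) c)"
proof -
  have c: "hankel_euler n f x \<in> carrier_mat n n" for f by (simp add: hankel_euler_def)
  have "sym_on n (mat_fun (hankel_euler n g x))"
    by (simp add: sym_on_def hankel_euler_def add.commute)
  from lambda_max_pencil_le_iff[OF c pd c this] \<open>n \<ge> 1\<close>
  have "gamma_const n h g x \<le> K \<longleftrightarrow>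
      (\<forall>u. quad n (mat_fun (hankel_euler n g x)) u \<le> K * quad n (mat_fun (hankel_euler n h x)) u)"
    by (simp add: gamma_const_def)
  also have "\<dots> \<longleftrightarrow> (\<forall>u. 0 \<le> quad n (\<lambda>i j.
      euler_family (\<lambda>r x. K * (deriv ^^ r) h x - (deriv ^^ r) g x) (i + j) x) u)"
  proof -
    have q: "quad n (mat_fun (hankel_euler n f x)) u
        = quad n (\<lambda>i j. euler_family (\<lambda>r. (deriv ^^ r) f) (i + j) x) u"
      if "Ck_on (2 * n - 2) f I" for f u
      by (rule quad_cong)
        (simp_all add: hankel_euler_def euler_funpow_eq[OF that \<open>open I\<close> _ \<open>x \<in> I\<close>])
    have "quad n (\<lambda>i j. euler_family (\<lambda>r x. K * (deriv ^^ r) h x - (deriv ^^ r) g x) (i + j) x) u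
      = K * quad n (mat_fun (hankel_euler n h x)) u - quad n (mat_fun (hankel_euler n g x)) u" for u
      unfolding q[OF g] q[OF h] euler_family_linear
      using quad_linear[where a = K and b = "-1"] by simp
    then show ?thesis by simp
  qed
  finally show ?thesis .
qed

theorem theorem6p1:
  fixes n :: nat and \<rho> :: ereal and g h :: "real \<Rightarrow> real" and I :: "real set"
  assumes n: "n \<ge> 1"
    and rho: "0 < \<rho>"
    and I: "I = einterval 0 \<rho>"
    and g: "Ck_on (2 * n - 2) g I"
    and h: "Ck_on (2 * n - 2) h I"
    and hankel_pd: "\<And>x. x \<in> I \<Longrightarrow> pd_mat (hankel_euler n h x)"
    and deriv_pos: "\<And>x r. x \<in> I \<Longrightarrow> r \<le> n - 1 \<Longrightarrow> (deriv ^^ r) h x > 0"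
  shows "(\<forall>K::real. K \<ge> 0 \<longrightarrow>
            (\<forall>A \<in> psd_mats_in n I. map_mat g A \<preceq>\<^sub>L K \<cdot>\<^sub>m map_mat h A)
            \<longleftrightarrow> ereal K \<ge> K_const n h g I)
       \<and> ((\<exists>K::real. K \<ge> 0 \<and> (\<forall>A \<in> psd_mats_in n I. map_mat g A \<preceq>\<^sub>L K \<cdot>\<^sub>m map_mat h A))
            \<longleftrightarrow> K_const n h g I < \<infinity>)"
proof -
  have oI: "open I" unfolding I by simp
  have pos: "0 < x" if "x \<in> I" for x using that unfolding I by (simp add: einterval_def)
  have down: "y \<in> I" if "x \<in> I" "0 < y" "y \<le> x" for x y
    using that unfolding I by (auto simp: einterval_def intro: le_less_trans[of "ereal y" "ereal x"])
  have main: "(\<forall>A \<in> psd_mats_in n I. map_mat g A \<preceq>\<^sub>L K \<cdot>\<^sub>m map_mat h A)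
      \<longleftrightarrow> ereal K \<ge> K_const n h g I" if K: "K \<ge> 0" for K
  proof -
    let ?F = "\<lambda>r x. K * (deriv ^^ r) h x - (deriv ^^ r) g x"
    have F: "deriv_family (2 * n - 2) ?F I"
      using deriv_family_Ck_on[OF g] deriv_family_Ck_on[OF h] unfolding deriv_family_def
      by (auto intro!: DERIV_diff DERIV_cmult continuous_intros)
    have "(\<forall>A \<in> psd_mats_in n I. map_mat g A \<preceq>\<^sub>L K \<cdot>\<^sub>m map_mat h A) \<longleftrightarrow>
      (\<forall>x\<in>I. (\<forall>r<n. 0 \<le> ?F r x) \<and> (\<forall>c. 0 \<le> quad n (\<lambda>i j. euler_family ?F (i + j) x) c))"
      unfolding loewner_preserver_iff using preserves_psd_iff[OF oI pos down F n] by simp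
    also have "\<dots> \<longleftrightarrow>
      (\<forall>x\<in>I. (\<forall>r<n. (deriv ^^ r) g x \<le> K * (deriv ^^ r) h x) \<and> gamma_const n h g x \<le> K)"
      using gamma_const_le_iff[OF oI _ n g h hankel_pd] by simp
    also have "\<dots> \<longleftrightarrow> K_const n h g I \<le> ereal K"
      using K_const_le_iff[OF n K deriv_pos] by simp
    finally show ?thesis .
  qed
  moreover have "(\<exists>K::real. K \<ge> 0 \<and> K_const n h g I \<le> ereal K) \<longleftrightarrow> K_const n h g I < \<infinity>"
  proof
    assume "K_const n h g I < \<infinity>"
    then obtain r where r: "K_const n h g I \<le> ereal r" by (cases "K_const n h g I") auto
    also have "ereal r \<le> ereal (max r 0)" by simp
    finally show "\<exists>K::real. K \<ge> 0 \<and> K_const n h g I \<le> ereal K"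
      by (intro exI[of _ "max r 0"]) auto
  qed auto
  ultimately show ?thesis by (metis (no_types, lifting))
qed

end
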